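(* For every undirected unweighted graph $G=(V,E)$ with $n$ nodes and $m$ edges and every integer $f\geq 1$, there is a randomized $\widetilde{O}(f\,n\,m)$-time construction of a $+2$-additive $f$-FT spanner of $G$ with $\widetilde{O}\left(f\cdot n^{2-1/(2^f+1)}\right)$ edges, which succeeds with high probability.
   Context: A subgraph $H\subseteq G$ is a $+2$-additive $f$-FT spanner of $G$ if $\mathrm{dist}_{H\setminus F}(u,v)\leq \mathrm{dist}_{G\setminus F}(u,v)+2$ for all $u,v\in V$ and every fault set $F$ of size at most $f$. "With high probability" means with probability at least $1-1/n^c$ for an arbitrary constant $c\geq 2$. $\widetilde{O}$ hides polylogarithmic factors in $n$. *)

theory Defs
  imports "HOL-Probability.Probability" "HOL-Library.Extended_Nat"
begin

section \<open>Graphs, distances and fault-tolerant additive spanners\<close>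

text \<open>A finite simple undirected graph is a vertex set together with a set of two-element
  edges. All subgraphs below are spanning, so they are given by their edge sets.\<close>

definition simple_graph :: "'a set \<Rightarrow> 'a set set \<Rightarrow> bool" where
  "simple_graph V E \<longleftrightarrow> finite V \<and> (\<forall>e\<in>E. e \<subseteq> V \<and> card e = 2)"

definition walks :: "'a set set \<Rightarrow> 'a \<Rightarrow> 'a \<Rightarrow> 'a list set" where
  "walks E u v =
     {p. p \<noteq> [] \<and> hd p = u \<and> last p = v \<and> successively (\<lambda>x y. {x, y} \<in> E) p}"

text \<open>A walk with \<open>k\<close> edges is a list of \<open>k + 1\<close> vertices; the distance between vertices
  that are not connected is \<open>\<infinity>\<close>.\<close>

definition gdist :: "'a set set \<Rightarrow> 'a \<Rightarrow> 'a \<Rightarrow> enat" where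
  "gdist E u v = (INF p\<in>walks E u v. enat (length p - 1))"

text \<open>The faults are edges.\<close>

definition additive_FT_spanner ::
    "nat \<Rightarrow> nat \<Rightarrow> 'a set \<Rightarrow> 'a set set \<Rightarrow> 'a set set \<Rightarrow> bool" where
  "additive_FT_spanner \<beta> f V E H \<longleftrightarrow>
     H \<subseteq> E \<and>
     (\<forall>F u v. F \<subseteq> E \<and> card F \<le> f \<and> u \<in> V \<and> v \<in> V \<longrightarrow>
        gdist (H - F) u v \<le> gdist (E - F) u v + enat \<beta>)"


section \<open>Soft-O\<close>

text \<open>\<open>soft_O D N h\<close> is the class of functions bounded on the parameter set \<open>D\<close> by \<open>h\<close> up to
  a constant and a polylogarithmic factor in \<open>N\<close> (which is at least \<open>1\<close> on \<open>D\<close> wherever this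
  is used). The constant and the exponent are uniform in all parameters; \<open>1 + ln N\<close> is used
  instead of \<open>ln N\<close> because the latter vanishes at \<open>N = 1\<close>.\<close>

definition soft_O :: "'i set \<Rightarrow> ('i \<Rightarrow> nat) \<Rightarrow> ('i \<Rightarrow> real) \<Rightarrow> ('i \<Rightarrow> real) set" where
  "soft_O D N h = {g. \<exists>C k. \<forall>x\<in>D. g x \<le> C * (1 + ln (real (N x))) ^ k * h x}"


section \<open>A randomized word RAM\<close>

text \<open>The machine has registers and arrays (both named by constants of the program, so that a
  program uses only finitely many of them) holding words of \<open>w\<close> bits. Every step of the
  small-step semantics costs one unit of time. Since a program is fixed independently of the
  input, evaluating one of its expressions amounts to a constant number of elementary word
  operations.\<close>

datatype exp =
    Const nat
  | Reg nat
  | Cell nat exp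
  | Add exp exp
  | Sub exp exp
  | Mul exp exp
  | Div exp exp
  | Mod exp exp
  | Less exp exp
  | Eq exp exp

datatype prog =
    Set_Reg nat exp
  | Set_Cell nat exp exp
  | Random nat
  | Seq prog prog
  | If exp prog prog
  | While exp prog

record state =
  reg :: "nat \<Rightarrow> nat"
  arr :: "nat \<Rightarrow> nat \<Rightarrow> nat"

text \<open>Operations that may leave the range of words are reduced modulo \<open>2 ^ w\<close>; subtraction
  is truncated at \<open>0\<close>.\<close>

fun val :: "nat \<Rightarrow> state \<Rightarrow> exp \<Rightarrow> nat" where
  "val w s (Const k) = k mod 2 ^ w"
| "val w s (Reg x) = reg s x"
| "val w s (Cell a e) = arr s a (val w s e)"
| "val w s (Add d e) = (val w s d + val w s e) mod 2 ^ w"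
| "val w s (Sub d e) = val w s d - val w s e"
| "val w s (Mul d e) = (val w s d * val w s e) mod 2 ^ w"
| "val w s (Div d e) = val w s d div val w s e"
| "val w s (Mod d e) = val w s d mod val w s e"
| "val w s (Less d e) = of_bool (val w s d < val w s e)"
| "val w s (Eq d e) = of_bool (val w s d = val w s e)"

definition set_reg :: "nat \<Rightarrow> nat \<Rightarrow> state \<Rightarrow> state" where
  "set_reg x k s = s\<lparr>reg := (reg s)(x := k)\<rparr>"

definition set_cell :: "nat \<Rightarrow> nat \<Rightarrow> nat \<Rightarrow> state \<Rightarrow> state" where
  "set_cell a i k s = s\<lparr>arr := (arr s)(a := (arr s a)(i := k))\<rparr>"

text \<open>A configuration consists of the programs that remain to be executed and the state. The
  machine has halted when no program remains; halted configurations are stationary. The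
  instruction \<^const>\<open>Random\<close> draws a fresh uniformly distributed word.\<close>

type_synonym config = "prog list \<times> state"

fun step :: "nat \<Rightarrow> config \<Rightarrow> config pmf" where
  "step w ([], s) = return_pmf ([], s)"
| "step w (Set_Reg x e # ps, s) = return_pmf (ps, set_reg x (val w s e) s)"
| "step w (Set_Cell a d e # ps, s) = return_pmf (ps, set_cell a (val w s d) (val w s e) s)"
| "step w (Random x # ps, s) = map_pmf (\<lambda>k. (ps, set_reg x k s)) (pmf_of_set {..<2 ^ w})"
| "step w (Seq p q # ps, s) = return_pmf (p # q # ps, s)"
| "step w (If e p q # ps, s) = return_pmf ((if val w s e \<noteq> 0 then p else q) # ps, s)"
| "step w (While e p # ps, s) =
     return_pmf (if val w s e \<noteq> 0 then p # While e p # ps else ps, s)"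

definition halted :: "config \<Rightarrow> bool" where
  "halted cfg \<longleftrightarrow> fst cfg = []"

text \<open>The distribution of the configuration after \<open>t\<close> steps.\<close>

primrec run :: "nat \<Rightarrow> nat \<Rightarrow> config \<Rightarrow> config pmf" where
  "run w 0 cfg = return_pmf cfg"
| "run w (Suc t) cfg = bind_pmf (step w cfg) (run w t)"

text \<open>Words have \<open>\<kappa> log (n + f)\<close> bits for a constant \<open>\<kappa>\<close>, as usual for a word RAM whose input
  consists of a graph on \<open>n\<close> vertices and a number \<open>f\<close>.\<close>

definition word_length :: "nat \<Rightarrow> nat \<Rightarrow> nat \<Rightarrow> nat" where
  "word_length \<kappa> n f = \<kappa> * nat \<lceil>log 2 (real (n + f + 2))\<rceil>"


section \<open>Input and output\<close>

text \<open>A graph on \<open>{..<n}\<close> is presented to the machine by an arbitrary listing of its edges, each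
  edge occurring exactly once and in one arbitrary orientation.\<close>

definition lists_edges :: "(nat \<times> nat) list \<Rightarrow> nat set set \<Rightarrow> bool" where
  "lists_edges es E \<longleftrightarrow> (\<lambda>(u, v). {u, v}) ` set es = E \<and> length es = card E"

text \<open>Registers \<open>0\<close>, \<open>1\<close>, \<open>2\<close> initially hold \<open>n\<close>, \<open>m\<close>, \<open>f\<close>, and arrays \<open>0\<close>, \<open>1\<close> hold the two
  endpoints of the listed edges; everything else is \<open>0\<close>.\<close>

definition input_state :: "nat \<Rightarrow> nat \<Rightarrow> (nat \<times> nat) list \<Rightarrow> state" where
  "input_state n f es =
     \<lparr>reg = (\<lambda>_. 0)(0 := n, 1 := length es, 2 := f),
      arr = (\<lambda>_ _. 0)
        (0 := (\<lambda>i. if i < length es then fst (es ! i) else 0),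
         1 := (\<lambda>i. if i < length es then snd (es ! i) else 0))\<rparr>"

text \<open>The output is read in the same format: register \<open>1\<close> holds the length of the edge list
  stored in arrays \<open>0\<close> and \<open>1\<close>.\<close>

definition output_edges :: "config \<Rightarrow> nat set set" where
  "output_edges cfg =
     (let s = snd cfg in (\<lambda>i. {arr s 0 i, arr s 1 i}) ` {..<reg s 1})"

end

theory Submission
  imports Defs
begin

text \<open>The construction is deterministic. A vertex is saturated if it is adjacent to \<open>f + 1\<close> cluster
  centers; greedily chosen centers leave few edges with an unsaturated endpoint, and all of these are
  kept. If a shortest path in \<open>G - F\<close> uses an edge that is not kept, then an endpoint of this edge
  is adjacent to a center in \<open>G - F\<close>, and the detour via this center costs at most \<open>2\<close>. So it is enough
  to preserve the distances between the set \<open>C\<close> of centers and all vertices \<open>v\<close> under \<open>f\<close> faults.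

  For a fixed \<open>v\<close>, this is done in \<open>f + 1\<close> rounds that maintain a set \<open>S\<close> of vertices, initially
  \<open>C - {v}\<close>. A round computes a breadth-first search tree from \<open>v\<close> that does not expand the
  vertices of \<open>S\<close>, chooses a radius \<open>k\<close>, and adds to \<open>S\<close> the part of the tree paths from \<open>S\<close> to \<open>v\<close> within
  distance \<open>k\<close> of \<open>v\<close> and the whole layer at distance \<open>k\<close>. Consider the part of a shortest
  path in \<open>G - F\<close> after its last visit to \<open>S\<close>. If the tree path from the same vertex is free of
  faults, then it is a substitute. Otherwise it contains a fault, and this fault is out of the reach of the
  next round: it either joins two vertices of the new \<open>S\<close> or lies beyond the new layer. Hence
  no fault remains after \<open>f\<close> rounds, and it is enough to keep the edges between \<open>v\<close> and the final \<open>S\<close>.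

  With the least \<open>k\<close> such that the layer has at most \<open>|S| k\<close> vertices, \<open>|S|\<close> grows to \<open>O (sqrt (n |S|))\<close>, so
  at most \<open>O (n (|C| / n) powr (1 / 2 ^ f))\<close> edges are kept for each \<open>v\<close>. Balancing this against the
  edges at unsaturated vertices gives \<open>|C| = O (n powr (1 / (2 ^ f + 1)))\<close>.

  If \<open>m \<le> n\<close>, the whole graph is small enough; otherwise a breadth-first search takes time \<open>O (m)\<close>.\<close>

section \<open>Timed execution of deterministic programs\<close>

text \<open>Progress is measured by \<open>card (F \<inter> region E S v)\<close>: the faults on
  edges that a walk from \<open>v\<close> avoiding \<open>S\<close> can still touch at an endpoint
  other than \<open>v\<close>. For this number to drop, a faulty tree edge must lie in the region of
  the old set and outside the region of the new one. The first demand is why the trees leave out the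
  edges between \<open>v\<close> and \<open>S\<close>, which are kept anyway. The second is why a
  round adds both the inner parts of the tree paths and a whole layer. The layer only serves later
  rounds, so the last round does without it and takes radius \<open>1\<close>, which costs a factor
  \<open>2\<close>. It is enough to keep edges at \<open>v\<close>, because the substitute enters
  \<open>v\<close> by some kept edge \<open>{z, v}\<close> and is no longer than what it replaces.
  The walk to \<open>z\<close> is then strictly shorter than the one to \<open>v\<close>, and
  induction on the length covers it. The program contains no \<open>Random\<close>. The
  configuration after the time bound is therefore a point mass, and the machine part reduces to a
  calculus of deterministic, timed triples.\<close>

inductive exec :: "nat \<Rightarrow> prog \<Rightarrow> state \<Rightarrow> nat \<Rightarrow> state \<Rightarrow> bool" for w where
  exec_Set_Reg: "exec w (Set_Reg x e) s 1 (set_reg x (val w s e) s)"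
| exec_Set_Cell: "exec w (Set_Cell a d e) s 1 (set_cell a (val w s d) (val w s e) s)"
| exec_Seq: "exec w p s t s' \<Longrightarrow> exec w q s' t' s'' \<Longrightarrow> exec w (Seq p q) s (Suc (t + t')) s''"
| exec_If: "exec w (if val w s e \<noteq> 0 then p else q) s t s' \<Longrightarrow> exec w (If e p q) s (Suc t) s'"
| exec_While_False: "val w s e = 0 \<Longrightarrow> exec w (While e p) s 1 s"
| exec_While_True: "val w s e \<noteq> 0 \<Longrightarrow> exec w p s t s' \<Longrightarrow> exec w (While e p) s' t' s'' \<Longrightarrow>
    exec w (While e p) s (Suc (t + t')) s''"

text \<open>The step counts of \<open>exec\<close> are exact: the extra \<open>Suc\<close> for
  \<open>Seq\<close>, \<open>If\<close> and \<open>While\<close> is the small step that unpacks the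
  statement onto the stack. \<open>Random\<close> has no rule, so nothing is left of the
  distribution but a point mass.\<close>

lemma exec_run: "exec w p s t s' \<Longrightarrow> run w (t + r) (p # ps, s) = run w r (ps, s')"
proof (induction arbitrary: ps r rule: exec.induct)
  case (exec_Seq p s t s' q t' s'')
  have "run w (Suc (t + t') + r) (Seq p q # ps, s) = run w (t + (t' + r)) (p # q # ps, s)"
    by (simp add: bind_return_pmf add.assoc)
  then show ?case
    by (simp add: exec_Seq.IH)
next
  case (exec_While_True s e p t s' t' s'')
  have "run w (Suc (t + t') + r) (While e p # ps, s) = run w (t + (t' + r)) (p # While e p # ps, s)"
    using exec_While_True.hyps by (simp add: bind_return_pmf add.assoc)
  then show ?case
    by (simp add: exec_While_True.IH)
qed (auto simp: bind_return_pmf)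

lemma run_halted: "run w t ([], s) = return_pmf ([], s)"
  by (induction t) (auto simp: bind_return_pmf)

lemma exec_run_halted:
  assumes "exec w p s t s'" "t \<le> T"
  shows "run w T ([p], s) = return_pmf ([], s')"
  using exec_run[OF assms(1), of "T - t" "[]"] assms(2) by (simp add: run_halted)

section \<open>Frame conditions and timed total-correctness triples\<close>

fun wregs :: "prog \<Rightarrow> nat set" where
  "wregs (Set_Reg x e) = {x}"
| "wregs (Set_Cell a d e) = {}"
| "wregs (Random x) = {x}"
| "wregs (Seq p q) = wregs p \<union> wregs q"
| "wregs (If e p q) = wregs p \<union> wregs q"
| "wregs (While e p) = wregs p"

fun warrs :: "prog \<Rightarrow> nat set" where
  "warrs (Set_Reg x e) = {}"
| "warrs (Set_Cell a d e) = {a}"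
| "warrs (Random x) = {}"
| "warrs (Seq p q) = warrs p \<union> warrs q"
| "warrs (If e p q) = warrs p \<union> warrs q"
| "warrs (While e p) = warrs p"

definition same :: "nat set \<Rightarrow> nat set \<Rightarrow> state \<Rightarrow> state \<Rightarrow> bool" where
  "same R A s s' \<longleftrightarrow> (\<forall>x. x \<notin> R \<longrightarrow> reg s' x = reg s x) \<and> (\<forall>a. a \<notin> A \<longrightarrow> arr s' a = arr s a)"

abbreviation frame :: "prog \<Rightarrow> state \<Rightarrow> state \<Rightarrow> bool" where
  "frame p \<equiv> same (wregs p) (warrs p)"

abbreviation frame_for :: "nat \<Rightarrow> prog \<Rightarrow> state \<Rightarrow> state \<Rightarrow> bool" where
  "frame_for x p \<equiv> same (insert x (wregs p)) (warrs p)"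

lemma sameD:
  assumes "same R A s s'"
  shows "x \<notin> R \<Longrightarrow> reg s' x = reg s x" "a \<notin> A \<Longrightarrow> arr s' a = arr s a"
  using assms by (auto simp: same_def)

lemma same_refl [simp]: "same R A s s"
  by (simp add: same_def)

lemma same_trans: "same R A s s' \<Longrightarrow> same R' A' s' s'' \<Longrightarrow> R \<subseteq> R'' \<Longrightarrow> R' \<subseteq> R'' \<Longrightarrow> A \<subseteq> A'' \<Longrightarrow> A' \<subseteq> A''
   \<Longrightarrow> same R'' A'' s s''"
  unfolding same_def by (metis subsetD)

lemma set_simps [simp]:
  "reg (set_reg x k s) y = (if y = x then k else reg s y)"
  "arr (set_reg x k s) = arr s"
  "reg (set_cell a i k s) = reg s"
  "arr (set_cell a i k s) b = (if b = a then (arr s a)(i := k) else arr s b)"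
  by (auto simp: set_reg_def set_cell_def)

lemma exec_same: "exec w p s t s' \<Longrightarrow> frame p s s'"
proof (induction rule: exec.induct)
  case (exec_If s e p q t s')
  then show ?case by (auto simp: same_def split: if_splits)
qed (auto simp: same_def)

text \<open>The triple speaks about one fixed initial state rather than a precondition, so that
  postconditions and invariants can mention that state. \<open>tr_conseq\<close> and
  \<open>tr_Seq\<close> supply the frame condition along with the postcondition.\<close>

definition tr :: "nat \<Rightarrow> prog \<Rightarrow> state \<Rightarrow> nat \<Rightarrow> (state \<Rightarrow> bool) \<Rightarrow> bool" where
  "tr w p s T Q \<longleftrightarrow> (\<exists>t s'. exec w p s t s' \<and> t \<le> T \<and> Q s')"

lemma tr_conseq:
  assumes "tr w p s T Q" "T \<le> T'" "\<And>s'. Q s' \<Longrightarrow> frame p s s' \<Longrightarrow> Q' s'"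
  shows "tr w p s T' Q'"
  using assms exec_same unfolding tr_def by (meson order_trans)

lemma tr_Seq:
  assumes "tr w p s T Q" "\<And>s'. Q s' \<Longrightarrow> frame p s s' \<Longrightarrow> tr w q s' T' Q'"
    "T + T' + 1 \<le> T''"
  shows "tr w (Seq p q) s T'' Q'"
proof -
  from assms(1) obtain t s' where 1: "exec w p s t s'" "t \<le> T" "Q s'" by (auto simp: tr_def)
  from assms(2)[OF this(3) exec_same[OF this(1)]]
  obtain t' s'' where 2: "exec w q s' t' s''" "t' \<le> T'" "Q' s''" by (auto simp: tr_def)
  have "exec w (Seq p q) s (Suc (t + t')) s''" using 1 2 exec_Seq by blast
  then show ?thesis using 1 2 assms(3) unfolding tr_def
    by (intro exI[of _ "Suc (t + t')"] exI[of _ s'']) auto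
qed

lemma tr_If:
  assumes "val w s e \<noteq> 0 \<Longrightarrow> tr w p s T Q" "val w s e = 0 \<Longrightarrow> tr w q s T Q" "T + 1 \<le> T'"
  shows "tr w (If e p q) s T' Q"
proof -
  have "tr w (if val w s e \<noteq> 0 then p else q) s T Q" using assms by auto
  then obtain t s' where *: "exec w (if val w s e \<noteq> 0 then p else q) s t s'" "t \<le> T" "Q s'"
    unfolding tr_def by blast
  show ?thesis unfolding tr_def
    by (rule exI[of _ "Suc t"], rule exI[of _ s']) (use exec_If[OF *(1)] * assms(3) in auto)
qed

text \<open>The potential pays for the remaining iterations, so amortised bounds need no separate
  argument.\<close>

lemma tr_While:
  assumes "I s"
    and body: "\<And>s1. I s1 \<Longrightarrow> frame p s s1 \<Longrightarrow> val w s1 e \<noteq> 0 \<Longrightarrow>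
      \<exists>c. tr w p s1 c (\<lambda>s'. I s' \<and> V s' + c + 1 \<le> V s1)"
    and "\<And>s1. I s1 \<Longrightarrow> frame p s s1 \<Longrightarrow> val w s1 e = 0 \<Longrightarrow> Q s1"
    and "V s + 1 \<le> T"
  shows "tr w (While e p) s T Q"
proof -
  have "tr w (While e p) s1 (V s1 + 1) Q" if "I s1" "frame p s s1" for s1
    using that
  proof (induction "V s1" arbitrary: s1 rule: less_induct)
    case less
    show ?case
    proof (cases "val w s1 e = 0")
      case True
      then show ?thesis using assms(3)[OF less.prems True] exec_While_False[OF True, of p]
        unfolding tr_def by (intro exI[of _ 1] exI[of _ s1]) auto
    next
      case False
      from body[OF less.prems False] obtain t s2 c where
        1: "exec w p s1 t s2" "t \<le> c" "I s2" "V s2 + c + 1 \<le> V s1" unfolding tr_def by blast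
      have "frame p s s2"
        using same_trans[OF less.prems(2) exec_same[OF 1(1)]] by simp
      with less.hyps[of s2] 1 obtain t' s3 where
        2: "exec w (While e p) s2 t' s3" "t' \<le> V s2 + 1" "Q s3"
        unfolding tr_def by auto
      show ?thesis
        unfolding tr_def
        by (intro exI[of _ "Suc (t + t')"] exI[of _ s3] conjI exec_While_True[OF False 1(1) 2(1)])
          (use 1 2 in auto)
    qed
  qed
  from this[OF assms(1)] show ?thesis
    using assms(4) by (auto intro: tr_conseq)
qed

section \<open>Loop-free programs and counting loops\<close>

fun flat :: "prog \<Rightarrow> bool" where
  "flat (Set_Reg x e) = True"
| "flat (Set_Cell a d e) = True"
| "flat (Random x) = False"
| "flat (Seq p q) \<longleftrightarrow> flat p \<and> flat q"
| "flat (If e p q) \<longleftrightarrow> flat p \<and> flat q"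
| "flat (While e p) = False"

fun cost :: "prog \<Rightarrow> nat" where
  "cost (Seq p q) = cost p + cost q + 1"
| "cost (If e p q) = max (cost p) (cost q) + 1"
| "cost _ = 1"

fun result :: "nat \<Rightarrow> prog \<Rightarrow> state \<Rightarrow> state" where
  "result w (Set_Reg x e) s = set_reg x (val w s e) s"
| "result w (Set_Cell a d e) s = set_cell a (val w s d) (val w s e) s"
| "result w (Seq p q) s = result w q (result w p s)"
| "result w (If e p q) s = (if val w s e \<noteq> 0 then result w p s else result w q s)"
| "result w _ s = s"

text \<open>Loop-free code is executed symbolically: the simplifier evaluates \<open>result\<close>,
  and \<open>cost\<close> takes the dearer branch of each \<open>If\<close>.\<close>

lemma tr_flat:
  assumes "flat p" "Q (result w p s)" "cost p \<le> T"
  shows "tr w p s T Q"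
proof -
  have "tr w p s (cost p) (\<lambda>s'. s' = result w p s)" using assms(1)
  proof (induction p arbitrary: s)
    case (Set_Reg x e)
    show ?case using exec_Set_Reg[of w x e s] by (auto simp: tr_def)
  next
    case (Set_Cell a d e)
    show ?case using exec_Set_Cell[of w a d e s] by (auto simp: tr_def)
  next
    case (Seq p q)
    then show ?case
      by (auto intro!: tr_Seq[where T = "cost p" and T' = "cost q" and Q = "\<lambda>s'. s' = result w p s"])
  next
    case (If e p q)
    then show ?case
      by (intro tr_If[where T = "max (cost p) (cost q)"])
        (auto intro: tr_conseq[OF If.IH(1)] tr_conseq[OF If.IH(2)])
  qed auto
  then show ?thesis using assms(2,3) by (auto intro: tr_conseq)
qed

definition ForR :: "nat \<Rightarrow> exp \<Rightarrow> exp \<Rightarrow> prog \<Rightarrow> prog" where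
  "ForR x d e p = Seq (Set_Reg x d) (While (Less (Reg x) e) (Seq p (Set_Reg x (Add (Reg x) (Const 1)))))"

definition For :: "nat \<Rightarrow> exp \<Rightarrow> prog \<Rightarrow> prog" where
  "For x e p = ForR x (Const 0) e p"

lemma written_For [simp]:
  "wregs (ForR x d e p) = insert x (wregs p)" "warrs (ForR x d e p) = warrs p"
  "wregs (For x e p) = insert x (wregs p)" "warrs (For x e p) = warrs p"
  by (auto simp: ForR_def For_def)

text \<open>The bound \<open>e\<close> is evaluated again before every iteration, hence the
  assumption \<open>bound\<close>; \<open>N < 2 ^ w\<close> keeps the counter from wrapping around.
  Besides the body, an iteration pays for the test, the unpacking of \<open>Seq\<close> and the
  increment, which gives \<open>c + 3\<close>. The outer \<open>Seq\<close>, the initialization and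
  the last test give the remaining \<open>3\<close>.\<close>

lemma tr_ForR:
  assumes "N < 2 ^ w" "val w s d = a" "a \<le> N"
    and init: "I a (set_reg x a s)"
    and bound: "\<And>i s1. a \<le> i \<Longrightarrow> i \<le> N \<Longrightarrow> I i s1 \<Longrightarrow> reg s1 x = i \<Longrightarrow> frame_for x p s s1 \<Longrightarrow> val w s1 e = N"
    and body: "\<And>i s1. a \<le> i \<Longrightarrow> i < N \<Longrightarrow> I i s1 \<Longrightarrow> reg s1 x = i \<Longrightarrow> frame_for x p s s1 \<Longrightarrow>
       tr w p s1 c (\<lambda>s'. reg s' x = i \<and> I (Suc i) (set_reg x (Suc i) s'))"
    and final: "\<And>s1. I N s1 \<Longrightarrow> reg s1 x = N \<Longrightarrow> frame_for x p s s1 \<Longrightarrow> Q s1"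
    and "(N - a) * (c + 3) + 3 \<le> T"
  shows "tr w (ForR x d e p) s T Q"
proof -
  let ?R = "insert x (wregs p)" and ?A = "warrs p"
  let ?I = "\<lambda>s1. \<exists>i. a \<le> i \<and> i \<le> N \<and> I i s1 \<and> reg s1 x = i"
  let ?V = "\<lambda>s1. (N - reg s1 x) * (c + 3)"
  let ?s = "set_reg x a s"
  have sR: "same ?R ?A s s1" if "same ?R ?A ?s s1" for s1
    using that by (auto simp: same_def)
  have "tr w (While (Less (Reg x) e) (Seq p (Set_Reg x (Add (Reg x) (Const 1))))) ?s
    (?V ?s + 1) Q"
  proof (rule tr_While[where I = ?I and V = ?V])
    show "?I ?s" using assms(3) init by auto
  next
    fix s1
    assume I: "?I s1" and same: "frame (Seq p (Set_Reg x (Add (Reg x) (Const 1)))) ?s s1"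
      and v: "val w s1 (Less (Reg x) e) \<noteq> 0"
    from same have same: "same ?R ?A s s1" by (intro sR) auto
    from I obtain i where i: "a \<le> i" "i \<le> N" "I i s1" "reg s1 x = i" by auto
    have "i < N" using v bound[OF i same] i by (auto split: if_splits)
    have "tr w (Seq p (Set_Reg x (Add (Reg x) (Const 1)))) s1 (c + 2)
      (\<lambda>s'. ?I s' \<and> reg s' x = Suc i)"
    proof (rule tr_Seq[OF body[OF i(1) \<open>i < N\<close> i(3,4) same]])
      fix s'
      assume s': "reg s' x = i \<and> I (Suc i) (set_reg x (Suc i) s')"
      have "1 < (2::nat) ^ w" using \<open>i < N\<close> assms(1) by linarith
      then have "w > 0" by (cases w) auto
      with \<open>1 < 2 ^ w\<close> show "tr w (Set_Reg x (Add (Reg x) (Const 1))) s' 1 (\<lambda>s'. ?I s' \<and> reg s' x = Suc i)"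
        using s' \<open>i < N\<close> i(1) assms(1) by (intro tr_flat) auto
    qed simp
    then show "\<exists>d. tr w (Seq p (Set_Reg x (Add (Reg x) (Const 1)))) s1 d
       (\<lambda>s'. ?I s' \<and> ?V s' + d + 1 \<le> ?V s1)"
    proof (intro exI, elim tr_conseq)
      fix s' assume *: "?I s' \<and> reg s' x = Suc i"
      have "N - i = Suc (N - Suc i)" using \<open>i < N\<close> by simp
      then have "(N - i) * (c + 3) = (N - Suc i) * (c + 3) + (c + 3)" by simp
      then show "?I s' \<and> ?V s' + (c + 2) + 1 \<le> ?V s1" using * i(4) by auto
    qed simp
  next
    fix s1
    assume I: "?I s1" and same: "frame (Seq p (Set_Reg x (Add (Reg x) (Const 1)))) ?s s1"
      and v: "val w s1 (Less (Reg x) e) = 0"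
    from same have same: "same ?R ?A s s1" by (intro sR) auto
    from I obtain i where i: "a \<le> i" "i \<le> N" "I i s1" "reg s1 x = i" by auto
    have "i = N" using v bound[OF i same] i by (auto split: if_splits)
    then show "Q s1" using i same final by blast
  qed simp
  then have *: "tr w (While (Less (Reg x) e) (Seq p (Set_Reg x (Add (Reg x) (Const 1))))) ?s
    ((N - a) * (c + 3) + 1) Q" by simp
  show ?thesis unfolding ForR_def
    by (rule tr_Seq[where T = 1 and Q = "\<lambda>s'. s' = ?s"], rule tr_flat) (use * assms in auto)
qed

lemma tr_For:
  assumes "N < 2 ^ w"
    and init: "I 0 (set_reg x 0 s)"
    and bound: "\<And>i s1. i \<le> N \<Longrightarrow> I i s1 \<Longrightarrow> reg s1 x = i \<Longrightarrow> frame_for x p s s1 \<Longrightarrow> val w s1 e = N"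
    and body: "\<And>i s1. i < N \<Longrightarrow> I i s1 \<Longrightarrow> reg s1 x = i \<Longrightarrow> frame_for x p s s1 \<Longrightarrow>
       tr w p s1 c (\<lambda>s'. reg s' x = i \<and> I (Suc i) (set_reg x (Suc i) s'))"
    and final: "\<And>s1. I N s1 \<Longrightarrow> reg s1 x = N \<Longrightarrow> frame_for x p s s1 \<Longrightarrow> Q s1"
    and "N * (c + 3) + 3 \<le> T"
  shows "tr w (For x e p) s T Q"
  unfolding For_def
  by (rule tr_ForR[where a = 0 and N = N and I = I and c = c]) (use assms in auto)

section \<open>Walks\<close>

text \<open>Only the existence of a walk of a given length matters, so the lists of
  \<open>walks\<close> give way to a relation suited to rule induction.\<close>

inductive walk :: "'a set set \<Rightarrow> 'a \<Rightarrow> nat \<Rightarrow> 'a \<Rightarrow> bool" for X u where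
  walk_0: "walk X u 0 u"
| walk_Suc: "walk X u k x \<Longrightarrow> {x, y} \<in> X \<Longrightarrow> walk X u (Suc k) y"

lemma walk_trans: "walk X v l y \<Longrightarrow> walk X u k v \<Longrightarrow> walk X u (k + l) y"
  by (induction rule: walk.induct) (auto intro: walk.intros)

lemma walk_edge: "{x, y} \<in> X \<Longrightarrow> walk X x 1 y"
  using walk_Suc[OF walk_0] by simp

lemma walk_sym: "walk X u k v \<Longrightarrow> walk X v k u"
proof (induction rule: walk.induct)
  case (walk_Suc k x y)
  then show ?case
    using walk_trans[OF walk_Suc.IH walk_edge[of y x]] by (simp add: insert_commute)
qed (rule walk.intros)

lemma walk_mono: "walk X u k v \<Longrightarrow> X \<subseteq> Y \<Longrightarrow> walk Y u k v"
  by (induction rule: walk.induct) (auto intro: walk.intros)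

lemma walk_iff_walks: "walk X u k v \<longleftrightarrow> (\<exists>p\<in>walks X u v. length p = Suc k)"
proof
  assume "walk X u k v"
  then show "\<exists>p\<in>walks X u v. length p = Suc k"
  proof (induction rule: walk.induct)
    case walk_0
    then show ?case by (intro bexI[of _ "[u]"]) (auto simp: walks_def)
  next
    case (walk_Suc k x y)
    then obtain p where "p \<in> walks X u x" "length p = Suc k" by auto
    with walk_Suc show ?case
      by (intro bexI[of _ "p @ [y]"]) (auto simp: walks_def successively_append_iff)
  qed
next
  assume "\<exists>p\<in>walks X u v. length p = Suc k"
  then obtain p where "p \<in> walks X u v" "length p = Suc k" by auto
  then show "walk X u k v"
  proof (induction k arbitrary: p v)
    case 0
    then obtain x where "p = [x]" by (auto simp: length_Suc_conv)
    then show ?case using 0 by (auto simp: walks_def intro: walk_0)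
  next
    case (Suc k)
    then have "p = butlast p @ [v]" "butlast p \<noteq> []"
      by (auto simp: walks_def length_Suc_conv)
    then obtain q where q: "p = q @ [v]" "q \<noteq> []" by blast
    then have "q \<in> walks X u (last q)" "{last q, v} \<in> X" "length q = Suc k"
      using Suc.prems by (auto simp: walks_def successively_append_iff)
    then show ?case using Suc.IH[of q "last q"] by (auto intro: walk_Suc)
  qed
qed

lemma gdist_le: "walk X u k v \<Longrightarrow> gdist X u v \<le> enat k"
  unfolding walk_iff_walks gdist_def by (auto intro: INF_lower2)

lemma walk_of_gdist:
  assumes "gdist X u v \<noteq> \<infinity>"
  obtains k where "walk X u k v" "gdist X u v = enat k"
proof -
  have "walks X u v \<noteq> {}"
    using assms by (auto simp: gdist_def top_enat_def)
  then obtain q where "q \<in> walks X u v" by blast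
  \<comment> \<open>The infimum is attained because \<open>enat\<close> is well-ordered.\<close>
  then have "gdist X u v \<in> (\<lambda>p. enat (length p - 1)) ` walks X u v"
    unfolding gdist_def by (intro wellorder_InfI[of "enat (length q - 1)"] imageI)
  then obtain p where p: "p \<in> walks X u v" "gdist X u v = enat (length p - 1)" by auto
  moreover have "length p = Suc (length p - 1)" using p(1) by (cases p) (auto simp: walks_def)
  ultimately have "walk X u (length p - 1) v" unfolding walk_iff_walks by blast
  then show ?thesis using p(2) by (rule that)
qed

lemma additive_FT_spannerI:
  assumes "H \<subseteq> E"
    and "\<And>F u v k. F \<subseteq> E \<Longrightarrow> card F \<le> f \<Longrightarrow> u \<in> V \<Longrightarrow> v \<in> V \<Longrightarrow> walk (E - F) u k v \<Longrightarrow>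
      \<exists>k'\<le>k + \<beta>. walk (H - F) u k' v"
  shows "additive_FT_spanner \<beta> f V E H"
  unfolding additive_FT_spanner_def
proof (intro conjI allI impI assms(1))
  fix F u v
  assume *: "F \<subseteq> E \<and> card F \<le> f \<and> u \<in> V \<and> v \<in> V"
  show "gdist (H - F) u v \<le> gdist (E - F) u v + enat \<beta>"
  proof (cases "gdist (E - F) u v = \<infinity>")
    case False
    then obtain k where k: "walk (E - F) u k v" "gdist (E - F) u v = enat k"
      by (rule walk_of_gdist)
    then obtain k' where "k' \<le> k + \<beta>" "walk (H - F) u k' v" using assms(2) * by blast
    then have "gdist (H - F) u v \<le> enat (k + \<beta>)"
      by (meson enat_ord_simps(1) gdist_le order_trans)
    then show ?thesis using k(2) by simp
  qed simp
qed


section \<open>Correctness of a round\<close>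

inductive avoid :: "'a set set \<Rightarrow> 'a set \<Rightarrow> 'a \<Rightarrow> 'a \<Rightarrow> nat \<Rightarrow> bool" for X S v where
  avoid_0: "avoid X S v v 0"
| avoid_Suc: "avoid X S v u k \<Longrightarrow> {u, x} \<in> X \<Longrightarrow> x \<notin> S \<Longrightarrow> avoid X S v x (Suc k)"

lemma avoid_notin: "avoid X S v u k \<Longrightarrow> v \<notin> S \<Longrightarrow> u \<notin> S"
  by (cases rule: avoid.cases) auto

lemma avoid_mono: "avoid X S' v u k \<Longrightarrow> X \<subseteq> Y \<Longrightarrow> S \<subseteq> S' \<Longrightarrow> avoid Y S v u k"
  by (induction rule: avoid.induct) (auto intro: avoid.intros)

lemma avoid_walk: "avoid X S v u k \<Longrightarrow> walk X v k u"
  by (induction rule: avoid.induct) (auto intro: walk.intros)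

lemma walk_first_hit:
  assumes "walk X v k u"
  shows "avoid X S v u k \<or> (\<exists>x j y l. avoid X S v x j \<and> {x, y} \<in> X \<and> y \<in> S \<and>
     walk X y l u \<and> j + l + 1 = k)"
  using assms
proof (induction rule: walk.induct)
  case (walk_Suc k x y)
  from walk_Suc.IH show ?case
  proof
    assume a: "avoid X S v x k"
    show ?thesis
    proof (cases "y \<in> S")
      case True
      then show ?thesis using a walk_Suc.hyps walk_0[of X y]
        by (intro disjI2 exI[of _ x] exI[of _ k] exI[of _ y] exI[of _ 0]) auto
    next
      case False
      then show ?thesis using a walk_Suc.hyps by (auto intro: avoid_Suc)
    qed
  next
    assume "\<exists>a j b l. avoid X S v a j \<and> {a, b} \<in> X \<and> b \<in> S \<and> walk X b l x \<and> j + l + 1 = k"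
    then obtain a j b l where "avoid X S v a j" "{a, b} \<in> X" "b \<in> S" "walk X b l x" "j + l + 1 = k"
      by blast
    moreover have "walk X b (Suc l) y" using \<open>walk X b l x\<close> walk_Suc.hyps(2) by (rule walk.intros)
    ultimately show ?thesis by (intro disjI2 exI[of _ a] exI[of _ j] exI[of _ b] exI[of _ "Suc l"]) auto
  qed
qed (auto intro: avoid_0)

text \<open>These are the edges on which a fault can still do harm. The condition
  \<open>u \<noteq> v\<close> exempts the edges from \<open>v\<close> into \<open>S\<close>: they
  are kept in any case, and no round could remove them from the count.\<close>

definition region :: "'a set set \<Rightarrow> 'a set \<Rightarrow> 'a \<Rightarrow> 'a set set" where
  "region E S v = {e \<in> E. \<exists>u k. u \<in> e \<and> u \<noteq> v \<and> avoid E S v u k}"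

lemma region_mono: "S \<subseteq> S' \<Longrightarrow> region E S' v \<subseteq> region E S v"
  unfolding region_def using avoid_mono[of E S' v _ _ E S] by blast

text \<open>The result of a breadth-first search from \<open>v\<close> that does not expand the vertices of \<open>S\<close> and
  does not use the edges between \<open>v\<close> and \<open>S\<close>. The labels \<open>D\<close> are distances plus \<open>1\<close>, and \<open>D u = 0\<close>
  means that \<open>u\<close> is not reached.\<close>

definition bfs_tree :: "'a set set \<Rightarrow> 'a set \<Rightarrow> 'a \<Rightarrow> ('a \<Rightarrow> nat) \<Rightarrow> ('a \<Rightarrow> 'a) \<Rightarrow> bool" where
  "bfs_tree E S v D par \<longleftrightarrow>
     v \<notin> S \<and> D v = 1 \<and>
     (\<forall>u. D u \<noteq> 0 \<longrightarrow> u \<noteq> v \<longrightarrow> D (par u) \<noteq> 0 \<and> D u = D (par u) + 1 \<and> {par u, u} \<in> E \<and>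
        par u \<notin> S \<and> \<not> (par u = v \<and> u \<in> S)) \<and>
     (\<forall>u x. D u \<noteq> 0 \<longrightarrow> u \<notin> S \<longrightarrow> {u, x} \<in> E \<longrightarrow> \<not> (u = v \<and> x \<in> S) \<longrightarrow> D x \<noteq> 0 \<and> D x \<le> D u + 1)"

lemma bfs_treeD:
  assumes "bfs_tree E S v D par"
  shows "v \<notin> S" "D v = 1"
    "D u \<noteq> 0 \<Longrightarrow> u \<noteq> v \<Longrightarrow> D (par u) \<noteq> 0"
    "D u \<noteq> 0 \<Longrightarrow> u \<noteq> v \<Longrightarrow> D u = D (par u) + 1"
    "D u \<noteq> 0 \<Longrightarrow> u \<noteq> v \<Longrightarrow> {par u, u} \<in> E"
    "D u \<noteq> 0 \<Longrightarrow> u \<noteq> v \<Longrightarrow> par u \<notin> S"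
    "D u \<noteq> 0 \<Longrightarrow> u \<noteq> v \<Longrightarrow> par u = v \<Longrightarrow> u \<notin> S"
    "D u \<noteq> 0 \<Longrightarrow> u \<notin> S \<Longrightarrow> {u, x} \<in> E \<Longrightarrow> \<not> (u = v \<and> x \<in> S) \<Longrightarrow> D x \<noteq> 0 \<and> D x \<le> D u + 1"
  using assms unfolding bfs_tree_def by blast+

text \<open>All parents lie outside \<open>S\<close>, so the tree path itself is an avoiding walk;
  its length is \<open>D u - 1\<close> because labels are distances plus one.\<close>

lemma bfs_tree_avoid:
  assumes bfs: "bfs_tree E S v D par" and "D u \<noteq> 0" "u \<notin> S"
  shows "avoid E S v u (D u - 1)"
  using assms(2,3)
proof (induction "D u" arbitrary: u rule: less_induct)
  case less
  show ?case
  proof (cases "u = v")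
    case True
    then show ?thesis using bfs_treeD(2)[OF bfs] by (auto intro: avoid_0)
  next
    case False
    note * = bfs_treeD(3-7)[OF bfs less.prems(1) False]
    have "avoid E S v (par u) (D (par u) - 1)"
      using * by (intro less.hyps) auto
    then have "avoid E S v u (Suc (D (par u) - 1))"
      using *(3) less.prems(2) by (rule avoid_Suc)
    then show ?thesis using * by (metis Suc_eq_plus1 Suc_pred add_diff_cancel_right' neq0_conv)
  qed
qed

text \<open>The tree is computed without knowledge of the faults. The case \<open>X = E - F\<close>
  compares it with walks in the damaged graph.\<close>

lemma avoid_bfs_tree:
  assumes "bfs_tree E S v D par" "avoid X S v u k" "X \<subseteq> E"
  shows "D u \<noteq> 0 \<and> D u \<le> k + 1"
  using assms(2)
proof (induction rule: avoid.induct)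
  case (avoid_Suc u k x)
  have "u \<notin> S" using avoid_Suc.hyps(1) bfs_treeD(1)[OF assms(1)] by (rule avoid_notin)
  then have "D x \<noteq> 0 \<and> D x \<le> D u + 1"
    using avoid_Suc assms(3) by (intro bfs_treeD(8)[OF assms(1)]) auto
  then show ?case using avoid_Suc.IH by auto
qed (use bfs_treeD(2)[OF assms(1)] in auto)

text \<open>\<open>round_step E v S k L D par M S'\<close>: the set \<open>M\<close> contains the tree paths from \<open>S\<close> to \<open>v\<close>, and
  \<open>S'\<close> contains the part of \<open>M\<close> in the ball of radius \<open>k\<close>; if \<open>L\<close> holds, it also contains the
  boundary of this ball.\<close>

definition round_step ::
    "'a set set \<Rightarrow> 'a \<Rightarrow> 'a set \<Rightarrow> nat \<Rightarrow> bool \<Rightarrow> ('a \<Rightarrow> nat) \<Rightarrow> ('a \<Rightarrow> 'a) \<Rightarrow> 'a set \<Rightarrow> 'a set \<Rightarrow> bool" where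
  "round_step E v S k L D par M S' \<longleftrightarrow>
     bfs_tree E S v D par \<and> 1 \<le> k \<and> S \<subseteq> S' \<and> v \<notin> S' \<and>
     (\<forall>x\<in>S. D x \<noteq> 0 \<longrightarrow> x \<in> M) \<and> (\<forall>u\<in>M. u \<noteq> v \<longrightarrow> D u \<noteq> 0 \<longrightarrow> par u \<in> M) \<and>
     (\<forall>u\<in>M. u \<noteq> v \<longrightarrow> D u \<noteq> 0 \<longrightarrow> D u \<le> k + 1 \<longrightarrow> u \<in> S') \<and>
     (L \<longrightarrow> (\<forall>u. D u = k + 1 \<longrightarrow> u \<in> S'))"

lemma round_stepD:
  assumes "round_step E v S k L D par M S'"
  shows "bfs_tree E S v D par" "1 \<le> k" "S \<subseteq> S'" "v \<notin> S'"
    "x \<in> S \<Longrightarrow> D x \<noteq> 0 \<Longrightarrow> x \<in> M"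
    "u \<in> M \<Longrightarrow> u \<noteq> v \<Longrightarrow> D u \<noteq> 0 \<Longrightarrow> par u \<in> M"
    "u \<in> M \<Longrightarrow> u \<noteq> v \<Longrightarrow> D u \<noteq> 0 \<Longrightarrow> D u \<le> k + 1 \<Longrightarrow> u \<in> S'"
    "L \<Longrightarrow> D u = k + 1 \<Longrightarrow> u \<in> S'"
  using assms unfolding round_step_def by blast+

text \<open>On the tree path from \<open>y\<close> to \<open>v\<close> either some edge is faulty or
  all survive. If all survive, \<open>z\<close> is the child of \<open>v\<close> on this path: it is
  marked and has label \<open>2 \<le> k + 1\<close>, so it belongs to \<open>S'\<close>, and the
  tree path from \<open>z\<close> to \<open>y\<close> has \<open>D y - 2\<close> edges.\<close>

lemma tree_path_cases:
  assumes R: "round_step E v S k L D par M S'" and "y \<in> M" "y \<noteq> v" "D y \<noteq> 0"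
  shows "(\<exists>z\<in>S'. {z, v} \<in> E - F \<and> walk (E - F) z (D y - 2) y) \<or>
    (\<exists>a\<in>M. a \<noteq> v \<and> D a \<noteq> 0 \<and> {par a, a} \<in> F)"
  using assms(2-)
proof (induction "D y" arbitrary: y rule: less_induct)
  case less
  note bfs = round_stepD(1)[OF R]
  note * = bfs_treeD(3-7)[OF bfs less.prems(3,2)]
  show ?case
  proof (cases "{par y, y} \<in> F")
    case True
    then show ?thesis using less.prems by blast
  next
    case False
    show ?thesis
    proof (cases "par y = v")
      case True
      then have "D y = 2" using *(2) bfs_treeD(2)[OF bfs] by simp
      then have "y \<in> S'" using round_stepD(2)[OF R] less.prems by (intro round_stepD(7)[OF R]) auto
      moreover have "{y, v} \<in> E - F" using * False True by (auto simp: insert_commute)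
      ultimately show ?thesis using \<open>D y = 2\<close> by (auto intro: walk_0)
    next
      case pv: False
      have "par y \<in> M" using round_stepD(6)[OF R] less.prems by blast
      moreover have "D (par y) < D y" using *(2) by simp
      ultimately have "(\<exists>z\<in>S'. {z, v} \<in> E - F \<and> walk (E - F) z (D (par y) - 2) (par y)) \<or>
        (\<exists>a\<in>M. a \<noteq> v \<and> D a \<noteq> 0 \<and> {par a, a} \<in> F)" using pv *(1) less.hyps by blast
      then show ?thesis
      proof
        assume "\<exists>z\<in>S'. {z, v} \<in> E - F \<and> walk (E - F) z (D (par y) - 2) (par y)"
        then obtain z where z: "z \<in> S'" "{z, v} \<in> E - F" "walk (E - F) z (D (par y) - 2) (par y)"
          by blast
        have "D (par y) \<ge> 2"
          using bfs_treeD(4)[OF bfs *(1) pv] bfs_treeD(3)[OF bfs *(1) pv] by linarith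
        moreover have "{par y, y} \<in> E - F" using False *(3) by blast
        then have "walk (E - F) z (Suc (D (par y) - 2)) y" by (rule walk_Suc[OF z(3)])
        moreover from \<open>D (par y) \<ge> 2\<close> have "Suc (D (par y) - 2) = D y - 2" using *(2) by linarith
        ultimately have "walk (E - F) z (D y - 2) y" by simp
        then show ?thesis using z by blast
      qed blast
    qed
  qed
qed

text \<open>The endpoint that witnesses membership is the parent, or \<open>a\<close> itself if the
  parent is \<open>v\<close>. In the latter case \<open>a \<notin> S\<close>, since the tree has no
  edge from \<open>v\<close> into \<open>S\<close>.\<close>

lemma tree_edge_region:
  assumes "bfs_tree E S v D par" "a \<noteq> v" "D a \<noteq> 0"
  shows "{par a, a} \<in> region E S v"
proof (cases "par a = v")
  case True
  then have "a \<notin> S" using bfs_treeD(7)[OF assms(1,3,2)] by blast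
  from bfs_tree_avoid[OF assms(1,3) this] show ?thesis
    using assms(2) bfs_treeD(5)[OF assms(1,3,2)] unfolding region_def by blast
next
  case False
  from bfs_tree_avoid[OF assms(1) bfs_treeD(3)[OF assms(1,3,2)] bfs_treeD(6)[OF assms(1,3,2)]]
  show ?thesis using False bfs_treeD(5)[OF assms(1,3,2)] unfolding region_def by blast
qed

text \<open>A walk that avoids \<open>S'\<close> cannot cross the boundary of the ball.\<close>

lemma tree_edge_not_region:
  assumes R: "round_step E v S k True D par M S'" and a: "a \<in> M" "a \<noteq> v" "D a \<noteq> 0"
  shows "{par a, a} \<notin> region E S' v"
proof
  note bfs = round_stepD(1)[OF R]
  have ball: "D u \<noteq> 0 \<and> D u \<le> k" if "avoid E S' v u j" for u j
    using that
  proof (induction rule: avoid.induct)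
    case avoid_0
    then show ?case using bfs_treeD(2)[OF bfs] round_stepD(2)[OF R] by simp
  next
    case (avoid_Suc u j x)
    have "u \<notin> S'" using avoid_notin[OF avoid_Suc.hyps(1) round_stepD(4)[OF R]] .
    then have "D x \<noteq> 0 \<and> D x \<le> D u + 1"
      using avoid_Suc round_stepD(3)[OF R] by (intro bfs_treeD(8)[OF bfs]) auto
    moreover have "D x \<noteq> k + 1" using round_stepD(8)[OF R] avoid_Suc.hyps by blast
    ultimately show ?case using avoid_Suc.IH by linarith
  qed
  assume "{par a, a} \<in> region E S' v"
  then obtain u j where u: "u = par a \<or> u = a" "u \<noteq> v" "avoid E S' v u j"
    unfolding region_def by blast
  \<comment> \<open>Marks are closed under parents, so both endpoints are marked. One that is
    reached would lie inside the ball and hence in \<open>S'\<close>, which an avoiding walk cannot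
    visit.\<close>
  have "u \<in> M" using u(1) a round_stepD(6)[OF R] by blast
  then have "u \<in> S'" using ball[OF u(3)] u(2) by (intro round_stepD(7)[OF R]) auto
  then show False using avoid_notin[OF u(3) round_stepD(4)[OF R]] by blast
qed

text \<open>Downward induction on \<open>i\<close>, where \<open>r - i\<close> is the budget of
  faults left in the region, so that none is left at \<open>i = r\<close>. The walk of length
  \<open>k\<close> from \<open>v\<close> to \<open>u\<close>, followed by the edge into
  \<open>y\<close>, is traded for a walk of at most \<open>k\<close> edges from \<open>y\<close> to
  some \<open>z\<close> and a final edge \<open>{z, v}\<close> with \<open>z\<close> in the last
  set.\<close>

lemma rounds_correct:
  assumes rounds: "\<And>i. i < r \<Longrightarrow> \<exists>k D par M. round_step E v (S i) k True D par M (S (Suc i))"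
    and last: "\<exists>k D par M. round_step E v (S r) k False D par M (S (Suc r))"
    and F: "finite F"
  shows "i \<le> r \<Longrightarrow> card (F \<inter> region E (S i) v) \<le> r - i \<Longrightarrow> y \<in> S i \<Longrightarrow> avoid (E - F) (S i) v u k \<Longrightarrow>
    {u, y} \<in> E - F \<Longrightarrow> \<exists>z\<in>S (Suc r). \<exists>k'\<le>k. {z, v} \<in> E - F \<and> walk (E - F) z k' y"
proof (induction i arbitrary: y u k rule: inc_induct)
  case base
  obtain l D par M where R: "round_step E v (S r) l False D par M (S (Suc r))" using last by blast
  note bfs = round_stepD(1)[OF R]
  show ?case
  proof (cases "u = v")
    case True
    then have "{y, v} \<in> E - F" "y \<in> S (Suc r)"
      using base round_stepD(3)[OF R] by (auto simp: insert_commute)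
    then show ?thesis by (intro bexI[of _ y] exI[of _ 0]) (auto intro: walk_0)
  next
    case False
    have u: "D u \<noteq> 0 \<and> D u \<le> k + 1" using avoid_bfs_tree[OF bfs base(3)] by blast
    have "u \<notin> S r" using avoid_notin[OF base(3) bfs_treeD(1)[OF bfs]] .
    then have y: "D y \<noteq> 0 \<and> D y \<le> D u + 1"
      using u base False by (intro bfs_treeD(8)[OF bfs]) auto
    have yv: "y \<noteq> v" using base bfs_treeD(1)[OF bfs] by blast
    have "F \<inter> region E (S r) v = {}" using base(1) F by simp
    then have "\<not> (\<exists>a\<in>M. a \<noteq> v \<and> D a \<noteq> 0 \<and> {par a, a} \<in> F)"
      using tree_edge_region[OF bfs] by blast
    then obtain z where "z \<in> S (Suc r)" "{z, v} \<in> E - F" "walk (E - F) z (D y - 2) y"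
      using tree_path_cases[OF R round_stepD(5)[OF R base(2)] yv, of F] y by blast
    then show ?thesis using y u by (intro bexI[of _ z] exI[of _ "D y - 2"]) auto
  qed
next
  case (step i)
  obtain l D par M where R: "round_step E v (S i) l True D par M (S (Suc i))"
    using rounds step.hyps by blast
  note bfs = round_stepD(1)[OF R]
  have sub: "S (Suc i) \<subseteq> S (Suc r)"
  proof -
    have *: "S j \<subseteq> S (Suc j)" if "j \<le> r" for j
    proof (cases "j = r")
      case True
      then show ?thesis using last by (auto dest: round_stepD(3))
    next
      case False
      then have "\<exists>k D par M. round_step E v (S j) k True D par M (S (Suc j))" using that rounds by simp
      then show ?thesis by (auto dest: round_stepD(3))
    qed
    have "S (Suc i) \<subseteq> S j" if "Suc i \<le> j" "j \<le> Suc r" for j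
      using that
    proof (induction j rule: dec_induct)
      case (step j)
      then show ?case using *[of j] by auto
    qed simp
    then show ?thesis using step.hyps by simp
  qed
  show ?case
  proof (cases "u = v")
    case True
    then have "{y, v} \<in> E - F" "y \<in> S (Suc r)"
      using step.prems round_stepD(3)[OF R] sub by (auto simp: insert_commute)
    then show ?thesis by (intro bexI[of _ y] exI[of _ 0]) (auto intro: walk_0)
  next
    case False
    have u: "D u \<noteq> 0 \<and> D u \<le> k + 1" using avoid_bfs_tree[OF bfs step.prems(3)] by blast
    have "u \<notin> S i" using avoid_notin[OF step.prems(3) bfs_treeD(1)[OF bfs]] .
    then have y: "D y \<noteq> 0 \<and> D y \<le> D u + 1"
      using u step.prems False by (intro bfs_treeD(8)[OF bfs]) auto
    have yv: "y \<noteq> v" using step.prems bfs_treeD(1)[OF bfs] by blast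
    consider z where "z \<in> S (Suc i)" "{z, v} \<in> E - F" "walk (E - F) z (D y - 2) y"
      | a where "a \<in> M" "a \<noteq> v" "D a \<noteq> 0" "{par a, a} \<in> F"
      using tree_path_cases[OF R round_stepD(5)[OF R step.prems(2)] yv, of F] y by blast
    then show ?thesis
    proof cases
      case 1
      then show ?thesis using y u sub by (intro bexI[of _ z] exI[of _ "D y - 2"]) auto
    next
      case 2
      \<comment> \<open>This fault leaves the region, which pays for the round.\<close>
      have "{par a, a} \<in> F \<inter> region E (S i) v" "{par a, a} \<notin> F \<inter> region E (S (Suc i)) v"
        using 2 tree_edge_region[OF bfs] tree_edge_not_region[OF R] by auto
      then have "F \<inter> region E (S (Suc i)) v \<subset> F \<inter> region E (S i) v"
        using region_mono[OF round_stepD(3)[OF R], of E v] by blast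
      then have "card (F \<inter> region E (S (Suc i)) v) < card (F \<inter> region E (S i) v)"
        using F by (intro psubset_card_mono) auto
      then have card: "card (F \<inter> region E (S (Suc i)) v) \<le> r - Suc i"
        using step.prems(1) step.hyps by linarith
      have "y \<in> S (Suc i)" using step.prems(2) round_stepD(3)[OF R] by blast
      \<comment> \<open>The walk through \<open>u\<close> to \<open>y\<close> is cut at its first
        vertex in the larger set, seen from \<open>v\<close>. The induction hypothesis treats the
        part up to the cut; the rest is reused unchanged.\<close>
      have hit: "avoid (E - F) (S (Suc i)) v u k \<or> (\<exists>x j y l. avoid (E - F) (S (Suc i)) v x j \<and>
        {x, y} \<in> E - F \<and> y \<in> S (Suc i) \<and> walk (E - F) y l u \<and> j + l + 1 = k)"
        using avoid_walk[OF step.prems(3)] by (rule walk_first_hit)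
      obtain x j y' l where x: "avoid (E - F) (S (Suc i)) v x j" "{x, y'} \<in> E - F"
        "y' \<in> S (Suc i)" "walk (E - F) y' l y" "j + l \<le> k"
      proof (cases "avoid (E - F) (S (Suc i)) v u k")
        case True
        then show ?thesis using that[of u k y 0] step.prems(4) \<open>y \<in> S (Suc i)\<close> walk_0[of "E - F" y] by simp
      next
        case False
        then obtain x j y' l where *: "avoid (E - F) (S (Suc i)) v x j" "{x, y'} \<in> E - F"
          "y' \<in> S (Suc i)" "walk (E - F) y' l u" "j + l + 1 = k" using hit by blast
        have "walk (E - F) y' (Suc l) y" using *(4) step.prems(4) by (rule walk_Suc)
        then show ?thesis using that * by simp
      qed
      from step.IH[OF card x(3,1,2)] obtain z k' where
        z: "z \<in> S (Suc r)" "k' \<le> j" "{z, v} \<in> E - F" "walk (E - F) z k' y'" by blast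
      have "walk (E - F) z (k' + l) y" using walk_trans[OF x(4) z(4)] .
      then show ?thesis using z x(5) by (intro bexI[of _ z] exI[of _ "k' + l"]) auto
    qed
  qed
qed

text \<open>Rerouting the part of the walk near \<open>v\<close> produces a kept edge
  \<open>{z, v}\<close> and a walk in \<open>E - F\<close> from \<open>s\<close> to \<open>z\<close>
  of length below \<open>k\<close>, to which the induction hypothesis applies with \<open>z\<close>
  in place of \<open>v\<close>.\<close>

lemma preserver_correct:
  assumes rounds: "\<And>v i. v \<in> V \<Longrightarrow> i < f \<Longrightarrow> \<exists>k D par M. round_step E v (S v i) k True D par M (S v (Suc i))"
    and last: "\<And>v. v \<in> V \<Longrightarrow> \<exists>k D par M. round_step E v (S v f) k False D par M (S v (Suc f))"
    and init: "\<And>v. v \<in> V \<Longrightarrow> S v 0 = C - {v}"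
    and H: "\<And>v y. v \<in> V \<Longrightarrow> y \<in> S v (Suc f) \<Longrightarrow> {y, v} \<in> E \<Longrightarrow> {y, v} \<in> H"
    and V: "\<And>e. e \<in> E \<Longrightarrow> e \<subseteq> V" and F: "finite F" "card F \<le> f"
    and s: "s \<in> C" and v: "v \<in> V" and walk: "walk (E - F) s k v"
  shows "\<exists>k'\<le>k. walk (H - F) s k' v"
  using v walk
proof (induction k arbitrary: v rule: less_induct)
  case (less k v)
  show ?case
  proof (cases "s = v")
    case True
    then show ?thesis by (auto intro!: exI[of _ 0] walk_0)
  next
    case False
    then have sS: "s \<in> S v 0" using init[OF less.prems(1)] s by blast
    have "v \<notin> S v 0" using init[OF less.prems(1)] by blast
    have "walk (E - F) v k s" using walk_sym[OF less.prems(2)] .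
    then have "\<exists>u j y l. avoid (E - F) (S v 0) v u j \<and> {u, y} \<in> E - F \<and> y \<in> S v 0 \<and>
        walk (E - F) y l s \<and> j + l + 1 = k"
      using walk_first_hit[of "E - F" v k s "S v 0"] avoid_notin[OF _ \<open>v \<notin> S v 0\<close>] sS by blast
    then obtain u j y l where u: "avoid (E - F) (S v 0) v u j" "{u, y} \<in> E - F" "y \<in> S v 0"
        "walk (E - F) y l s" "j + l + 1 = k" by blast
    have "card (F \<inter> region E (S v 0) v) \<le> f - 0"
      using card_mono[OF F(1), of "F \<inter> region E (S v 0) v"] F(2) by auto
    then obtain z k' where z: "z \<in> S v (Suc f)" "k' \<le> j" "{z, v} \<in> E - F" "walk (E - F) z k' y"
      using rounds_correct[of f E v "S v" F 0 y u j, OF rounds[OF less.prems(1)] last[OF less.prems(1)]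
          F(1) le0 _ u(3,1,2)] by blast
    have "walk (E - F) s (l + k') z" using walk_sym[OF walk_trans[OF u(4) z(4)]] by (simp add: add.commute)
    moreover have "l + k' < k" using z u by linarith
    moreover have "z \<in> V" using z(3) V by blast
    ultimately obtain k'' where k'': "k'' \<le> l + k'" "walk (H - F) s k'' z"
      using less.IH by blast
    have "{z, v} \<in> H - F" using H[OF less.prems(1) z(1)] z(3) by blast
    then have "walk (H - F) s (Suc k'') v" by (rule walk_Suc[OF k''(2)])
    then show ?thesis using k'' \<open>l + k' < k\<close> by (intro exI[of _ "Suc k''"]) auto
  qed
qed

lemma walk_edges:
  assumes "walk X u k v"
  shows "walk (X \<inter> H) u k v \<or> (\<exists>i a b. walk X u i a \<and> {a, b} \<in> X - H \<and> walk X a (k - i) v \<and> i \<le> k)"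
  using assms
proof (induction rule: walk.induct)
  case (walk_Suc k x y)
  from walk_Suc.IH show ?case
  proof
    assume w: "walk (X \<inter> H) u k x"
    show ?thesis
    proof (cases "{x, y} \<in> H")
      case True
      then show ?thesis using walk.walk_Suc[OF w] walk_Suc.hyps by blast
    next
      case False
      then show ?thesis using walk_Suc.hyps walk_edge[of x y X]
        by (intro disjI2 exI[of _ k] exI[of _ x] exI[of _ y]) auto
    qed
  next
    assume "\<exists>i a b. walk X u i a \<and> {a, b} \<in> X - H \<and> walk X a (k - i) x \<and> i \<le> k"
    then obtain i a b where *: "walk X u i a" "{a, b} \<in> X - H" "walk X a (k - i) x" "i \<le> k" by blast
    have "walk X a (Suc (k - i)) y" using *(3) walk_Suc.hyps(2) by (rule walk.walk_Suc)
    then show ?thesis using * by (metis Suc_diff_le le_SucI)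
  qed
qed (auto intro: walk.walk_0)

theorem spanner_correct:
  assumes rounds: "\<And>v i. v \<in> V \<Longrightarrow> i < f \<Longrightarrow> \<exists>k D par M. round_step E v (S v i) k True D par M (S v (Suc i))"
    and last: "\<And>v. v \<in> V \<Longrightarrow> \<exists>k D par M. round_step E v (S v f) k False D par M (S v (Suc f))"
    and init: "\<And>v. v \<in> V \<Longrightarrow> S v 0 = C - {v}"
    and H: "\<And>v y. v \<in> V \<Longrightarrow> y \<in> S v (Suc f) \<Longrightarrow> {y, v} \<in> E \<Longrightarrow> {y, v} \<in> H"
    and dense: "\<And>a b. {a, b} \<in> E \<Longrightarrow> {a, b} \<notin> H \<Longrightarrow> card {c \<in> C. {c, a} \<in> E} > f"
    and "H \<subseteq> E" and V: "\<And>e. e \<in> E \<Longrightarrow> e \<subseteq> V" and fin: "finite E"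
  shows "additive_FT_spanner 2 f V E H"
proof (rule additive_FT_spannerI[OF \<open>H \<subseteq> E\<close>])
  fix F u v k
  assume F: "F \<subseteq> E" "card F \<le> f" and uv: "u \<in> V" "v \<in> V" and walk: "walk (E - F) u k v"
  have finF: "finite F" using F(1) fin by (rule finite_subset)
  have pres: "\<exists>k'\<le>k. walk (H - F) c k' x" if "c \<in> C" "x \<in> V" "walk (E - F) c k x" for c x k
    by (rule preserver_correct[where S = S and V = V and E = E and C = C and f = f])
      (fact rounds last init H V finF F(2) that)+
  from walk_edges[OF walk, of H] show "\<exists>k'\<le>k + 2. walk (H - F) u k' v"
  proof
    assume "walk ((E - F) \<inter> H) u k v"
    then have "walk (H - F) u k v" by (rule walk_mono) blast
    then show ?thesis by (intro exI[of _ k]) simp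
  next
    assume "\<exists>i a b. walk (E - F) u i a \<and> {a, b} \<in> E - F - H \<and> walk (E - F) a (k - i) v \<and> i \<le> k"
    then obtain i a b where *: "walk (E - F) u i a" "{a, b} \<in> E - F - H" "walk (E - F) a (k - i) v" "i \<le> k"
      by blast
    let ?N = "{c \<in> C. {c, a} \<in> E}"
    \<comment> \<open>More than \<open>f\<close> distinct edges join \<open>a\<close> to centers, so
      one of them survives.\<close>
    have "card F < card ?N" using dense[of a b] *(2) F(2) by auto
    also have "card ?N = card ((\<lambda>c. {c, a}) ` ?N)"
      by (rule card_image[symmetric]) (auto simp: inj_on_def doubleton_eq_iff)
    finally have "\<not> (\<lambda>c. {c, a}) ` ?N \<subseteq> F" using card_mono[OF finF] by (meson not_le)
    then obtain c where c: "c \<in> C" "{c, a} \<in> E - F" by blast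
    \<comment> \<open>The walks from \<open>c\<close> to \<open>u\<close> and to \<open>v\<close>
      have \<open>i + 1\<close> and \<open>k - i + 1\<close> edges and are preserved without loss.
      The surplus \<open>2\<close> consists of the two traversals of \<open>{c, a}\<close>.\<close>
    have "walk (E - F) c 1 a" using walk_edge[OF c(2)] .
    note cu = walk_trans[OF walk_sym[OF *(1)] this] and cv = walk_trans[OF *(3) this]
    obtain l where l: "l \<le> 1 + i" "walk (H - F) c l u"
      using pres[OF c(1) uv(1) cu] by blast
    obtain l' where l': "l' \<le> 1 + (k - i)" "walk (H - F) c l' v"
      using pres[OF c(1) uv(2) cv] by blast
    have "walk (H - F) u (l + l') v" using walk_trans[OF l'(2) walk_sym[OF l(2)]] .
    then show ?thesis using l(1) l'(1) *(4) by (intro exI[of _ "l + l'"]) simp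
  qed
qed

section \<open>Size of the spanner\<close>

text \<open>Tree paths may merge on the way to \<open>v\<close> but never split. Hence the marked
  vertices of label \<open>d\<close> can be charged injectively to vertices of \<open>S\<close> with
  label at least \<open>d\<close>; the induction descends from a label \<open>B\<close> that exceeds
  all others.\<close>

lemma card_layer_marked:
  assumes fin: "finite {u. D u \<noteq> 0}" "finite S"
    and par: "\<And>x. D x \<noteq> 0 \<Longrightarrow> x \<noteq> v \<Longrightarrow> D x = D (par x) + 1"
    and M: "\<And>u. u \<in> M \<Longrightarrow> D u \<noteq> 0 \<Longrightarrow> u \<in> S \<or> (\<exists>x\<in>M. D x \<noteq> 0 \<and> x \<noteq> v \<and> par x = u)"
    and "d \<noteq> (0::nat)"
  shows "card {u \<in> M. D u = d} \<le> card S"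
proof -
  define B where "B = Suc (Max (D ` {u. D u \<noteq> 0}) + d)"
  have B: "D u < B" for u
  proof (cases "D u = 0")
    case False
    then have "D u \<le> Max (D ` {u. D u \<noteq> 0})" using fin(1) by (intro Max_ge) auto
    then show ?thesis by (simp add: B_def)
  qed (simp add: B_def)
  have "d \<le> B" by (simp add: B_def)
  then have "d \<noteq> 0 \<Longrightarrow> card {u \<in> M. D u = d} \<le> card {u \<in> S. D u \<ge> d}"
  proof (induction rule: inc_induct)
    case base
    have "{u \<in> M. D u = B} = {}" using B less_irrefl by blast
    then show ?case by (metis card.empty le0)
  next
    case (step d)
    have f: "finite {u \<in> M. D u = Suc d}" by (rule finite_subset[OF _ fin(1)]) auto
    have "{u \<in> M. D u = d} \<subseteq> {u \<in> S. D u = d} \<union> par ` {u \<in> M. D u = Suc d}"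
    proof
      fix u assume u: "u \<in> {u \<in> M. D u = d}"
      then have "u \<in> S \<or> (\<exists>x\<in>M. D x \<noteq> 0 \<and> x \<noteq> v \<and> par x = u)" using M step.prems by auto
      then show "u \<in> {u \<in> S. D u = d} \<union> par ` {u \<in> M. D u = Suc d}"
        using u par by auto
    qed
    then have "card {u \<in> M. D u = d} \<le> card ({u \<in> S. D u = d} \<union> par ` {u \<in> M. D u = Suc d})"
      using f fin(2) by (intro card_mono) auto
    also have "\<dots> \<le> card {u \<in> S. D u = d} + card {u \<in> M. D u = Suc d}"
      using f by (meson add_left_mono card_Un_le card_image_le order_trans)
    also have "\<dots> \<le> card {u \<in> S. D u = d} + card {u \<in> S. D u \<ge> Suc d}"
      using step.IH by simp
    also have "\<dots> = card ({u \<in> S. D u = d} \<union> {u \<in> S. D u \<ge> Suc d})"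
      using fin(2) by (intro card_Un_disjoint[symmetric]) auto
    also have "{u \<in> S. D u = d} \<union> {u \<in> S. D u \<ge> Suc d} = {u \<in> S. D u \<ge> d}"
      by auto
    finally show ?case .
  qed
  also have "card {u \<in> S. D u \<ge> d} \<le> card S" using fin(2) by (intro card_mono) auto
  finally show ?thesis using assms(5) by blast
qed

text \<open>The marked part of the ball has the labels \<open>2\<close> to \<open>k + 1\<close>,
  that is \<open>k\<close> layers of at most \<open>card S\<close> vertices; the old set adds one
  more \<open>card S\<close>.\<close>

lemma card_round:
  assumes R: "round_step E v S k L D par M S'"
    and fin: "finite {u. D u \<noteq> 0}" "finite S"
    and M: "\<And>u. u \<in> M \<Longrightarrow> D u \<noteq> 0 \<Longrightarrow> u \<in> S \<or> (\<exists>x\<in>M. D x \<noteq> 0 \<and> x \<noteq> v \<and> par x = u)"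
    and S': "S' \<subseteq> S \<union> {u \<in> M. u \<noteq> v \<and> D u \<noteq> 0 \<and> D u \<le> k + 1} \<union> Z" and "finite Z"
  shows "card S' \<le> card S * (k + 1) + card Z"
proof -
  note bfs = round_stepD(1)[OF R]
  let ?B = "{u \<in> M. u \<noteq> v \<and> D u \<noteq> 0 \<and> D u \<le> k + 1}"
  have "?B \<subseteq> (\<Union>d\<in>{2..k + 1}. {u \<in> M. D u = d})"
  proof
    fix u assume u: "u \<in> ?B"
    then have "D u = D (par u) + 1" "D (par u) \<noteq> 0" using bfs_treeD(3,4)[OF bfs] by auto
    then show "u \<in> (\<Union>d\<in>{2..k + 1}. {u \<in> M. D u = d})" using u by auto
  qed
  moreover have "finite {u \<in> M. D u = d}" if "d \<in> {2..k + 1}" for d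
    using that by (intro finite_subset[OF _ fin(1)]) auto
  ultimately have "card ?B \<le> card (\<Union>d\<in>{2..k + 1}. {u \<in> M. D u = d})"
    by (intro card_mono) auto
  also have "\<dots> \<le> (\<Sum>d\<in>{2..k + 1}. card {u \<in> M. D u = d})" by (rule card_UN_le) auto
  also have "\<dots> \<le> (\<Sum>d\<in>{2..k + 1}. card S)"
    using bfs_treeD(4)[OF bfs] M fin by (intro sum_mono card_layer_marked[where v = v and par = par]) auto
  also have "\<dots> = k * card S" by simp
  finally have B: "card ?B \<le> k * card S" .
  have finB: "finite ?B" by (intro finite_subset[OF _ fin(1)]) auto
  have "card S' \<le> card (S \<union> ?B \<union> Z)"
    using S' fin(2) finB \<open>finite Z\<close> by (intro card_mono) auto
  also have "\<dots> \<le> card S + card ?B + card Z"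
    by (meson add_le_mono1 card_Un_le order_trans)
  finally show ?thesis using B by (simp add: algebra_simps)
qed

text \<open>The layers below the chosen radius are disjoint and large, so the radius is \<open>O (sqrt (n / s))\<close>.\<close>

lemma radius_bound:
  assumes layers: "\<And>j. 1 \<le> j \<Longrightarrow> j < k \<Longrightarrow> s * j < card {u. u < n \<and> D u = j + 1}"
  shows "s * (k - 1)\<^sup>2 \<le> 2 * (n::nat)"
proof (cases "k = 0")
  case False
  have "s * (\<Sum>j\<in>{1..<k}. j) \<le> (\<Sum>j\<in>{1..<k}. card {u. u < n \<and> D u = j + 1})"
    unfolding sum_distrib_left using layers by (intro sum_mono) (auto intro: less_imp_le)
  also have "\<dots> = card (\<Union>j\<in>{1..<k}. {u. u < n \<and> D u = j + 1})"
    by (intro card_UN_disjoint[symmetric]) auto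
  also have "\<dots> \<le> card {..<n}" by (intro card_mono) auto
  finally have 1: "s * (\<Sum>j\<in>{1..<k}. j) \<le> n" by simp
  have "(k - 1)\<^sup>2 \<le> 2 * (\<Sum>j\<in>{1..<k}. j)"
  proof -
    have "q\<^sup>2 \<le> 2 * (\<Sum>j\<in>{1..<Suc q}. j)" for q :: nat
      by (induction q) (auto simp: power2_eq_square algebra_simps)
    from this[of "k - 1"] show ?thesis using False by simp
  qed
  then have "s * (k - 1)\<^sup>2 \<le> s * (2 * (\<Sum>j\<in>{1..<k}. j))" by (rule mult_left_mono) simp
  with 1 show ?thesis by linarith
qed simp

text \<open>With \<open>q = k - 1\<close> one has
  \<open>(2 * q + 3)\<^sup>2 \<le> 10 * q\<^sup>2 + 15\<close>. As
  \<open>s * q\<^sup>2 \<le> 2 * n\<close> and \<open>s \<le> n\<close>, this yields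
  \<open>20 * n + 15 * n\<close>, and \<open>36\<close> rounds the \<open>35\<close> up.\<close>

lemma card_full_round:
  assumes card: "s' \<le> s * (2 * k + 1)" and "1 \<le> k" "s \<le> n" and k: "s * (k - 1)\<^sup>2 \<le> 2 * (n::nat)"
  shows "s'\<^sup>2 \<le> 36 * n * s"
proof -
  define q where "q = k - 1"
  have "12 * q \<le> 6 * q\<^sup>2 + 6"
  proof -
    have "0 \<le> (real q - 1)\<^sup>2" by simp
    then have "2 * real q \<le> (real q)\<^sup>2 + 1" by (simp add: power2_eq_square algebra_simps)
    then have "real (2 * q) \<le> real (q\<^sup>2 + 1)" by simp
    then have "2 * q \<le> q\<^sup>2 + 1" by (simp only: of_nat_le_iff)
    then show ?thesis by simp
  qed
  then have "(2 * q + 3)\<^sup>2 \<le> 10 * q\<^sup>2 + 15"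
    by (simp add: power2_eq_square algebra_simps)
  then have "s * (2 * q + 3)\<^sup>2 \<le> s * (10 * q\<^sup>2 + 15)" by (rule mult_left_mono) simp
  also have "\<dots> = 10 * (s * q\<^sup>2) + 15 * s" by (simp add: algebra_simps)
  also have "\<dots> \<le> 36 * n" using k \<open>s \<le> n\<close> unfolding q_def by linarith
  finally have *: "s * (2 * q + 3)\<^sup>2 \<le> 36 * n" .
  have "s'\<^sup>2 \<le> (s * (2 * q + 3))\<^sup>2"
    using card \<open>1 \<le> k\<close> unfolding q_def by (intro power_mono) (auto simp: algebra_simps)
  also have "\<dots> = s * (s * (2 * q + 3)\<^sup>2)" by (simp add: power2_eq_square algebra_simps)
  also have "\<dots> \<le> s * (36 * n)" using * by (rule mult_left_mono) simp
  finally show ?thesis by (simp add: algebra_simps)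
qed

text \<open>In the scale \<open>t = s / (36 n)\<close> a round satisfies \<open>t' \<le> sqrt t\<close>.\<close>

lemma iterated_sqrt_bound:
  fixes s :: "nat \<Rightarrow> nat"
  assumes "\<And>i. i < r \<Longrightarrow> (s (Suc i))\<^sup>2 \<le> 36 * n * s i" "n > 0"
  shows "i \<le> r \<Longrightarrow> (real (s i) / (36 * real n)) ^ (2 ^ i) \<le> real (s 0) / (36 * real n)"
proof (induction i)
  case (Suc i)
  have "real ((s (Suc i))\<^sup>2) \<le> real (36 * n * s i)"
    using assms(1)[of i] Suc.prems by (simp only: of_nat_le_iff)
  then have "(real (s (Suc i)) / (36 * real n))\<^sup>2 \<le> real (s i) / (36 * real n)"
    using assms(2) by (simp add: power2_eq_square field_simps)
  then have "((real (s (Suc i)) / (36 * real n))\<^sup>2) ^ (2 ^ i) \<le> (real (s i) / (36 * real n)) ^ (2 ^ i)"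
    by (intro power_mono) auto
  then show ?case using Suc by (simp flip: power_mult)
qed simp

text \<open>The second conjunct is what the greedy potential yields; for
  \<open>\<Delta> = (f + 1) * n div \<sigma> + 1\<close> it says that there are at most
  \<open>\<sigma>\<close> centers. The third one says that no further vertex would gain
  enough.\<close>

definition center_set :: "nat \<Rightarrow> nat \<Rightarrow> nat \<Rightarrow> nat set set \<Rightarrow> nat set \<Rightarrow> bool" where
  "center_set n f \<Delta> E C \<longleftrightarrow> C \<subseteq> {..<n} \<and> card C * \<Delta> \<le> n * (f + 1) \<and>
     (\<forall>c<n. c \<notin> C \<longrightarrow> card {a. {c, a} \<in> E \<and> card {c' \<in> C. {c', a} \<in> E} \<le> f} < \<Delta>)"

definition sparse_edges :: "nat \<Rightarrow> nat set set \<Rightarrow> nat set \<Rightarrow> nat set set" where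
  "sparse_edges f E C = {e \<in> E. \<exists>a\<in>e. card {c \<in> C. {c, a} \<in> E} \<le> f}"

text \<open>An edge with an unsaturated endpoint \<open>a\<close> is charged to the opposite
  endpoint \<open>c\<close>. A vertex outside \<open>C\<close> is charged fewer than
  \<open>\<Delta>\<close> times, a center at most \<open>n\<close> times.\<close>

lemma card_sparse_edges:
  assumes E: "simple_graph {..<n} E" and C: "center_set n f \<Delta> E C"
  shows "card (sparse_edges f E C) \<le> n * (\<Delta> - 1) + n * card C"
proof -
  let ?N = "\<lambda>c. {a. {c, a} \<in> E \<and> card {c' \<in> C. {c', a} \<in> E} \<le> f}"
  have V: "a < n" "c < n" if "{c, a} \<in> E" for a c
    using E that unfolding simple_graph_def by auto
  then have fin: "finite (?N c)" for c by (intro finite_subset[OF _ finite_lessThan[of n]]) auto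
  have finC: "finite C" using C finite_subset[OF _ finite_lessThan] unfolding center_set_def by blast
  let ?P = "(SIGMA c:{..<n} - C. ?N c) \<union> C \<times> {..<n}"
  have "sparse_edges f E C \<subseteq> (\<lambda>(c, a). {c, a}) ` ?P"
  proof
    fix e assume "e \<in> sparse_edges f E C"
    then obtain a where a: "e \<in> E" "a \<in> e" "card {c \<in> C. {c, a} \<in> E} \<le> f"
      unfolding sparse_edges_def by blast
    then have "card e = 2" using E unfolding simple_graph_def by blast
    then obtain c where c: "e = {c, a}" using a(2) unfolding card_2_iff by (auto simp: insert_commute)
    have "(c, a) \<in> ?P"
      using a V[of c a] unfolding c by auto
    then show "e \<in> (\<lambda>(c, a). {c, a}) ` ?P" unfolding c by force
  qed
  then have "card (sparse_edges f E C) \<le> card ?P"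
    using fin finC by (intro surj_card_le) auto
  also have "\<dots> \<le> card (SIGMA c:{..<n} - C. ?N c) + card (C \<times> {..<n})" by (rule card_Un_le)
  also have "card (SIGMA c:{..<n} - C. ?N c) = (\<Sum>c\<in>{..<n} - C. card (?N c))"
    using fin by (intro card_SigmaI) auto
  also have "\<dots> \<le> (\<Sum>c\<in>{..<n} - C. \<Delta> - 1)"
    using C unfolding center_set_def by (intro sum_mono) fastforce
  also have "\<dots> \<le> n * (\<Delta> - 1)"
    using card_mono[of "{..<n}" "{..<n} - C"] by simp
  finally show ?thesis by (simp add: card_cartesian_product mult.commute)
qed

text \<open>In terms of \<open>\<rho> = n powr (1 / (2 ^ f + 1))\<close> the target is
  \<open>X = n\<^sup>2 / \<rho>\<close>, and \<open>\<rho> \<le> \<sigma> \<le> 2 * \<rho>\<close>.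
  Sparse edges charged to non-centers, those charged to centers, and the edges between each
  \<open>v\<close> and its last set contribute \<open>(f + 1) * X\<close>, \<open>2 * X\<close> and
  \<open>72 * X\<close>.\<close>

lemma spanner_size:
  assumes n: "n \<ge> 1" and f: "f \<ge> 1" and E: "simple_graph {..<n} E"
    and \<sigma>: "\<sigma> \<ge> 1" "n \<le> \<sigma> ^ (2 ^ f + 1)" "\<sigma> = 1 \<or> (\<sigma> - 1) ^ (2 ^ f + 1) < n"
    and C: "center_set n f ((f + 1) * n div \<sigma> + 1) E C"
    and S0: "\<And>v. v < n \<Longrightarrow> S v 0 = C - {v}"
    and Si: "\<And>v i. v < n \<Longrightarrow> i < f \<Longrightarrow> (card (S v (Suc i)))\<^sup>2 \<le> 36 * n * card (S v i)"
    and Sf: "\<And>v. v < n \<Longrightarrow> card (S v (Suc f)) \<le> 2 * card (S v f)"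
    and fin: "\<And>v. v < n \<Longrightarrow> finite (S v (Suc f))"
    and H: "H \<subseteq> sparse_edges f E C \<union> (\<Union>v\<in>{..<n}. (\<lambda>y. {y, v}) ` S v (Suc f))"
  shows "real (card H) \<le> 76 * (real f * real n powr (2 - 1 / (2 ^ f + 1)))"
proof -
  define b :: nat where "b = 2 ^ f + 1"
  define \<rho> where "\<rho> = real n powr (1 / b)"
  define X where "X = real n powr (2 - 1 / b)"
  have b: "b \<ge> 3" using f power_increasing[of 1 f "2::nat"] unfolding b_def by simp
  have \<rho>1: "\<rho> \<ge> 1" unfolding \<rho>_def using n b by (intro ge_one_powr_ge_zero) auto
  have \<rho>b: "\<rho> ^ b = n" unfolding \<rho>_def using n b by (simp add: powr_power)
  have X: "X = (real n)\<^sup>2 / \<rho>"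
    unfolding X_def \<rho>_def using n by (simp add: powr_diff powr_realpow flip: powr_numeral)
  have \<rho>\<sigma>: "\<rho> \<le> \<sigma>"
  proof (rule power_le_imp_le_base)
    show "\<rho> ^ Suc (2 ^ f) \<le> real \<sigma> ^ Suc (2 ^ f)"
      using \<rho>b \<sigma>(2) unfolding b_def by (metis Suc_eq_plus1 of_nat_le_iff of_nat_power)
  qed simp
  have \<sigma>\<rho>: "\<sigma> \<le> 2 * \<rho>"
  proof (cases "\<sigma> = 1")
    case True
    then show ?thesis using \<rho>1 by simp
  next
    case False
    then have "real (\<sigma> - 1) ^ Suc (2 ^ f) \<le> \<rho> ^ Suc (2 ^ f)"
      using \<rho>b \<sigma>(3) unfolding b_def by (metis Suc_eq_plus1 of_nat_le_iff of_nat_power less_imp_le)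
    then have "real (\<sigma> - 1) \<le> \<rho>" by (rule power_le_imp_le_base) (use \<rho>1 in auto)
    then show ?thesis using \<rho>1 \<sigma>(1) by linarith
  qed
  have C\<sigma>: "card C \<le> \<sigma>"
  proof -
    have "card C * ((f + 1) * n div \<sigma> + 1) \<le> (f + 1) * n"
      using C unfolding center_set_def by (simp add: mult.commute)
    moreover have "(f + 1) * n < \<sigma> * ((f + 1) * n div \<sigma> + 1)"
      using \<sigma>(1) by (metis Suc_eq_plus1 dividend_less_times_div less_eq_Suc_le mult_Suc_right add.commute One_nat_def)
    ultimately have "card C * ((f + 1) * n div \<sigma> + 1) < \<sigma> * ((f + 1) * n div \<sigma> + 1)" by (rule le_less_trans)
    then show ?thesis by (metis mult_less_cancel2 less_imp_le)
  qed
  have finC: "finite C" using C finite_subset[OF _ finite_lessThan] unfolding center_set_def by blast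
  have last: "real (card (S v (Suc f))) \<le> 72 * (real n / \<rho>)" if v: "v < n" for v
  proof -
    let ?t = "real (card (S v f)) / (36 * real n)"
    have "?t ^ (2 ^ f) \<le> real (card (S v 0)) / (36 * real n)"
      using iterated_sqrt_bound[of f "\<lambda>i. card (S v i)" n f] Si[OF v] n by simp
    also have "card (S v 0) \<le> \<sigma>"
      using C\<sigma> card_mono[OF finC, of "C - {v}"] S0[OF v] by simp
    then have "real (card (S v 0)) / (36 * real n) \<le> \<rho> / real n"
      using \<sigma>\<rho> \<rho>1 n by (simp add: field_simps)
    \<comment> \<open>This is where the exponent \<open>2 ^ f + 1\<close> is balanced: since
      \<open>\<rho> ^ (2 ^ f + 1) = n\<close>, taking \<open>f\<close> square roots of
      \<open>\<rho> / n\<close> gives exactly \<open>1 / \<rho>\<close>.\<close>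
    also have "\<rho> / real n = (1 / \<rho>) ^ (2 ^ f)"
      using \<rho>1 \<rho>b[symmetric] unfolding b_def by (simp add: field_simps)
    finally have "?t \<le> 1 / \<rho>"
      using \<rho>1 by (intro power_mono_iff[THEN iffD1, of ?t "1 / \<rho>" "2 ^ f"]) auto
    then have "real (card (S v f)) \<le> 36 * (real n / \<rho>)" using n \<rho>1 by (simp add: field_simps)
    moreover have "real (card (S v (Suc f))) \<le> 2 * real (card (S v f))" using Sf[OF v] by linarith
    ultimately show ?thesis by linarith
  qed
  have "E \<subseteq> Pow {..<n}" using E unfolding simple_graph_def by blast
  then have "sparse_edges f E C \<subseteq> Pow {..<n}" unfolding sparse_edges_def by blast
  then have fC: "finite (sparse_edges f E C)" by (rule finite_subset) simp
  have fU: "finite (\<Union>v\<in>{..<n}. (\<lambda>y. {y, v}) ` S v (Suc f))" using fin by auto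
  have "card H \<le> card (sparse_edges f E C \<union> (\<Union>v\<in>{..<n}. (\<lambda>y. {y, v}) ` S v (Suc f)))"
    using fC fU H by (intro card_mono) auto
  also have "\<dots> \<le> card (sparse_edges f E C) + card (\<Union>v\<in>{..<n}. (\<lambda>y. {y, v}) ` S v (Suc f))"
    by (rule card_Un_le)
  also have "\<dots> \<le> (n * ((f + 1) * n div \<sigma>) + n * card C) + (\<Sum>v<n. card (S v (Suc f)))"
    using card_sparse_edges[OF E C] fin
    by (intro add_mono order_trans[OF card_UN_le] sum_mono card_image_le) auto
  finally have "real (card H) \<le> real (n * ((f + 1) * n div \<sigma>) + n * card C + (\<Sum>v<n. card (S v (Suc f))))"
    by (simp only: of_nat_le_iff)
  also have "\<dots> = real n * real ((f + 1) * n div \<sigma>) + real n * real (card C) +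
      (\<Sum>v<n. real (card (S v (Suc f))))"
    by (simp only: of_nat_add of_nat_mult of_nat_sum)
  also have "(\<Sum>v<n. real (card (S v (Suc f)))) \<le> (\<Sum>v<n. 72 * (real n / \<rho>))"
    using last by (intro sum_mono) auto
  also have "(\<Sum>v<n. 72 * (real n / \<rho>)) = 72 * X" by (simp add: X power2_eq_square)
  also have "real n * real ((f + 1) * n div \<sigma>) \<le> (real f + 1) * X"
  proof -
    have "real ((f + 1) * n div \<sigma>) \<le> real ((f + 1) * n) / real \<sigma>" by (rule of_nat_div_le_of_nat)
    also have "\<dots> \<le> real ((f + 1) * n) / \<rho>" using \<rho>\<sigma> \<rho>1 by (intro divide_left_mono) auto
    finally have "real n * real ((f + 1) * n div \<sigma>) \<le> real n * (real ((f + 1) * n) / \<rho>)"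
      by (rule mult_left_mono) simp
    then show ?thesis by (simp add: X power2_eq_square algebra_simps)
  qed
  also have "real n * real (card C) \<le> 2 * X"
  proof -
    \<comment> \<open>From \<open>b \<ge> 3\<close> one gets \<open>\<rho>\<^sup>2 \<le> n\<close>,
      so the \<open>n * \<rho>\<close> edges at the centers stay below
      \<open>n\<^sup>2 / \<rho>\<close>.\<close>
    have "\<rho>\<^sup>2 \<le> \<rho> ^ b" using \<rho>1 b by (intro power_increasing) auto
    then have "\<rho> * \<rho> \<le> real n" using \<rho>b by (simp add: power2_eq_square)
    then have "real n * \<rho> \<le> X" using \<rho>1 n unfolding X
      by (simp add: pos_le_divide_eq power2_eq_square mult.assoc)
    moreover have "real n * real (card C) \<le> real n * (2 * \<rho>)"
      using C\<sigma> \<sigma>\<rho> by (intro mult_left_mono) auto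
    ultimately show ?thesis by linarith
  qed
  finally have "real (card H) \<le> (real f + 75) * X" by (simp add: algebra_simps)
  also have "\<dots> \<le> (76 * real f) * X" using f by (intro mult_right_mono) (auto simp: X_def)
  finally show ?thesis unfolding X_def b_def by (simp add: add.commute mult.assoc)
qed

section \<open>Adjacency lists\<close>

text \<open>Registers: 0 \<open>n\<close>, 1 \<open>m\<close>, 2 \<open>f\<close>, 6 \<open>\<sigma>\<close>, 9 \<open>\<Delta>\<close>, 12 \<open>v\<close>, 13 round, 14 and 15 head and tail of the
  queue, 17 \<open>|S|\<close>, 18 radius plus one; the others are loop counters and temporaries.
  Arrays: 0 and 1 edges, 2 and 3 offsets and targets of the adjacency lists, 4 number of adjacent
  centers, 5 centers, 6 kept edges, 7 \<open>S\<close>, 8 labels \<open>D\<close>, 9 queue, 10 parents, 11 layer sizes,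
  12 \<open>M\<close>.\<close>

abbreviation Seq_infix :: "prog \<Rightarrow> prog \<Rightarrow> prog" (infixr ";;" 60) where
  "p ;; q \<equiv> Seq p q"

abbreviation skip :: prog where "skip \<equiv> Set_Reg 20 (Const 0)"
abbreviation incr :: "nat \<Rightarrow> prog" where "incr x \<equiv> Set_Reg x (Add (Reg x) (Const 1))"

text \<open>Subtracting the known endpoint from the sum of both yields the other one in either
  orientation. The sum of the two tests acts as a disjunction.\<close>

definition adjacency_step :: prog where
  "adjacency_step =
     If (Add (Eq (Cell 0 (Reg 4)) (Reg 3)) (Eq (Cell 1 (Reg 4)) (Reg 3)))
       (Set_Cell 3 (Reg 5) (Sub (Add (Cell 0 (Reg 4)) (Cell 1 (Reg 4))) (Reg 3)) ;; incr 5)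
       skip"

text \<open>One scan of all edges per vertex costs \<open>O (n m)\<close>, which the budget allows,
  and lays the rows out contiguously. The last instruction stores the end of the last row.\<close>

definition adjacency_prog :: prog where
  "adjacency_prog =
     Set_Reg 5 (Const 0) ;;
     For 3 (Reg 0) (Set_Cell 2 (Reg 3) (Reg 5) ;; For 4 (Reg 1) adjacency_step) ;;
     Set_Cell 2 (Reg 0) (Reg 5)"

lemma written_adjacency [simp]:
  "wregs adjacency_step = {5, 20}" "warrs adjacency_step = {3}"
  "wregs adjacency_prog = {3, 4, 5, 20}" "warrs adjacency_prog = {2, 3}"
  by (auto simp: adjacency_step_def adjacency_prog_def)

definition nbrs :: "nat \<Rightarrow> (nat \<times> nat) list \<Rightarrow> nat list" where
  "nbrs u l = map (\<lambda>(a, b). a + b - u) (filter (\<lambda>(a, b). a = u \<or> b = u) l)"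

lemma nbrs_Nil [simp]: "nbrs u [] = []"
  by (simp add: nbrs_def)

lemma nbrs_take_Suc:
  "j < length l \<Longrightarrow> nbrs u (take (Suc j) l) =
     (if fst (l ! j) = u \<or> snd (l ! j) = u then nbrs u (take j l) @ [fst (l ! j) + snd (l ! j) - u]
      else nbrs u (take j l))"
  by (auto simp: nbrs_def take_Suc_conv_app_nth split: prod.splits)

text \<open>The cube leaves room for all intermediate values, the largest being
  \<open>2 * m\<close>, \<open>n * n\<close> and \<open>(f + 1) * n\<close> up to small constants;
  this is why the word length uses the factor \<open>3\<close>.\<close>

locale ram_graph =
  fixes w n f :: nat and E :: "nat set set" and es :: "(nat \<times> nat) list"
  assumes graph: "simple_graph {..<n} E" and es: "lists_edges es E"
    and word: "(n + f + 2) ^ 3 \<le> 2 ^ w"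
begin

abbreviation m :: nat where "m \<equiv> length es"

lemma edgeD:
  assumes "{a, b} \<in> E" shows "a < n" "b < n" "a \<noteq> b"
  using graph assms unfolding simple_graph_def by (auto dest!: bspec)

lemma finite_E: "finite E"
  using graph unfolding simple_graph_def
  by (intro finite_subset[of E "Pow {..<n}"]) auto

definition edge :: "nat \<Rightarrow> nat set" where
  "edge j = {fst (es ! j), snd (es ! j)}"

lemma edge_image: "edge ` {..<m} = E"
proof -
  have "E = (\<lambda>(u, v). {u, v}) ` set es" using es by (simp add: lists_edges_def)
  also have "set es = (!) es ` {..<m}" by (auto simp: set_conv_nth)
  finally show ?thesis by (simp add: image_image edge_def case_prod_beta)
qed

lemma edge_in: "j < m \<Longrightarrow> edge j \<in> E"
  using edge_image by blast

lemma edge_endpoints: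
  assumes "j < m"
  shows "fst (es ! j) < n" "snd (es ! j) < n" "fst (es ! j) \<noteq> snd (es ! j)"
  using edgeD[of "fst (es ! j)" "snd (es ! j)"] edge_in[OF assms] by (auto simp: edge_def)

lemma m_le: "m \<le> n * n"
proof -
  have "E \<subseteq> (\<lambda>(a, b). {a, b}) ` ({..<n} \<times> {..<n})"
  proof
    fix e assume "e \<in> E"
    then obtain j where "j < m" "e = edge j" using edge_image by blast
    then show "e \<in> (\<lambda>(a, b). {a, b}) ` ({..<n} \<times> {..<n})"
      using edge_endpoints[of j] by (auto simp: edge_def)
  qed
  then have "card E \<le> card ({..<n} \<times> {..<n})" by (intro surj_card_le) auto
  then show ?thesis using es by (simp add: lists_edges_def)
qed

lemma word_bounds:
  "8 \<le> (2::nat) ^ w" "2 * m + 4 < 2 ^ w" "n + f + 4 < 2 ^ w" "(f + 1) * n + 4 < 2 ^ w" "n * n + 4 < 2 ^ w"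
  "2 * n + 4 < 2 ^ w"
proof -
  define z where "z = n + f"
  have "n * n \<le> z * z" "f * n \<le> z * z" "n \<le> z" unfolding z_def by (auto intro: mult_mono)
  have "z\<^sup>2 + 4 * z + 4 \<le> (z + 2)\<^sup>2" by (simp add: power2_eq_square algebra_simps)
  have *: "(z + 2) ^ 3 = z * z * z + 6 * (z * z) + 12 * z + 8"
    by (simp add: power3_eq_cube algebra_simps)
  note b = word[folded z_def, unfolded *]
  show "8 \<le> (2::nat) ^ w" using b by linarith
  show "n * n + 4 < 2 ^ w" using b \<open>n * n \<le> z * z\<close> by linarith
  show "2 * m + 4 < 2 ^ w" using b \<open>n * n \<le> z * z\<close> m_le by linarith
  show "2 * n + 4 < 2 ^ w" using b \<open>n \<le> z\<close> by linarith
  have "z + 4 < 2 ^ w" using b by linarith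
  then show "n + f + 4 < 2 ^ w" by (simp add: z_def)
  have "f * n + n + 4 < 2 ^ w" using b \<open>f * n \<le> z * z\<close> \<open>n \<le> z\<close> by linarith
  then show "(f + 1) * n + 4 < 2 ^ w" by simp
qed

lemma const_mod [simp]: "Suc 0 mod 2 ^ w = Suc 0" "Suc (Suc 0) mod 2 ^ w = Suc (Suc 0)" "2 mod 2 ^ w = (2::nat)" "w \<noteq> 0" "0 < w"
  using word_bounds(1) by (auto intro!: mod_less gr0I)

definition input :: "state \<Rightarrow> bool" where
  "input s \<longleftrightarrow> reg s 0 = n \<and> reg s 1 = m \<and> reg s 2 = f \<and>
     (\<forall>j<m. arr s 0 j = fst (es ! j) \<and> arr s 1 j = snd (es ! j))"

lemma inputD:
  assumes "input s"
  shows "reg s 0 = n" "reg s (Suc 0) = m" "reg s 1 = m" "reg s 2 = f"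
    "j < m \<Longrightarrow> arr s 0 j = fst (es ! j)" "j < m \<Longrightarrow> arr s (Suc 0) j = snd (es ! j)"
    "j < m \<Longrightarrow> arr s 1 j = snd (es ! j)"
  using assms by (auto simp: input_def)

lemma same_input: "input s \<Longrightarrow> same R A s s' \<Longrightarrow> R \<inter> {0, 1, 2} = {} \<Longrightarrow> A \<inter> {0, 1} = {} \<Longrightarrow> input s'"
  unfolding input_def same_def by (auto simp: disjoint_iff)

definition deg :: "nat \<Rightarrow> nat" where "deg u = length (nbrs u es)"
definition offset :: "nat \<Rightarrow> nat" where "offset u = (\<Sum>x<u. deg x)"

lemma set_nbrs: "set (nbrs u es) = {x. {u, x} \<in> E}"
proof -
  have E: "E = (\<lambda>p. {fst p, snd p}) ` set es"
    using es by (simp add: lists_edges_def case_prod_beta)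
  have 1: "{u, x} \<in> E \<longleftrightarrow> (\<exists>p\<in>set es. {u, x} = {fst p, snd p})" for x
    unfolding E by (rule image_iff)
  have 2: "x \<in> set (nbrs u es) \<longleftrightarrow>
      (\<exists>p\<in>set es. (fst p = u \<or> snd p = u) \<and> x = fst p + snd p - u)" for x
    unfolding nbrs_def by (force simp: image_iff case_prod_beta)
  have 3: "{u, x} = {fst p, snd p} \<longleftrightarrow> (fst p = u \<or> snd p = u) \<and> x = fst p + snd p - u"
    for p :: "nat \<times> nat" and x
    by (auto simp: doubleton_eq_iff)
  show ?thesis by (rule set_eqI) (simp only: 1 2 3 mem_Collect_eq)
qed

text \<open>Since \<open>length es = card E\<close>, no edge is listed twice, not even in opposite
  orientations.\<close>

lemma distinct_nbrs: "distinct (nbrs u es)"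
proof -
  have "distinct es"
  proof (rule card_distinct)
    have "card E \<le> card (set es)" using es unfolding lists_edges_def by (metis card_image_le List.finite_set)
    then show "card (set es) = length es"
      using es card_length[of es] unfolding lists_edges_def by linarith
  qed
  moreover have "inj_on (\<lambda>(a, b). {a, b}) (set es)"
    using es \<open>distinct es\<close> distinct_card[of es] unfolding lists_edges_def
    by (intro eq_card_imp_inj_on) auto
  then have "inj_on (\<lambda>(a, b). a + b - u) {e \<in> set es. case e of (a, b) \<Rightarrow> a = u \<or> b = u}"
    unfolding inj_on_def by (fastforce simp: doubleton_eq_iff)
  ultimately show ?thesis unfolding nbrs_def by (simp add: distinct_map)
qed

lemma deg_card: "deg u = card {x. {u, x} \<in> E}"
  unfolding deg_def using distinct_card[OF distinct_nbrs, of u] by (simp add: set_nbrs)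

lemma sum_deg: "(\<Sum>u<n. deg u) \<le> 2 * m"
proof -
  have "(\<Sum>u<n. length (nbrs u l)) \<le> 2 * length l" for l
  proof (induction l)
    case (Cons e l)
    have "(\<Sum>u<n. length (nbrs u (e # l))) =
        (\<Sum>u<n. length (nbrs u l) + (if u \<in> {fst e, snd e} then 1 else 0))"
      by (intro sum.cong) (auto simp: nbrs_def)
    also have "\<dots> = (\<Sum>u<n. length (nbrs u l)) + card ({..<n} \<inter> {fst e, snd e})"
    proof -
      have "{..<n} \<inter> {u. u = fst e \<or> u = snd e} = {..<n} \<inter> {fst e, snd e}" by auto
      then show ?thesis unfolding sum.distrib by (simp add: sum.If_cases)
    qed
    also have "card ({..<n} \<inter> {fst e, snd e}) \<le> 2"
      by (rule order_trans[OF card_mono[of "{fst e, snd e}"]]) (auto simp: card_insert_if)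
    finally show ?case using Cons.IH by simp
  qed (simp)
  then show ?thesis by (simp add: deg_def)
qed

lemma offset_Suc: "offset (Suc u) = offset u + deg u"
  by (simp add: offset_def)

lemma offset_mono: "u \<le> u' \<Longrightarrow> offset u \<le> offset u'"
  unfolding offset_def by (intro sum_mono2) auto

lemma offset_le: "u \<le> n \<Longrightarrow> offset u \<le> 2 * m"
  using offset_mono[of u n] sum_deg by (simp add: offset_def)

definition adj :: "state \<Rightarrow> bool" where
  "adj s \<longleftrightarrow> input s \<and> (\<forall>u\<le>n. arr s 2 u = offset u) \<and>
     (\<forall>u<n. \<forall>i<deg u. arr s 3 (offset u + i) = nbrs u es ! i)"

lemma adjD:
  assumes "adj s"
  shows "input s" "u \<le> n \<Longrightarrow> arr s 2 u = offset u"
    "u < n \<Longrightarrow> i < deg u \<Longrightarrow> arr s 3 (offset u + i) = nbrs u es ! i"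
  using assms by (auto simp: adj_def)

lemma same_adj:
  assumes "adj s" "same R A s s'" "R \<inter> {0, 1, 2} = {}" "A \<inter> {0, 1, 2, 3} = {}"
  shows "adj s'"
proof -
  have "arr s' 2 = arr s 2" "arr s' 3 = arr s 3"
    using assms by (auto simp: same_def disjoint_iff)
  moreover have "input s'" using assms by (intro same_input[OF adjD(1)]) auto
  ultimately show ?thesis using assms(1) by (simp add: adj_def)
qed

definition row_inv :: "nat \<Rightarrow> nat \<Rightarrow> state \<Rightarrow> bool" where
  "row_inv u j s \<longleftrightarrow> reg s 3 = u \<and> reg s 5 = offset u + length (nbrs u (take j es)) \<and>
     (\<forall>i<length (nbrs u (take j es)). arr s 3 (offset u + i) = nbrs u (take j es) ! i) \<and>
     (\<forall>u'<u. \<forall>i<deg u'. arr s 3 (offset u' + i) = nbrs u' es ! i)"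

lemma adjacency_step_correct:
  assumes "input s" "u < n" "j < m" "row_inv u j s" "reg s 4 = j"
  shows "tr w adjacency_step s 4 (\<lambda>s'. reg s' 4 = j \<and> row_inv u (Suc j) (set_reg 4 (Suc j) s'))"
proof (rule tr_flat)
  let ?L = "length (nbrs u (take j es))"
  have "?L \<le> deg u"
    unfolding deg_def using append_take_drop_id[of j es]
    by (metis (no_types, lifting) filter_append le_add1 length_append length_map nbrs_def)
  then have "Suc (offset u + ?L) < 2 ^ w"
    using offset_le[of "Suc u"] assms(2) word_bounds(2) by (simp add: offset_Suc)
  moreover have "fst (es ! j) + snd (es ! j) < 2 ^ w"
  proof -
    have "fst (es ! j) + snd (es ! j) < 2 * n" using edge_endpoints[OF assms(3)] by linarith
    also have "\<dots> < 2 ^ w" using word_bounds(6) by linarith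
    finally show ?thesis .
  qed
  \<comment> \<open>Entries written for \<open>u\<close> lie beyond the rows of all smaller vertices
    and leave them intact.\<close>
  moreover have "offset u' + i \<noteq> offset u + k" if "u' < u" "i < deg u'" for u' i k
    using that offset_mono[of "Suc u'" u] by (simp add: offset_Suc)
  ultimately show "reg (result w adjacency_step s) 4 = j \<and> row_inv u (Suc j) (set_reg 4 (Suc j) (result w adjacency_step s))"
    using assms(2-) edge_endpoints[OF assms(3)] inputD[OF assms(1)]
    by (auto simp: row_inv_def adjacency_step_def nbrs_take_Suc nth_append less_Suc_eq)
qed (simp_all add: adjacency_step_def)

lemma adjacency_correct:
  assumes "input s"
  shows "tr w adjacency_prog s (n * (7 * m + 8) + 7) adj"
proof -
  define I where "I u s1 \<longleftrightarrow> reg s1 5 = offset u \<and> (\<forall>u'<u. arr s1 2 u' = offset u') \<and>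
     (\<forall>u'<u. \<forall>i<deg u'. arr s1 3 (offset u' + i) = nbrs u' es ! i)" for u and s1 :: state
  let ?row = "Set_Cell 2 (Reg 3) (Reg 5) ;; For 4 (Reg 1) adjacency_step"
  have row: "tr w ?row s2 (7 * m + 5) (\<lambda>s'. reg s' 3 = u \<and> I (Suc u) (set_reg 3 (Suc u) s'))"
    if u: "u < n" "I u s2" "reg s2 3 = u" "input s2" for u s2
  proof (rule tr_Seq[where T = 1 and Q = "\<lambda>s'. s' = set_cell 2 u (offset u) s2"])
    show "tr w (Set_Cell 2 (Reg 3) (Reg 5)) s2 1 (\<lambda>s'. s' = set_cell 2 u (offset u) s2)"
      using u by (intro tr_flat) (auto simp: I_def)
  next
    fix s3 assume s3: "s3 = set_cell 2 u (offset u) s2"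
    have inp: "input s3" using u(4) unfolding s3 input_def by simp
    show "tr w (For 4 (Reg 1) adjacency_step) s3 (7 * m + 3)
        (\<lambda>s'. reg s' 3 = u \<and> I (Suc u) (set_reg 3 (Suc u) s'))"
    proof (rule tr_For[where N = m and I = "row_inv u" and c = 4])
      show "row_inv u 0 (set_reg 4 0 s3)" using u by (simp add: row_inv_def I_def s3)
    next
      fix i s4 assume "frame_for 4 adjacency_step s3 s4"
      then have "input s4" using same_input[OF inp] by auto
      then show "val w s4 (Reg 1) = m" by (simp add: inputD)
      assume "i < m" "row_inv u i s4" "reg s4 4 = i"
      then show "tr w adjacency_step s4 4 (\<lambda>s'. reg s' 4 = i \<and> row_inv u (Suc i) (set_reg 4 (Suc i) s'))"
        using \<open>input s4\<close> u(1) by (intro adjacency_step_correct) auto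
    next
      fix s4 assume J: "row_inv u m s4" and same: "frame_for 4 adjacency_step s3 s4"
      have "arr s4 2 = arr s3 2" using same by (auto simp: same_def)
      then show "reg s4 3 = u \<and> I (Suc u) (set_reg 3 (Suc u) s4)"
        using J u(2) by (auto simp: row_inv_def I_def s3 less_Suc_eq offset_Suc deg_def)
    qed (use word_bounds in auto)
  qed simp
  show ?thesis
    unfolding adjacency_prog_def
  proof (rule tr_Seq[where T = 1 and Q = "\<lambda>s1. s1 = set_reg 5 0 s"], rule tr_flat)
    fix s1 assume s1: "s1 = set_reg 5 0 s"
    then have inp: "input s1" using assms by (simp add: input_def)
    show "tr w (For 3 (Reg 0) ?row ;; Set_Cell 2 (Reg 0) (Reg 5)) s1 (n * (7 * m + 8) + 5) adj"
    proof (rule tr_Seq[where T' = 1], rule tr_For[where N = n and I = I and c = "7 * m + 5"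
        and Q = "\<lambda>s2. I n s2 \<and> input s2"])
      show "I 0 (set_reg 3 0 s1)" using s1 by (simp add: I_def offset_def)
    next
      fix u s2 assume "frame_for 3 ?row s1 s2"
      then have "input s2" using same_input[OF inp] by auto
      then show "val w s2 (Reg 0) = n" by (simp add: inputD)
      assume "u < n" "I u s2" "reg s2 3 = u"
      then show "tr w ?row s2 (7 * m + 5) (\<lambda>s'. reg s' 3 = u \<and> I (Suc u) (set_reg 3 (Suc u) s'))"
        using row \<open>input s2\<close> by blast
    next
      fix s2 assume "I n s2" "frame_for 3 ?row s1 s2"
      then show "I n s2 \<and> input s2" using same_input[OF inp] by auto
    next
      fix s2 assume "I n s2 \<and> input s2"
      then show "tr w (Set_Cell 2 (Reg 0) (Reg 5)) s2 1 adj"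
        by (intro tr_flat) (auto simp: I_def adj_def input_def le_less)
    qed (use word_bounds in auto)
  qed simp_all
qed

end

section \<open>The cluster centers\<close>

definition cap :: prog where
  "cap = If (Less (Reg 0) (Reg 7)) (Set_Reg 7 (Reg 0)) skip"

text \<open>The exponent \<open>2 ^ f + 1\<close> arises from \<open>f\<close> squarings and one
  more multiplication, so \<open>f\<close> enters the running time only linearly.\<close>

definition power_prog :: prog where
  "power_prog = Set_Reg 7 (Reg 6) ;; For 8 (Reg 2) (Set_Reg 7 (Mul (Reg 7) (Reg 7)) ;; cap) ;;
     Set_Reg 7 (Mul (Reg 7) (Reg 6)) ;; cap"

text \<open>Computes the least \<open>\<sigma>\<close> with \<open>n \<le> \<sigma> ^ (2 ^ f + 1)\<close>, an integer substitute for
  \<open>n powr (1 / (2 ^ f + 1))\<close>. The powers are capped at \<open>n\<close> to fit into a word.\<close>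

definition threshold_prog :: prog where
  "threshold_prog = Set_Reg 6 (Const 0) ;; Set_Reg 7 (Const 0) ;;
     While (Less (Reg 7) (Reg 0)) (incr 6 ;; power_prog) ;;
     Set_Reg 9 (Add (Div (Mul (Add (Reg 2) (Const 1)) (Reg 0)) (Reg 6)) (Const 1))"

definition ForNbr :: "nat \<Rightarrow> nat \<Rightarrow> prog \<Rightarrow> prog" where
  "ForNbr x y p = ForR x (Cell 2 (Reg y)) (Cell 2 (Add (Reg y) (Const 1))) p"

definition count_step :: prog where
  "count_step = If (Less (Reg 2) (Cell 4 (Cell 3 (Reg 4)))) skip (incr 11)"

definition mark_step :: prog where
  "mark_step = Set_Cell 4 (Cell 3 (Reg 4)) (Add (Cell 4 (Cell 3 (Reg 4))) (Const 1))"

definition center_step :: prog where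
  "center_step = Set_Reg 11 (Const 0) ;; ForNbr 4 10 count_step ;;
     If (Less (Reg 11) (Reg 9)) skip (Set_Cell 5 (Reg 10) (Const 1) ;; ForNbr 4 10 mark_step)"

definition centers_prog :: prog where
  "centers_prog = For 10 (Reg 0) center_step"

definition sparse_step :: prog where
  "sparse_step = Set_Cell 6 (Reg 4) (Add
     (Less (Cell 4 (Cell 0 (Reg 4))) (Add (Reg 2) (Const 1)))
     (Less (Cell 4 (Cell 1 (Reg 4))) (Add (Reg 2) (Const 1))))"

definition sparse_prog :: prog where
  "sparse_prog = For 4 (Reg 1) sparse_step"

lemma written_ForNbr [simp]:
  "wregs (ForNbr x y p) = insert x (wregs p)" "warrs (ForNbr x y p) = warrs p"
  by (auto simp: ForNbr_def)

lemma written_centers [simp]: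
  "wregs cap = {7, 20}" "warrs cap = {}"
  "wregs power_prog = {7, 8, 20}" "warrs power_prog = {}"
  "wregs threshold_prog = {6, 7, 8, 9, 20}" "warrs threshold_prog = {}"
  "wregs count_step = {11, 20}" "warrs count_step = {}"
  "wregs mark_step = {}" "warrs mark_step = {4}"
  "wregs center_step = {4, 11, 20}" "warrs center_step = {4, 5}"
  "wregs centers_prog = {4, 10, 11, 20}" "warrs centers_prog = {4, 5}"
  "wregs sparse_step = {}" "warrs sparse_step = {6}"
  "wregs sparse_prog = {4}" "warrs sparse_prog = {6}"
  by (auto simp: cap_def power_prog_def threshold_prog_def count_step_def mark_step_def
    center_step_def centers_prog_def sparse_step_def sparse_prog_def)

text \<open>A value that has reached \<open>n\<close> stays there under multiplication by
  \<open>b \<ge> 1\<close>, so capping intermediate results does not change the capped final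
  result.\<close>

lemma min_mult_min:
  fixes a b n :: nat
  assumes "b \<ge> 1"
  shows "min (min a n * b) n = min (a * b) n"
proof (cases "a \<le> n")
  case False
  then have "n \<le> n * b" "n \<le> a * b" using assms mult_le_mono[of n a 1 b] by auto
  then show ?thesis using False by simp
qed simp

lemma min_square_min:
  fixes a n :: nat
  shows "min (min a n * min a n) n = min (a * a) n"
proof (cases "a \<le> n")
  case False
  then have "n \<le> n * n" "n \<le> a * a" by (auto intro: order_trans[OF _ mult_le_mono] le_square)
  then show ?thesis using False by simp
qed simp

context ram_graph
begin

lemma power_correct:
  assumes "input s" "reg s 6 = \<sigma>" "1 \<le> \<sigma>" "\<sigma> \<le> n"
  shows "tr w power_prog s (7 * f + 10) (\<lambda>s'. reg s' 7 = min (\<sigma> ^ (2 ^ f + 1)) n)"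
    (is "tr w _ s _ ?Q")
proof -
  let ?sq = "Set_Reg 7 (Mul (Reg 7) (Reg 7)) ;; cap"
  have nn: "x * y < 2 ^ w" if "x \<le> n" "y \<le> n" for x y
    using mult_le_mono[OF that] word_bounds(5) by linarith
  have main: "tr w (For 8 (Reg 2) ?sq ;; Set_Reg 7 (Mul (Reg 7) (Reg 6)) ;; cap) (set_reg 7 \<sigma> s) (7 * f + 8)
    ?Q"
  proof (rule tr_Seq[where T = "7 * f + 3" and T' = 4], rule tr_For[where N = f and c = 4 and I = "\<lambda>i s1. reg s1 7 = min (\<sigma> ^ (2 ^ i)) n"
        and Q = "\<lambda>s1. reg s1 7 = min (\<sigma> ^ (2 ^ f)) n"])
    show "reg (set_reg 8 0 (set_reg 7 \<sigma> s)) 7 = min (\<sigma> ^ 2 ^ 0) n" using assms by simp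
  next
    fix i s1
    assume i: "reg s1 7 = min (\<sigma> ^ 2 ^ i) n" "reg s1 8 = i"
      and same: "frame_for 8 ?sq (set_reg 7 \<sigma> s) s1"
    show "val w s1 (Reg 2) = f" using sameD(1)[OF same] inputD(4)[OF assms(1)] by simp
    have n: "reg s1 0 = n" using sameD(1)[OF same] inputD(1)[OF assms(1)] by simp
    let ?q = "reg s1 7"
    have "?q * ?q < 2 ^ w" using i by (intro nn) auto
    then have "reg (result w ?sq s1) 7 = min (?q * ?q) n" using n by (simp add: cap_def)
    also have "\<dots> = min (\<sigma> ^ 2 ^ Suc i) n"
      unfolding i(1) min_square_min by (simp add: power_add mult_2)
    finally show "tr w ?sq s1 4 (\<lambda>s'. reg s' 8 = i \<and> reg (set_reg 8 (Suc i) s') 7 = min (\<sigma> ^ 2 ^ Suc i) n)"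
      using i(2) by (intro tr_flat) (auto simp: cap_def)
  next
    fix s1
    assume s1: "reg s1 7 = min (\<sigma> ^ (2 ^ f)) n"
      and same: "frame (For 8 (Reg 2) ?sq) (set_reg 7 \<sigma> s) s1"
    have r: "reg s1 0 = n" "reg s1 6 = \<sigma>" using sameD(1)[OF same] inputD(1)[OF assms(1)] assms(2) by auto
    have "reg s1 7 * \<sigma> < 2 ^ w" using s1 assms by (intro nn) auto
    then have "reg (result w (Set_Reg 7 (Mul (Reg 7) (Reg 6)) ;; cap) s1) 7 = min (reg s1 7 * \<sigma>) n"
      using r by (simp add: cap_def)
    also have "\<dots> = min (\<sigma> ^ (2 ^ f + 1)) n"
      unfolding s1 min_mult_min[OF assms(3)] by (simp add: mult.commute)
    finally show "tr w (Set_Reg 7 (Mul (Reg 7) (Reg 6)) ;; cap) s1 4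
      ?Q"
      by (intro tr_flat) (auto simp: cap_def)
  qed (use word_bounds in auto)
  show ?thesis unfolding power_prog_def
    by (rule tr_Seq[where T = 1 and T' = "7 * f + 8" and Q = "\<lambda>s1. s1 = set_reg 7 \<sigma> s"], rule tr_flat)
      (use assms main in simp_all)
qed

lemma threshold_correct:
  assumes "input s" "n \<ge> 1"
  shows "tr w threshold_prog s (n * (7 * f + 14) + 8)
    (\<lambda>s'. \<exists>\<sigma>\<ge>1. n \<le> \<sigma> ^ (2 ^ f + 1) \<and> (\<sigma> - 1) ^ (2 ^ f + 1) < n \<and> reg s' 9 = (f + 1) * n div \<sigma> + 1)"
proof -
  let ?b = "2 ^ f + 1 :: nat"
  let ?Q = "\<lambda>s'. \<exists>\<sigma>\<ge>1. n \<le> \<sigma> ^ (2 ^ f + 1) \<and> (\<sigma> - 1) ^ (2 ^ f + 1) < n \<and> reg s' 9 = (f + 1) * n div \<sigma> + 1"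
  let ?p9 = "Set_Reg 9 (Add (Div (Mul (Add (Reg 2) (Const 1)) (Reg 0)) (Reg 6)) (Const 1))"
  \<comment> \<open>The search starts with \<open>0\<close> in register 6, where truncated
    subtraction turns the last conjunct into \<open>0 ^ ?b < n\<close>.\<close>
  define I where "I s1 \<longleftrightarrow> input s1 \<and> reg s1 6 \<le> n \<and> reg s1 7 = min (reg s1 6 ^ ?b) n \<and> (reg s1 6 - 1) ^ ?b < n"
    for s1
  let ?p = "incr 6 ;; power_prog"
  have loop: "tr w (While (Less (Reg 7) (Reg 0)) ?p) s1 (n * (7 * f + 14) + 1)
      (\<lambda>s'. I s' \<and> \<not> reg s' 7 < n)" if s1: "s1 = set_reg 7 0 (set_reg 6 0 s)" for s1
  proof (rule tr_While[where I = I and V = "\<lambda>s'. (n - reg s' 6) * (7 * f + 14)"])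
    show "I s1" using assms s1 by (auto simp: I_def input_def power_0_left)
  next
    fix s2 assume I: "I s2" and g: "val w s2 (Less (Reg 7) (Reg 0)) \<noteq> 0"
    define \<sigma> where "\<sigma> = reg s2 6"
    have inp: "input s2" using I by (simp add: I_def)
    have "reg s2 7 < n" using g inputD(1)[OF inp] by auto
    then have lt: "\<sigma> ^ ?b < n" using I unfolding I_def \<sigma>_def by (simp add: min_def split: if_splits)
    \<comment> \<open>Hence \<open>\<sigma> < n\<close> whenever the loop continues, which bounds
      the number of iterations and excludes overflow.\<close>
    have "\<sigma> \<le> \<sigma> ^ ?b" by (cases "\<sigma> = 0") (auto intro: self_le_power)
    then have "\<sigma> < n" using lt by linarith
    then have ov: "Suc \<sigma> < 2 ^ w" using word_bounds(3) by linarith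
    have "tr w ?p s2 (7 * f + 12) (\<lambda>s'. reg s' 6 = Suc \<sigma> \<and> input s' \<and> reg s' 7 = min (Suc \<sigma> ^ ?b) n)"
    proof (rule tr_Seq[where T = 1 and T' = "7 * f + 10" and Q = "\<lambda>s'. s' = set_reg 6 (Suc \<sigma>) s2"])
      show "tr w (incr 6) s2 1 (\<lambda>s'. s' = set_reg 6 (Suc \<sigma>) s2)"
        using ov by (intro tr_flat) (auto simp: \<sigma>_def)
      fix s' assume s': "s' = set_reg 6 (Suc \<sigma>) s2"
      then have inp': "input s'" using inp by (simp add: input_def)
      have "tr w power_prog s' (7 * f + 10) (\<lambda>s'. reg s' 7 = min (Suc \<sigma> ^ ?b) n)"
        using inp' \<open>\<sigma> < n\<close> s' by (intro power_correct) auto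
      then show "tr w power_prog s' (7 * f + 10)
          (\<lambda>s'. reg s' 6 = Suc \<sigma> \<and> input s' \<and> reg s' 7 = min (Suc \<sigma> ^ ?b) n)"
      proof (rule tr_conseq)
        fix t assume "reg t 7 = min (Suc \<sigma> ^ ?b) n" and same: "frame power_prog s' t"
        then show "reg t 6 = Suc \<sigma> \<and> input t \<and> reg t 7 = min (Suc \<sigma> ^ ?b) n"
          using same_input[OF inp' same] sameD(1)[OF same, of 6] s' by auto
      qed simp
    qed simp
    then have "tr w ?p s2 (7 * f + 12) (\<lambda>s'. I s' \<and> (n - reg s' 6) * (7 * f + 14) + (7 * f + 12) + 1 \<le> (n - reg s2 6) * (7 * f + 14))"
    proof (rule tr_conseq)
      fix t assume t: "reg t 6 = Suc \<sigma> \<and> input t \<and> reg t 7 = min (Suc \<sigma> ^ ?b) n"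
      have "n - \<sigma> = Suc (n - Suc \<sigma>)" using \<open>\<sigma> < n\<close> by simp
      then have "(n - Suc \<sigma>) * (7 * f + 14) + (7 * f + 14) = (n - \<sigma>) * (7 * f + 14)" by simp
      then show "I t \<and> (n - reg t 6) * (7 * f + 14) + (7 * f + 12) + 1 \<le> (n - reg s2 6) * (7 * f + 14)"
        using t lt \<open>\<sigma> < n\<close> unfolding I_def \<sigma>_def[symmetric] by (auto simp del: power_Suc)
    qed simp
    then show "\<exists>c. tr w ?p s2 c (\<lambda>s'. I s' \<and> (n - reg s' 6) * (7 * f + 14) + c + 1 \<le> (n - reg s2 6) * (7 * f + 14))"
      by blast
  next
    fix s2 assume "I s2" "val w s2 (Less (Reg 7) (Reg 0)) = 0"
    then show "I s2 \<and> \<not> reg s2 7 < n" using inputD(1)[of s2] by (auto simp: I_def split: if_splits)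
  qed (simp add: s1)
  have final: "tr w ?p9 s2 1
    ?Q"
    if I: "I s2" and g: "\<not> reg s2 7 < n" for s2
  proof (rule tr_flat)
    have inp: "input s2" using I by (simp add: I_def)
    have "reg s2 6 \<noteq> 0" using I g assms(2) by (auto simp: I_def power_0_left intro: ccontr)
    moreover have "n \<le> reg s2 6 ^ ?b" using I g unfolding I_def by (simp add: min_def split: if_splits)
    moreover have "(f + 1) * n div reg s2 6 \<le> (f + 1) * n" by (rule div_le_dividend)
    then have "(f + 1) * n div reg s2 6 + 1 < 2 ^ w" using word_bounds(4) by linarith
    moreover have "(f + 1) * n < 2 ^ w" "f + 1 < 2 ^ w" using word_bounds by linarith+
    ultimately show "\<exists>\<sigma>\<ge>1. n \<le> \<sigma> ^ (2 ^ f + 1) \<and> (\<sigma> - 1) ^ (2 ^ f + 1) < n \<and>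
       reg (result w ?p9 s2) 9 =
         (f + 1) * n div \<sigma> + 1"
      using I inputD[OF inp] unfolding I_def by (intro exI[of _ "reg s2 6"]) (simp del: mult_Suc power_Suc)
  qed simp_all
  show ?thesis unfolding threshold_prog_def
  proof (rule tr_Seq[where T = 1 and T' = "n * (7 * f + 14) + 6" and Q = "\<lambda>s1. s1 = set_reg 6 0 s"])
    fix s1 assume s1: "s1 = set_reg 6 0 s"
    show "tr w (Set_Reg 7 (Const 0) ;; While (Less (Reg 7) (Reg 0)) ?p ;;
       ?p9) s1 (n * (7 * f + 14) + 6)
      ?Q"
      by (rule tr_Seq[where T = 1 and T' = "n * (7 * f + 14) + 4" and Q = "\<lambda>s2. s2 = set_reg 7 0 s1"],
          rule tr_flat, simp, simp, simp, rule tr_Seq[OF loop final], use s1 in auto)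
  qed (auto intro: tr_flat)
qed

text \<open>The register runs through absolute positions in array 3, while the invariant counts
  positions in \<open>nbrs u es\<close>; the shift by \<open>offset u\<close> is settled here once
  and for all.\<close>

lemma tr_ForNbr:
  assumes adj: "adj s" and y: "reg s y = u" "u < n" "y \<noteq> x" "y \<notin> wregs p"
    and w: "insert x (wregs p) \<inter> {0, 1, 2} = {}" "warrs p \<inter> {0, 1, 2, 3} = {}"
    and init: "I 0 (set_reg x (offset u) s)"
    and body: "\<And>i s1. i < deg u \<Longrightarrow> I i s1 \<Longrightarrow> reg s1 x = offset u + i \<Longrightarrow>
       frame_for x p s s1 \<Longrightarrow> adj s1 \<Longrightarrow> reg s1 y = u \<Longrightarrow>
       arr s1 3 (offset u + i) = nbrs u es ! i \<Longrightarrow>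
       tr w p s1 c (\<lambda>s'. reg s' x = offset u + i \<and> I (Suc i) (set_reg x (offset u + Suc i) s'))"
    and final: "\<And>s1. I (deg u) s1 \<Longrightarrow> frame_for x p s s1 \<Longrightarrow> adj s1 \<Longrightarrow> Q s1"
    and T: "deg u * (c + 3) + 3 \<le> T"
  shows "tr w (ForNbr x y p) s T Q"
  unfolding ForNbr_def
proof (rule tr_ForR[where a = "offset u" and N = "offset (Suc u)" and I = "\<lambda>i. I (i - offset u)" and c = c])
  show "offset (Suc u) < 2 ^ w" using offset_le[of "Suc u"] y(2) word_bounds(2) by linarith
  show "val w s (Cell 2 (Reg y)) = offset u" using adjD(2)[OF adj] y by simp
  show "offset u \<le> offset (Suc u)" by (rule offset_mono) simp
  show "I (offset u - offset u) (set_reg x (offset u) s)" using init by simp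
  have adj': "adj s1" if "frame_for x p s s1" for s1
    using same_adj[OF adj that] w by simp
  have y': "reg s1 y = u" if "frame_for x p s s1" for s1
    using sameD(1)[OF that, of y] y by simp
  show "val w s1 (Cell 2 (Add (Reg y) (Const 1))) = offset (Suc u)"
    if "frame_for x p s s1" for s1
  proof -
    have "Suc u < 2 ^ w" using y(2) word_bounds(3) by linarith
    then show ?thesis using adjD(2)[OF adj'[OF that]] y'[OF that] y(2) by simp
  qed
  show "tr w p s1 c (\<lambda>s'. reg s' x = i \<and> I (Suc i - offset u) (set_reg x (Suc i) s'))"
    if "offset u \<le> i" "i < offset (Suc u)" "I (i - offset u) s1" "reg s1 x = i"
      "frame_for x p s s1" for i s1
  proof -
    define k where "k = i - offset u"
    then have "i = offset u + k" "k < deg u" using that by (auto simp: offset_Suc)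
    then show ?thesis using body[of k s1] that adj'[OF that(5)] y'[OF that(5)] adjD(3)[OF adj'[OF that(5)] y(2)]
      by (simp add: Suc_diff_le)
  qed
  show "Q s1" if "I (offset (Suc u) - offset u) s1" "frame_for x p s s1" for s1
    using that final adj' by (simp add: offset_Suc)
  show "(offset (Suc u) - offset u) * (c + 3) + 3 \<le> T" using T by (simp add: offset_Suc)
qed

section \<open>Greedy choice of the centers\<close>

definition cnt :: "nat set \<Rightarrow> nat \<Rightarrow> nat" where
  "cnt C a = card {c \<in> C. {c, a} \<in> E}"

text \<open>A new center increases \<open>min (cnt C a) (f + 1)\<close> for at least \<open>\<Delta>\<close> vertices \<open>a\<close>, which bounds the
  number of centers.\<close>

definition partial_centers :: "nat \<Rightarrow> nat \<Rightarrow> nat set \<Rightarrow> bool" where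
  "partial_centers \<Delta> c C \<longleftrightarrow> C \<subseteq> {..<c} \<and> card C * \<Delta> \<le> (\<Sum>a<n. min (cnt C a) (f + 1)) \<and>
     (\<forall>c'<c. c' \<notin> C \<longrightarrow> card {a. {c', a} \<in> E \<and> cnt C a \<le> f} < \<Delta>)"

lemma finite_nbrs: "finite {a. {c, a} \<in> E \<and> P a}"
  using edgeD by (intro finite_subset[OF _ finite_lessThan[of n]]) auto

lemma cnt_mono: "finite C' \<Longrightarrow> C \<subseteq> C' \<Longrightarrow> cnt C a \<le> cnt C' a"
  unfolding cnt_def by (intro card_mono) auto

lemma partial_centers_skip:
  assumes "partial_centers \<Delta> c C" "card {a. {c, a} \<in> E \<and> cnt C a \<le> f} < \<Delta>"
  shows "partial_centers \<Delta> (Suc c) C"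
  using assms unfolding partial_centers_def less_Suc_eq by auto

lemma cnt_insert:
  assumes "C \<subseteq> {..<c}"
  shows "cnt (insert c C) a = cnt C a + of_bool ({c, a} \<in> E)"
proof (cases "{c, a} \<in> E")
  case True
  then have "{c' \<in> insert c C. {c', a} \<in> E} = insert c {c' \<in> C. {c', a} \<in> E}" by auto
  moreover have "c \<notin> {c' \<in> C. {c', a} \<in> E}" using assms by auto
  moreover have "finite {c' \<in> C. {c', a} \<in> E}" using assms by (auto intro: finite_subset[of _ "{..<c}"])
  ultimately show ?thesis using True unfolding cnt_def by simp
next
  case False
  then have "{c' \<in> insert c C. {c', a} \<in> E} = {c' \<in> C. {c', a} \<in> E}" by auto
  then show ?thesis using False unfolding cnt_def by simp
qed

lemma partial_centers_insert:
  assumes C: "partial_centers \<Delta> c C" and \<Delta>: "card {a. {c, a} \<in> E \<and> cnt C a \<le> f} \<ge> \<Delta>"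
  shows "partial_centers \<Delta> (Suc c) (insert c C)"
proof -
  have sub: "C \<subseteq> {..<c}" using C unfolding partial_centers_def by blast
  then have fin: "finite C" "c \<notin> C" by (auto intro: finite_subset)
  let ?N = "{a. {c, a} \<in> E \<and> cnt C a \<le> f}"
  have "card (insert c C) * \<Delta> = card C * \<Delta> + \<Delta>" using fin by simp
  also have "\<dots> \<le> (\<Sum>a<n. min (cnt C a) (f + 1)) + card ?N"
    using C \<Delta> unfolding partial_centers_def by linarith
  also have "card ?N = (\<Sum>a<n. of_bool (a \<in> ?N))"
  proof -
    have "?N \<subseteq> {..<n}" using edgeD by auto
    then show ?thesis by (simp add: sum.inter_restrict[symmetric] of_bool_def sum.If_cases Int_absorb1)
  qed
  \<comment> \<open>At each vertex of \<open>?N\<close> the count is still below the cap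
    \<open>f + 1\<close>, so the new center raises the capped count by one.\<close>
  also have "(\<Sum>a<n. min (cnt C a) (f + 1)) + (\<Sum>a<n. of_bool (a \<in> ?N)) \<le>
      (\<Sum>a<n. min (cnt (insert c C) a) (f + 1))"
    unfolding sum.distrib[symmetric] by (intro sum_mono) (auto simp: cnt_insert[OF sub])
  finally have 1: "card (insert c C) * \<Delta> \<le> (\<Sum>a<n. min (cnt (insert c C) a) (f + 1))" .
  have 2: "card {a. {c', a} \<in> E \<and> cnt (insert c C) a \<le> f} < \<Delta>" if "c' < c" "c' \<notin> C" for c'
  proof -
    \<comment> \<open>Vertices rejected earlier stay rejected: counts only grow, so their
      unsaturated neighbors can only become fewer.\<close>
    have "card {a. {c', a} \<in> E \<and> cnt (insert c C) a \<le> f} \<le> card {a. {c', a} \<in> E \<and> cnt C a \<le> f}"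
      using cnt_mono[of "insert c C" C] fin(1) by (intro card_mono finite_nbrs) (auto intro: order_trans)
    also have "\<dots> < \<Delta>" using C that unfolding partial_centers_def by blast
    finally show ?thesis .
  qed
  show ?thesis unfolding partial_centers_def using 1 2 sub by (auto simp: less_Suc_eq)
qed

lemma partial_centers_final:
  assumes "partial_centers \<Delta> n C"
  shows "center_set n f \<Delta> E C"
proof -
  have "(\<Sum>a<n. min (cnt C a) (f + 1)) \<le> (\<Sum>a<n. f + 1)" by (intro sum_mono) simp
  then show ?thesis using assms unfolding partial_centers_def center_set_def cnt_def by auto
qed

definition centers_stored :: "nat set \<Rightarrow> state \<Rightarrow> bool" where
  "centers_stored C s \<longleftrightarrow> (\<forall>u<n. arr s 5 u = of_bool (u \<in> C)) \<and> (\<forall>u<n. arr s 4 u = cnt C u)"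

lemma cnt_le:
  assumes "C \<subseteq> {..<n}" shows "cnt C a \<le> n"
proof -
  have "cnt C a \<le> card {..<n}" unfolding cnt_def using assms by (intro card_mono) auto
  then show ?thesis by simp
qed

lemma deg_le: "deg u \<le> n"
proof -
  have "card {x. {u, x} \<in> E} \<le> card {..<n}" using edgeD by (intro card_mono) auto
  then show ?thesis by (simp add: deg_card)
qed

lemma center_step_correct:
  assumes adj: "adj s" and c: "reg s 10 = c" "c < n" and \<Delta>: "reg s 9 = \<Delta>"
    and C: "centers_stored C s" "partial_centers \<Delta> c C"
  shows "tr w center_step s (9 * n + 13)
    (\<lambda>s'. \<exists>C'. centers_stored C' s' \<and> partial_centers \<Delta> (Suc c) C')"
    (is "tr w _ s _ ?Q")
proof -
  have Cc: "C \<subseteq> {..<c}" using C(2) unfolding partial_centers_def by blast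
  then have Cn: "C \<subseteq> {..<n}" using c(2) by auto
  let ?d = "card {a. {c, a} \<in> E \<and> cnt C a \<le> f}"
  let ?P = "\<lambda>a. cnt C a \<le> f"
  have lt: "nbrs c es ! i < n" "{c, nbrs c es ! i} \<in> E" if "i < deg c" for i
    using set_nbrs[of c] nth_mem[of i "nbrs c es"] that edgeD unfolding deg_def by auto
  have count: "tr w (ForNbr 4 10 count_step) (set_reg 11 0 s) (5 * n + 3)
     (\<lambda>s1. adj s1 \<and> reg s1 11 = ?d)"
  proof (rule tr_ForNbr[where u = c and c = 2 and I = "\<lambda>i s1. reg s1 11 = length (filter ?P (take i (nbrs c es)))"])
    show "adj (set_reg 11 0 s)" using same_adj[OF adj, of "{11}" "{}"] by (simp add: same_def)
  next
    fix i s1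
    assume i: "i < deg c" "reg s1 11 = length (filter ?P (take i (nbrs c es)))" "reg s1 4 = offset c + i"
      "frame_for 4 count_step (set_reg 11 0 s) s1" "adj s1"
      "arr s1 3 (offset c + i) = nbrs c es ! i"
    have "length (filter ?P (take i (nbrs c es))) \<le> i" by (rule order_trans[OF length_filter_le]) simp
    then have ov: "Suc (reg s1 11) < 2 ^ w" using i(1,2) deg_le[of c] word_bounds(3) by linarith
    have "arr s1 4 = arr s 4" using sameD(2)[OF i(4), of 4] by simp
    then have cn: "arr s1 4 (nbrs c es ! i) = cnt C (nbrs c es ! i)"
      using C(1) lt[OF i(1)] unfolding centers_stored_def by simp
    have f: "reg s1 2 = f" using inputD(4)[OF adjD(1)[OF i(5)]] .
    have t: "take (Suc i) (nbrs c es) = take i (nbrs c es) @ [nbrs c es ! i]"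
      using i(1) by (simp add: deg_def take_Suc_conv_app_nth)
    show "tr w count_step s1 2 (\<lambda>s'. reg s' 4 = offset c + i \<and>
       reg (set_reg 4 (offset c + Suc i) s') 11 = length (filter ?P (take (Suc i) (nbrs c es))))"
      unfolding count_step_def t by (rule tr_flat) (use ov i cn f in auto)
  next
    fix s1 assume "reg s1 11 = length (filter ?P (take (deg c) (nbrs c es)))" "adj s1"
    moreover have "length (filter ?P (nbrs c es)) = ?d"
      using distinct_length_filter[OF distinct_nbrs, of ?P c] by (simp add: set_nbrs Collect_conj_eq Int_commute)
    ultimately show "adj s1 \<and> reg s1 11 = ?d"
      by (simp add: deg_def)
  next
    show "deg c * (2 + 3) + 3 \<le> 5 * n + 3" using deg_le[of c] by simp
  qed (use c in auto)
  have mark: "tr w (ForNbr 4 10 mark_step) s2 (4 * n + 3)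
      (\<lambda>s'. \<forall>a<n. arr s' 4 a = arr s2 4 a + of_bool ({c, a} \<in> E))"
    if s2: "adj s2" "reg s2 10 = c" "\<forall>a<n. arr s2 4 a = cnt C a" for s2
  proof (rule tr_ForNbr[where u = c and c = 1 and
        I = "\<lambda>i s1. \<forall>a<n. arr s1 4 a = arr s2 4 a + of_bool (a \<in> set (take i (nbrs c es)))"])
    fix i and s1 :: state
    assume i: "i < deg c" "\<forall>a<n. arr s1 4 a = arr s2 4 a + of_bool (a \<in> set (take i (nbrs c es)))"
      "reg s1 4 = offset c + i" "arr s1 3 (offset c + i) = nbrs c es ! i"
    have t: "take (Suc i) (nbrs c es) = take i (nbrs c es) @ [nbrs c es ! i]"
      using i(1) by (simp add: deg_def take_Suc_conv_app_nth)
    have "distinct (take (Suc i) (nbrs c es))" using distinct_nbrs by simp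
    then have "nbrs c es ! i \<notin> set (take i (nbrs c es))" unfolding t by simp
    moreover have "cnt C (nbrs c es ! i) + 1 < 2 ^ w" using cnt_le[OF Cn, of "nbrs c es ! i"] word_bounds(3) by linarith
    ultimately show "tr w mark_step s1 1 (\<lambda>s'. reg s' 4 = offset c + i \<and>
       (\<forall>a<n. arr (set_reg 4 (offset c + Suc i) s') 4 a = arr s2 4 a + of_bool (a \<in> set (take (Suc i) (nbrs c es)))))"
      unfolding mark_step_def t by (intro tr_flat) (use i s2(3) lt[OF i(1)] in auto)
  next
    fix s1 :: state assume "\<forall>a<n. arr s1 4 a = arr s2 4 a + of_bool (a \<in> set (take (deg c) (nbrs c es)))"
    then show "\<forall>a<n. arr s1 4 a = arr s2 4 a + of_bool ({c, a} \<in> E)" by (simp add: deg_def set_nbrs)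
  next
    show "deg c * (1 + 3) + 3 \<le> 4 * n + 3" using deg_le[of c] by simp
  qed (use c s2 in auto)
  show ?thesis unfolding center_step_def
  proof (rule tr_Seq[where T = 1 and T' = "9 * n + 11" and Q = "\<lambda>s1. s1 = set_reg 11 0 s"], rule tr_flat)
    fix s1 assume s1: "s1 = set_reg 11 0 s"
    show "tr w (ForNbr 4 10 count_step ;; If (Less (Reg 11) (Reg 9)) skip
        (Set_Cell 5 (Reg 10) (Const 1) ;; ForNbr 4 10 mark_step)) s1 (9 * n + 11)
        ?Q"
      unfolding s1
    proof (rule tr_Seq[OF count, where T' = "4 * n + 7"])
      fix s2 assume 2: "adj s2 \<and> reg s2 11 = ?d"
        and same: "frame (ForNbr 4 10 count_step) (set_reg 11 0 s) s2"
      have r: "reg s2 9 = \<Delta>" "reg s2 10 = c" "arr s2 5 = arr s 5" "arr s2 4 = arr s 4"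
        using sameD[OF same] c \<Delta> by auto
      show "tr w (If (Less (Reg 11) (Reg 9)) skip (Set_Cell 5 (Reg 10) (Const 1) ;; ForNbr 4 10 mark_step)) s2
        (4 * n + 7) ?Q"
      proof (rule tr_If[where T = "4 * n + 6"])
        assume "val w s2 (Less (Reg 11) (Reg 9)) \<noteq> 0"
        then have "?d < \<Delta>" using r 2 by (auto split: if_splits)
        from partial_centers_skip[OF C(2) this]
        show "tr w skip s2 (4 * n + 6) ?Q"
          using C(1) r by (intro tr_flat) (auto simp: centers_stored_def)
      next
        assume "val w s2 (Less (Reg 11) (Reg 9)) = 0"
        then have "?d \<ge> \<Delta>" using r 2 by (auto split: if_splits)
        from partial_centers_insert[OF C(2) this]
        have p: "partial_centers \<Delta> (Suc c) (insert c C)" .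
        let ?s = "set_cell 5 c 1 s2"
        have a: "adj ?s" using 2 same_adj[of s2 "{}" "{5}" ?s] by (simp add: same_def)
        show "tr w (Set_Cell 5 (Reg 10) (Const 1) ;; ForNbr 4 10 mark_step) s2 (4 * n + 6)
          ?Q"
        proof (rule tr_Seq[where T = 1 and Q = "\<lambda>s'. s' = ?s" and T' = "4 * n + 3"], rule tr_flat)
          fix s3 assume s3: "s3 = ?s"
          have "tr w (ForNbr 4 10 mark_step) s3 (4 * n + 3)
            (\<lambda>s'. \<forall>a<n. arr s' 4 a = arr s3 4 a + of_bool ({c, a} \<in> E))"
            using a r C(1) unfolding s3 by (intro mark) (auto simp: centers_stored_def)
          then show "tr w (ForNbr 4 10 mark_step) s3 (4 * n + 3)
             ?Q"
          proof (rule tr_conseq)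
            fix s4 assume 4: "\<forall>a<n. arr s4 4 a = arr s3 4 a + of_bool ({c, a} \<in> E)"
              and same4: "frame (ForNbr 4 10 mark_step) s3 s4"
            have "arr s4 5 = (arr s 5)(c := 1)" using sameD(2)[OF same4, of 5] r by (simp add: s3)
            then have "centers_stored (insert c C) s4"
              using 4 C(1) r unfolding centers_stored_def cnt_insert[OF Cc] by (auto simp: s3)
            then show "\<exists>C'. centers_stored C' s4 \<and> partial_centers \<Delta> (Suc c) C'" using p by blast
          qed simp
        qed (use r in auto)
      qed simp
    qed simp
  qed simp_all
qed

lemma centers_correct:
  assumes adj: "adj s" and \<Delta>: "reg s 9 = \<Delta>" and zero: "\<forall>u<n. arr s 4 u = 0" "\<forall>u<n. arr s 5 u = 0"
  shows "tr w centers_prog s (n * (9 * n + 16) + 3) (\<lambda>s'. \<exists>C. centers_stored C s' \<and> center_set n f \<Delta> E C)"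
  unfolding centers_prog_def
proof (rule tr_For[where N = n and c = "9 * n + 13" and
      I = "\<lambda>c s1. \<exists>C. centers_stored C s1 \<and> partial_centers \<Delta> c C"])
  show "\<exists>C. centers_stored C (set_reg 10 0 s) \<and> partial_centers \<Delta> 0 C"
    using zero by (intro exI[of _ "{}"]) (auto simp: centers_stored_def partial_centers_def cnt_def)
next
  fix i s1 assume same: "frame_for 10 center_step s s1"
  have adj1: "adj s1" using same_adj[OF adj same] by simp
  then show "val w s1 (Reg 0) = n" by (simp add: inputD[OF adjD(1)])
  assume i: "i < n" "\<exists>C. centers_stored C s1 \<and> partial_centers \<Delta> i C" "reg s1 10 = i"
  then obtain C where C: "centers_stored C s1" "partial_centers \<Delta> i C" by blast
  have "reg s1 9 = \<Delta>" using sameD(1)[OF same, of 9] \<Delta> by simp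
  from center_step_correct[OF adj1 i(3,1) this C]
  show "tr w center_step s1 (9 * n + 13) (\<lambda>s'. reg s' 10 = i \<and>
    (\<exists>C. centers_stored C (set_reg 10 (Suc i) s') \<and> partial_centers \<Delta> (Suc i) C))"
  proof (rule tr_conseq)
    fix s' assume "\<exists>C'. centers_stored C' s' \<and> partial_centers \<Delta> (Suc i) C'"
      and "frame center_step s1 s'"
    then show "reg s' 10 = i \<and> (\<exists>C. centers_stored C (set_reg 10 (Suc i) s') \<and> partial_centers \<Delta> (Suc i) C)"
      using i(3) by (auto simp: centers_stored_def same_def)
  qed simp
next
  fix s1 assume "\<exists>C. centers_stored C s1 \<and> partial_centers \<Delta> n C"
  then show "\<exists>C. centers_stored C s1 \<and> center_set n f \<Delta> E C" using partial_centers_final by blast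
qed (use word_bounds in auto)

definition kept :: "nat set set \<Rightarrow> state \<Rightarrow> bool" where
  "kept H s \<longleftrightarrow> (\<forall>j<m. arr s 6 j \<noteq> 0 \<longleftrightarrow> edge j \<in> H)"

lemma sparse_correct:
  assumes adj: "adj s" and C: "centers_stored C s"
  shows "tr w sparse_prog s (4 * m + 3) (kept (sparse_edges f E C))"
  unfolding sparse_prog_def
proof (rule tr_For[where N = m and c = 1 and
      I = "\<lambda>j s1. \<forall>i<j. arr s1 6 i \<noteq> 0 \<longleftrightarrow> edge i \<in> sparse_edges f E C"])
  fix j s1 assume same: "frame_for 4 sparse_step s s1"
  have inp: "input s1" using same_input[OF adjD(1)[OF adj] same] by simp
  then show "val w s1 (Reg 1) = m" by (simp add: inputD)
  assume j: "j < m" "\<forall>i<j. arr s1 6 i \<noteq> 0 \<longleftrightarrow> edge i \<in> sparse_edges f E C" "reg s1 4 = j"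
  have "arr s1 4 = arr s 4" using sameD(2)[OF same, of 4] by simp
  then have "arr s1 4 (fst (es ! j)) = cnt C (fst (es ! j))" "arr s1 4 (snd (es ! j)) = cnt C (snd (es ! j))"
    using C edge_endpoints[OF j(1)] unfolding centers_stored_def by auto
  moreover have "edge j \<in> sparse_edges f E C \<longleftrightarrow> cnt C (fst (es ! j)) \<le> f \<or> cnt C (snd (es ! j)) \<le> f"
    using edge_in[OF j(1)] unfolding sparse_edges_def edge_def cnt_def by auto
  moreover have "f + 1 < 2 ^ w" using word_bounds(3) by linarith
  ultimately show "tr w sparse_step s1 1 (\<lambda>s'. reg s' 4 = j \<and>
      (\<forall>i<Suc j. arr (set_reg 4 (Suc j) s') 6 i \<noteq> 0 \<longleftrightarrow> edge i \<in> sparse_edges f E C))"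
    unfolding sparse_step_def using j inputD[OF inp] by (intro tr_flat) (auto simp: less_Suc_eq)
qed (use word_bounds in \<open>auto simp: kept_def\<close>)

end

section \<open>One round\<close>

definition clear_step :: prog where
  "clear_step = Set_Cell 8 (Reg 3) (Const 0) ;; Set_Cell 11 (Reg 3) (Const 0) ;;
     Set_Cell 12 (Reg 3) (Cell 7 (Reg 3))"

text \<open>Labels are at most \<open>n\<close>, but the radius search may look up the label
  \<open>n + 1\<close>; hence \<open>n + 2\<close> layer counters. The marks start as a copy of
  \<open>S\<close>.\<close>

definition clear_prog :: prog where
  "clear_prog = For 3 (Add (Reg 0) (Const 2)) clear_step"

text \<open>The guard is a conjunction written as a product: the target has no label yet, and the
  edge does not lead from \<open>v\<close> into \<open>S\<close>.\<close>

definition visit_step :: prog where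
  "visit_step = Set_Reg 16 (Cell 3 (Reg 4)) ;;
     If (Mul (Eq (Cell 8 (Reg 16)) (Const 0)) (Sub (Const 1) (Mul (Eq (Reg 3) (Reg 12)) (Cell 7 (Reg 16)))))
       (Set_Cell 8 (Reg 16) (Add (Cell 8 (Reg 3)) (Const 1)) ;;
        Set_Cell 10 (Reg 16) (Reg 3) ;; Set_Cell 9 (Reg 15) (Reg 16) ;; incr 15)
       skip"

definition expand_step :: prog where
  "expand_step = Set_Reg 3 (Cell 9 (Reg 14)) ;;
     If (Cell 7 (Reg 3)) skip (ForNbr 4 3 visit_step) ;; incr 14"

definition bfs_init :: prog where
  "bfs_init = Set_Cell 8 (Reg 12) (Const 1) ;; Set_Cell 9 (Const 0) (Reg 12) ;;
     Set_Reg 14 (Const 0) ;; Set_Reg 15 (Const 1)"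

definition bfs_prog :: prog where
  "bfs_prog = bfs_init ;; While (Less (Reg 14) (Reg 15)) expand_step"

definition layer_step :: prog where
  "layer_step = Set_Reg 17 (Add (Reg 17) (Cell 7 (Reg 3))) ;;
     Set_Cell 11 (Cell 8 (Reg 3)) (Add (Cell 11 (Cell 8 (Reg 3))) (Const 1))"

definition layers_prog :: prog where
  "layers_prog = Set_Reg 17 (Const 0) ;; For 3 (Reg 0) layer_step"

definition radius_prog :: prog where
  "radius_prog = Set_Reg 18 (Const 2) ;;
     If (Less (Reg 13) (Reg 2))
       (While (Less (Mul (Reg 17) (Sub (Reg 18) (Const 1))) (Cell 11 (Reg 18))) (incr 18))
       skip"

text \<open>Parents precede their children in the queue, so a single backward pass closes the marks
  under parents. It ends at position \<open>1\<close>, because position \<open>0\<close> holds the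
  root.\<close>

definition ancestor_step :: prog where
  "ancestor_step = Set_Reg 3 (Cell 9 (Sub (Sub (Reg 15) (Const 1)) (Reg 19))) ;;
     If (Cell 12 (Reg 3)) (Set_Cell 12 (Cell 10 (Reg 3)) (Const 1)) skip"

definition ancestors_prog :: prog where
  "ancestors_prog = For 19 (Sub (Reg 15) (Const 1)) ancestor_step"

text \<open>Label \<open>0\<close> also passes the first test. This is harmless, since a marked
  vertex that was not reached already belongs to \<open>S\<close>. The root may have been marked and
  is removed from \<open>S\<close> afterwards.\<close>

definition update_step :: prog where
  "update_step =
     If (Add (Mul (Cell 12 (Reg 3)) (Less (Cell 8 (Reg 3)) (Add (Reg 18) (Const 1))))
          (Mul (Less (Reg 13) (Reg 2)) (Eq (Cell 8 (Reg 3)) (Reg 18))))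
       (Set_Cell 7 (Reg 3) (Const 1)) skip"

definition update_prog :: prog where
  "update_prog = For 3 (Reg 0) update_step ;; Set_Cell 7 (Reg 12) (Const 0)"

definition round_prog :: prog where
  "round_prog = clear_prog ;; bfs_prog ;; layers_prog ;; radius_prog ;; ancestors_prog ;; update_prog"

lemma written_round [simp]:
  "wregs clear_step = {}" "warrs clear_step = {8, 11, 12}"
  "wregs clear_prog = {3}" "warrs clear_prog = {8, 11, 12}"
  "wregs visit_step = {15, 16, 20}" "warrs visit_step = {8, 9, 10}"
  "wregs expand_step = {3, 4, 14, 15, 16, 20}" "warrs expand_step = {8, 9, 10}"
  "wregs bfs_init = {14, 15}" "warrs bfs_init = {8, 9}"
  "wregs bfs_prog = {3, 4, 14, 15, 16, 20}" "warrs bfs_prog = {8, 9, 10}"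
  "wregs layer_step = {17}" "warrs layer_step = {11}"
  "wregs layers_prog = {3, 17}" "warrs layers_prog = {11}"
  "wregs radius_prog = {18, 20}" "warrs radius_prog = {}"
  "wregs ancestor_step = {3, 20}" "warrs ancestor_step = {12}"
  "wregs ancestors_prog = {3, 19, 20}" "warrs ancestors_prog = {12}"
  "wregs update_step = {20}" "warrs update_step = {7}"
  "wregs update_prog = {3, 20}" "warrs update_prog = {7}"
  "wregs round_prog = {3, 4, 14, 15, 16, 17, 18, 19, 20}" "warrs round_prog = {7, 8, 9, 10, 11, 12}"
  by (auto simp: clear_step_def clear_prog_def visit_step_def expand_step_def bfs_init_def bfs_prog_def
    layer_step_def layers_prog_def radius_prog_def ancestor_step_def ancestors_prog_def
    update_step_def update_prog_def round_prog_def)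

text \<open>The queue \<open>q\<close> contains \<open>t\<close> vertices, of which the first \<open>h\<close> have been expanded.\<close>

definition bfs_inv ::
    "nat set set \<Rightarrow> nat set \<Rightarrow> nat \<Rightarrow> nat \<Rightarrow> nat \<Rightarrow> (nat \<Rightarrow> nat) \<Rightarrow> (nat \<Rightarrow> nat) \<Rightarrow> (nat \<Rightarrow> nat) \<Rightarrow> bool" where
  "bfs_inv E S v h t D par q \<longleftrightarrow>
     1 \<le> t \<and> h \<le> t \<and> q 0 = v \<and> D v = 1 \<and> inj_on q {..<t} \<and>
     (\<forall>u. D u \<noteq> 0 \<longleftrightarrow> u \<in> q ` {..<t}) \<and>
     (\<forall>i<t. D (q i) \<le> i + 1) \<and>
     (\<forall>i j. i \<le> j \<longrightarrow> j < t \<longrightarrow> D (q i) \<le> D (q j)) \<and>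
     (\<forall>i j. i < t \<longrightarrow> h \<le> j \<longrightarrow> j < t \<longrightarrow> D (q i) \<le> D (q j) + 1) \<and>
     (\<forall>i<t. i \<noteq> 0 \<longrightarrow> par (q i) \<in> q ` {..<i} \<and> D (q i) = D (par (q i)) + 1 \<and>
        {par (q i), q i} \<in> E \<and> par (q i) \<notin> S \<and> \<not> (par (q i) = v \<and> q i \<in> S)) \<and>
     (\<forall>i<h. q i \<notin> S \<longrightarrow> (\<forall>x. {q i, x} \<in> E \<longrightarrow> \<not> (q i = v \<and> x \<in> S) \<longrightarrow> D x \<noteq> 0 \<and> D x \<le> D (q i) + 1))"

lemma bfs_invD:
  assumes "bfs_inv E S v h t D par q"
  shows "1 \<le> t" "h \<le> t" "q 0 = v" "D v = 1" "inj_on q {..<t}"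
    "D u \<noteq> 0 \<longleftrightarrow> u \<in> q ` {..<t}"
    "i < t \<Longrightarrow> D (q i) \<le> i + 1"
    "i \<le> j \<Longrightarrow> j < t \<Longrightarrow> D (q i) \<le> D (q j)"
    "i < t \<Longrightarrow> h \<le> j \<Longrightarrow> j < t \<Longrightarrow> D (q i) \<le> D (q j) + 1"
    "i < t \<Longrightarrow> i \<noteq> 0 \<Longrightarrow> par (q i) \<in> q ` {..<i}"
    "i < t \<Longrightarrow> i \<noteq> 0 \<Longrightarrow> D (q i) = D (par (q i)) + 1"
    "i < t \<Longrightarrow> i \<noteq> 0 \<Longrightarrow> {par (q i), q i} \<in> E"
    "i < t \<Longrightarrow> i \<noteq> 0 \<Longrightarrow> par (q i) \<notin> S"
    "i < t \<Longrightarrow> i \<noteq> 0 \<Longrightarrow> par (q i) = v \<Longrightarrow> q i \<notin> S"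
    "i < h \<Longrightarrow> q i \<notin> S \<Longrightarrow> {q i, x} \<in> E \<Longrightarrow> \<not> (q i = v \<and> x \<in> S) \<Longrightarrow> D x \<noteq> 0 \<and> D x \<le> D (q i) + 1"
  using assms unfolding bfs_inv_def by (simp_all, blast)

text \<open>Labels in the queue are sorted and none exceeds the label of the head by more than one,
  so a vertex with label \<open>D (q h) + 1\<close> can be appended without breaking either
  property. From \<open>h < t\<close> it follows that a label exceeds its queue position by at most
  one, which later bounds labels by \<open>n\<close>.\<close>

lemma bfs_inv_visit:
  assumes inv: "bfs_inv E S v h t D par q" and h: "h < t" "q h \<notin> S"
    and x: "{q h, x} \<in> E" "D x = 0" "\<not> (q h = v \<and> x \<in> S)"
  shows "bfs_inv E S v h (Suc t) (D(x := D (q h) + 1)) (par(x := q h)) (q(t := x))"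
proof -
  note I = bfs_invD[OF inv]
  let ?D = "D(x := D (q h) + 1)" and ?q = "q(t := x)" and ?par = "par(x := q h)"
  have ne: "q i \<noteq> x" if "i < t" for i using I(6)[of x] x(2) that by blast
  have D: "?D (?q i) = (if i = t then D (q h) + 1 else D (q i))" if "i < Suc t" for i
    using ne[of i] that by auto
  have im: "?q ` {..<Suc t} = insert x (q ` {..<t})" by (auto simp: less_Suc_eq image_iff)
  show ?thesis
    unfolding bfs_inv_def
  proof (intro conjI allI impI)
    show "?q 0 = v" using I(1,3) by auto
    show "?D v = 1" using I(4) x(2) by auto
    show "inj_on ?q {..<Suc t}"
      using I(5) unfolding inj_on_def by (auto simp: less_Suc_eq dest: ne)
    show "?D u \<noteq> 0 \<longleftrightarrow> u \<in> ?q ` {..<Suc t}" for u unfolding im using I(6)[of u] by auto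
    show "?D (?q i) \<le> i + 1" if "i < Suc t" for i
      unfolding D[OF that] using I(7)[of i] I(7)[of h] that h(1) by auto
    show "?D (?q i) \<le> ?D (?q j)" if "i \<le> j" "j < Suc t" for i j
      using that D[of i] D[of j] I(8)[of i j] I(9)[of i h] h(1) by (auto split: if_splits)
    show "?D (?q i) \<le> ?D (?q j) + 1" if "i < Suc t" "h \<le> j" "j < Suc t" for i j
      using that D[of i] D[of j] I(9)[of i j] I(9)[of i h] I(8)[of h j] h(1) by (auto split: if_splits)
  next
    fix i assume i: "i < Suc t" "i \<noteq> 0"
    have "?par (?q i) \<in> ?q ` {..<i} \<and> ?D (?q i) = ?D (?par (?q i)) + 1 \<and> {?par (?q i), ?q i} \<in> E \<and>
      ?par (?q i) \<notin> S \<and> \<not> (?par (?q i) = v \<and> ?q i \<in> S)"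
    proof (cases "i = t")
      case True
      then show ?thesis using h x ne[OF h(1)] by (auto intro!: image_eqI[of _ _ h])
    next
      case False
      then have it: "i < t" using i by simp
      obtain k where k: "k < i" "par (q i) = q k" using I(10)[OF it i(2)] by auto
      have "q k \<noteq> x" using ne k it by simp
      moreover have "q k \<in> ?q ` {..<i}" using k it by (intro image_eqI[of _ _ k]) auto
      ultimately show ?thesis
        using ne[OF it] it k I(11-14)[OF it i(2)] by auto
    qed
    then show "?par (?q i) \<in> ?q ` {..<i}" "?D (?q i) = ?D (?par (?q i)) + 1" "{?par (?q i), ?q i} \<in> E"
      "?par (?q i) \<notin> S" "\<not> (?par (?q i) = v \<and> ?q i \<in> S)" by blast+
  next
    fix i y assume i: "i < h" "?q i \<notin> S" "{?q i, y} \<in> E" "\<not> (?q i = v \<and> y \<in> S)"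
    then have "?q i = q i" using h(1) by simp
    then have "D y \<noteq> 0 \<and> D y \<le> D (q i) + 1" using I(15)[of i y] i by simp
    then show "?D y \<noteq> 0" "?D y \<le> ?D (?q i) + 1" using x(2) ne[of i] i(1) h(1) \<open>?q i = q i\<close> by auto
  qed (use I(1,2) h in auto)
qed

lemma bfs_inv_expanded:
  assumes inv: "bfs_inv E S v h t D par q" and h: "h < t"
    and "q h \<notin> S \<Longrightarrow> \<forall>x. {q h, x} \<in> E \<longrightarrow> \<not> (q h = v \<and> x \<in> S) \<longrightarrow> D x \<noteq> 0 \<and> D x \<le> D (q h) + 1"
  shows "bfs_inv E S v (Suc h) t D par q"
proof -
  note I = bfs_invD[OF inv]
  show ?thesis
    unfolding bfs_inv_def
  proof (intro conjI)
    show "Suc h \<le> t" using h by simp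
    show "\<forall>i j. i < t \<longrightarrow> Suc h \<le> j \<longrightarrow> j < t \<longrightarrow> D (q i) \<le> D (q j) + 1"
      using I(9) Suc_leD by blast
    show "\<forall>i<Suc h. q i \<notin> S \<longrightarrow> (\<forall>x. {q i, x} \<in> E \<longrightarrow> \<not> (q i = v \<and> x \<in> S) \<longrightarrow>
        D x \<noteq> 0 \<and> D x \<le> D (q i) + 1)"
    proof (intro allI impI)
      fix i x assume *: "i < Suc h" "q i \<notin> S" "{q i, x} \<in> E" "\<not> (q i = v \<and> x \<in> S)"
      show "D x \<noteq> 0 \<and> D x \<le> D (q i) + 1"
      proof (cases "i = h")
        case True
        then show ?thesis using assms(3) * by blast
      next
        case False
        then have "i < h" using *(1) by simp
        then show ?thesis using I(15) * by blast
      qed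
    qed
  qed (insert inv, unfold bfs_inv_def, (elim conjE, assumption)+)
qed

lemma bfs_inv_tree:
  assumes "bfs_inv E S v t t D par q" "v \<notin> S"
  shows "bfs_tree E S v D par"
proof -
  note I = bfs_invD[OF assms(1)]
  have pos: "\<exists>i<t. u = q i" if "D u \<noteq> 0" for u using I(6)[of u] that by auto
  have "D (par u) \<noteq> 0 \<and> D u = D (par u) + 1 \<and> {par u, u} \<in> E \<and> par u \<notin> S \<and> \<not> (par u = v \<and> u \<in> S)"
    if u: "D u \<noteq> 0" "u \<noteq> v" for u
  proof -
    obtain i where i: "i < t" "u = q i" using pos[OF u(1)] by blast
    have "i \<noteq> 0" using i(2) u(2) I(3) by metis
    have "par u \<in> q ` {..<t}" using I(10)[OF i(1) \<open>i \<noteq> 0\<close>] i by auto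
    then have "D (par u) \<noteq> 0" using I(6) by blast
    then show ?thesis using I(11-14)[OF i(1) \<open>i \<noteq> 0\<close>] i(2) by blast
  qed
  moreover have "D x \<noteq> 0 \<and> D x \<le> D u + 1" if "D u \<noteq> 0" "u \<notin> S" "{u, x} \<in> E" "\<not> (u = v \<and> x \<in> S)" for u x
    using pos[OF that(1)] I(15) that by blast
  ultimately show ?thesis unfolding bfs_tree_def using assms(2) I(4) by blast
qed

context ram_graph
begin

definition stored :: "nat set \<Rightarrow> state \<Rightarrow> bool" where
  "stored S s \<longleftrightarrow> S \<subseteq> {..<n} \<and> (\<forall>u<n. arr s 7 u = of_bool (u \<in> S))"

text \<open>Array cells from \<open>n\<close> on hold arbitrary values. They are cut off because the
  search invariant demands that exactly the queued vertices have nonzero labels.\<close>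

definition label :: "state \<Rightarrow> nat \<Rightarrow> nat" where
  "label s u = (if u < n then arr s 8 u else 0)"

lemma label_set_reg [simp]: "label (set_reg x k s) = label s"
  by (auto simp: label_def)

lemma label_set_cell:
  "a \<noteq> 8 \<Longrightarrow> label (set_cell a i k s) = label s"
  "x < n \<Longrightarrow> label (set_cell 8 x k s) = (label s)(x := k)"
  by (auto simp: label_def)

definition cleared :: "state \<Rightarrow> bool" where
  "cleared s \<longleftrightarrow> (\<forall>u<n. arr s 8 u = 0) \<and> (\<forall>d<n + 2. arr s 11 d = 0) \<and> (\<forall>u<n. arr s 12 u = arr s 7 u)"

lemma clear_correct:
  assumes "input s"
  shows "tr w clear_prog s ((n + 2) * 8 + 3) cleared"
  unfolding clear_prog_def
proof (rule tr_For[where N = "n + 2" and c = 5 and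
      I = "\<lambda>d s1. \<forall>u<d. arr s1 8 u = 0 \<and> arr s1 11 u = 0 \<and> arr s1 12 u = arr s1 7 u"])
  fix i s1 assume same: "frame_for 3 clear_step s s1"
  then have "input s1" using same_input[OF assms same] by simp
  moreover have "n + 2 < 2 ^ w" using word_bounds(3) by linarith
  ultimately show "val w s1 (Add (Reg 0) (Const 2)) = n + 2" by (simp add: inputD)
qed (use word_bounds in \<open>auto simp: cleared_def clear_step_def less_Suc_eq intro!: tr_flat\<close>)

definition bfs_state :: "nat set \<Rightarrow> nat \<Rightarrow> nat \<Rightarrow> state \<Rightarrow> bool" where
  "bfs_state S v h s \<longleftrightarrow> bfs_inv E S v h (reg s 15) (label s) (arr s 10) (arr s 9)"

lemma bfs_state_lt:
  assumes "bfs_state S v h s"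
  shows "i < reg s 15 \<Longrightarrow> arr s 9 i < n" "reg s 15 \<le> n"
proof -
  note I = bfs_invD[OF assms[unfolded bfs_state_def]]
  show *: "arr s 9 i < n" if "i < reg s 15" for i
    using I(6)[of "arr s 9 i"] that by (auto simp: label_def split: if_splits)
  have "card {..<reg s 15} \<le> card {..<n}"
    using * by (intro card_inj_on_le[OF I(5)]) auto
  then show "reg s 15 \<le> n" by simp
qed

abbreviation visited :: "nat set \<Rightarrow> nat \<Rightarrow> nat \<Rightarrow> nat \<Rightarrow> state \<Rightarrow> state \<Rightarrow> bool" where
  "visited S v h x s s' \<equiv> bfs_state S v h s' \<and> h < reg s' 15 \<and> (\<forall>j\<le>h. arr s' 9 j = arr s 9 j) \<and>
     (\<forall>y. label s y \<noteq> 0 \<longrightarrow> label s' y = label s y) \<and>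
     (\<not> (arr s 9 h = v \<and> x \<in> S) \<longrightarrow> label s' x \<noteq> 0 \<and> label s' x \<le> label s' (arr s 9 h) + 1)"

lemma visit_correct:
  assumes adj: "adj s" and v: "reg s 12 = v" "v < n" and S: "stored S s"
    and inv: "bfs_state S v h s" and h: "h < reg s 15" "reg s 3 = arr s 9 h" "arr s 9 h \<notin> S"
    and x: "arr s 3 (reg s 4) = x" "{arr s 9 h, x} \<in> E"
  shows "tr w visit_step s 10 (visited S v h x s)"
proof -
  let ?u = "arr s 9 h"
  note I = bfs_invD[OF inv[unfolded bfs_state_def]]
  have un: "?u < n" "x < n" using edgeD[OF x(2)] by auto
  have uD: "label s ?u \<noteq> 0" using I(6)[of ?u] h(1) by auto
  have "label s ?u \<le> h + 1" using I(7)[OF h(1)] .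
  then have ov: "Suc (arr s 8 ?u) < 2 ^ w"
    using h(1) bfs_state_lt(2)[OF inv] word_bounds(3) un by (simp add: label_def)
  have ov': "Suc (reg s 15) < 2 ^ w" using bfs_state_lt(2)[OF inv] word_bounds(3) by linarith
  let ?c = "label s x = 0 \<and> \<not> (?u = v \<and> x \<in> S)"
  show ?thesis
  proof (cases ?c)
    case True
    let ?s = "set_reg 15 (Suc (reg s 15)) (set_cell 9 (reg s 15) x (set_cell 10 x ?u
      (set_cell 8 x (Suc (label s ?u)) (set_reg 16 x s))))"
    have xu: "x \<noteq> ?u" using True uD by auto
    have r: "result w visit_step s = ?s"
      using True un S v h x ov ov' by (auto simp: visit_step_def stored_def label_def)
    have lab: "label ?s = (label s)(x := label s ?u + 1)" using un by (simp add: label_set_cell)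
    have "bfs_state S v h ?s"
      using bfs_inv_visit[OF inv[unfolded bfs_state_def] h(1,3) x(2)] True
      unfolding bfs_state_def lab by simp
    then show ?thesis
      using True h(1) xu un by (intro tr_flat) (auto simp: r label_set_cell, auto simp: visit_step_def)
  next
    case False
    let ?s = "set_reg 20 0 (set_reg 16 x s)"
    have r: "result w visit_step s = ?s"
      using False un S v h x by (auto simp: visit_step_def stored_def label_def)
    have lab: "label ?s = label s" by (auto simp: label_def)
    \<comment> \<open>A vertex labelled earlier satisfies the bound because no label exceeds that of
      the head by more than one.\<close>
    have "label s x \<noteq> 0 \<Longrightarrow> label s x \<le> label s ?u + 1"
      using I(6)[of x] I(9)[OF _ order_refl h(1)] by auto
    moreover have "bfs_state S v h ?s" using inv unfolding bfs_state_def lab by simp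
    ultimately show ?thesis
      using False h(1) by (intro tr_flat) (auto simp: r, auto simp: visit_step_def)
  qed
qed

lemma expand_correct:
  assumes adj: "adj s" and v: "reg s 12 = v" "v < n" and S: "stored S s"
    and inv: "bfs_state S v h s" and h: "reg s 14 = h" "h < reg s 15"
  shows "tr w expand_step s (13 * deg (arr s 9 h) + 8) (\<lambda>s'. bfs_state S v (Suc h) s' \<and> reg s' 14 = Suc h \<and>
     (\<forall>i\<le>h. arr s' 9 i = arr s 9 i))"
    (is "tr w _ s _ ?Q")
proof -
  let ?P = "\<lambda>s'. bfs_state S v (Suc h) s' \<and> (\<forall>i\<le>h. arr s' 9 i = arr s 9 i)"
  let ?u = "arr s 9 h" and ?s = "set_reg 3 (arr s 9 h) s"
  note I = bfs_invD[OF inv[unfolded bfs_state_def]]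
  have un: "?u < n" using bfs_state_lt(1)[OF inv h(2)] .
  have hn: "Suc h < 2 ^ w" using h(2) bfs_state_lt(2)[OF inv] word_bounds(3) by linarith
  have adj1: "adj ?s" using same_adj[OF adj, of "{3}" "{}"] by (simp add: same_def)
  have inv1: "bfs_state S v h ?s" using inv by (simp add: bfs_state_def)
  have S1: "stored S ?s" using S by (simp add: stored_def)
  define X where "X i s1 \<longleftrightarrow> bfs_state S v h s1 \<and> h < reg s1 15 \<and> (\<forall>j\<le>h. arr s1 9 j = arr s 9 j) \<and>
     (\<forall>x\<in>set (take i (nbrs ?u es)). \<not> (?u = v \<and> x \<in> S) \<longrightarrow> label s1 x \<noteq> 0 \<and> label s1 x \<le> label s1 ?u + 1)"
    for i s1
  have loop: "tr w (If (Cell 7 (Reg 3)) skip (ForNbr 4 3 visit_step)) ?s (13 * deg ?u + 4)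
    ?P"
  proof (rule tr_If[where T = "13 * deg ?u + 3"])
    assume "val w ?s (Cell 7 (Reg 3)) \<noteq> 0"
    then have "?u \<in> S" using S un by (auto simp: stored_def)
    then have "bfs_state S v (Suc h) ?s"
      unfolding bfs_state_def using inv1 h(2) by (intro bfs_inv_expanded) (auto simp: bfs_state_def)
    then show "tr w skip ?s (13 * deg ?u + 3) ?P"
      by (intro tr_flat) (auto simp: bfs_state_def)
  next
    assume "val w ?s (Cell 7 (Reg 3)) = 0"
    then have uS: "?u \<notin> S" using S un by (auto simp: stored_def)
    show "tr w (ForNbr 4 3 visit_step) ?s (13 * deg ?u + 3)
      ?P"
    proof (rule tr_ForNbr[where u = ?u and c = 10 and I = X])
      show "X 0 (set_reg 4 (offset ?u) ?s)"
        using inv h(2) by (simp add: X_def bfs_state_def)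
    next
      fix i s1
      assume i: "i < deg ?u" "X i s1" "reg s1 4 = offset ?u + i"
        and same: "frame_for 4 visit_step ?s s1"
        and adj2: "adj s1" and r3: "reg s1 3 = ?u" and x: "arr s1 3 (offset ?u + i) = nbrs ?u es ! i"
      have r: "reg s1 12 = v" "stored S s1"
        using v S sameD(1)[OF same, of 12] sameD(2)[OF same, of 7] by (auto simp: stored_def)
      have e: "{?u, nbrs ?u es ! i} \<in> E"
        using set_nbrs[of ?u] nth_mem[of i "nbrs ?u es"] i(1) by (auto simp: deg_def)
      have t: "take (Suc i) (nbrs ?u es) = take i (nbrs ?u es) @ [nbrs ?u es ! i]"
        using i(1) by (simp add: deg_def take_Suc_conv_app_nth)
      have q: "arr s1 9 h = ?u" "bfs_state S v h s1" "h < reg s1 15" using i(2) by (auto simp: X_def)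
      have uD: "label s1 ?u \<noteq> 0"
        using bfs_invD(6)[OF q(2)[unfolded bfs_state_def], of ?u] q(1,3) by (metis imageI lessThan_iff)
      have "tr w visit_step s1 10 (visited S v h (nbrs ?u es ! i) s1)"
        using adj2 r v(2) q i(3) r3 x uS e by (intro visit_correct) auto
      then show "tr w visit_step s1 10 (\<lambda>s'. reg s' 4 = offset ?u + i \<and> X (Suc i) (set_reg 4 (offset ?u + Suc i) s'))"
      proof (rule tr_conseq)
        fix s2
        let ?s2 = "set_reg 4 (offset ?u + Suc i) s2"
        assume 2: "visited S v h (nbrs ?u es ! i) s1 s2"
          and "frame visit_step s1 s2"
        then have "reg s2 4 = offset ?u + i" using i(3) by (simp add: same_def)
        moreover have l: "label ?s2 = label s2" by (auto simp: label_def)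
        moreover have "label s2 x \<noteq> 0 \<and> label s2 x \<le> label s2 ?u + 1"
          if x: "x \<in> set (take (Suc i) (nbrs ?u es))" "\<not> (?u = v \<and> x \<in> S)" for x
        proof (cases "x = nbrs ?u es ! i")
          case True
          then show ?thesis using 2 x(2) q(1) by metis
        next
          case False
          then have "x \<in> set (take i (nbrs ?u es))" using x(1) unfolding t by simp
          then have "label s1 x \<noteq> 0 \<and> label s1 x \<le> label s1 ?u + 1" using i(2) x(2) unfolding X_def by blast
          then show ?thesis using 2 uD by metis
        qed
        moreover have "bfs_state S v h ?s2" using 2 unfolding bfs_state_def l by simp
        moreover have "\<forall>j\<le>h. arr ?s2 9 j = arr s 9 j" using 2 i(2) unfolding X_def by simp
        ultimately show "reg s2 4 = offset ?u + i \<and> X (Suc i) ?s2" using 2 unfolding X_def l by simp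
      qed simp
    next
      fix s1 assume X: "X (deg ?u) s1"
      have "bfs_state S v (Suc h) s1"
        unfolding bfs_state_def using X set_nbrs[of ?u]
        by (intro bfs_inv_expanded) (auto simp: bfs_state_def X_def deg_def)
      then show "bfs_state S v (Suc h) s1 \<and> (\<forall>i\<le>h. arr s1 9 i = arr s 9 i)"
        using X by (simp add: X_def)
    qed (use adj1 un in auto)
  qed simp
  show ?thesis unfolding expand_step_def
  proof (rule tr_Seq[where T = 1 and Q = "\<lambda>s1. s1 = ?s" and T' = "13 * deg ?u + 6"], rule tr_flat)
    fix s1 assume s1: "s1 = ?s"
    show "tr w (If (Cell 7 (Reg 3)) skip (ForNbr 4 3 visit_step) ;; incr 14) s1 (13 * deg ?u + 6)
      ?Q"
      unfolding s1
    proof (rule tr_Seq[OF loop, where T' = 1])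
      fix s2 assume "bfs_state S v (Suc h) s2 \<and> (\<forall>i\<le>h. arr s2 9 i = arr s 9 i)"
        and same: "frame (If (Cell 7 (Reg 3)) skip (ForNbr 4 3 visit_step)) ?s s2"
      then show "tr w (incr 14) s2 1 ?Q"
        using h(1) hn sameD(1)[OF same, of 14] by (intro tr_flat) (auto simp: bfs_state_def)
    qed simp
  qed (use h in auto)
qed

lemma bfs_correct:
  assumes adj: "adj s" and v: "reg s 12 = v" "v < n" and S: "stored S s" and zero: "\<forall>u<n. arr s 8 u = 0"
  shows "tr w bfs_prog s (26 * m + 9 * n + 9) (\<lambda>s'. bfs_state S v (reg s' 15) s')"
proof -
  let ?s = "set_reg 15 1 (set_reg 14 0 (set_cell 9 0 v (set_cell 8 v 1 s)))"
  \<comment> \<open>Every vertex not yet expanded holds the price of its own adjacency row. Degrees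
    sum to at most \<open>2 * m\<close>, so \<open>26 * m + 9 * n\<close> suffices at the
    start.\<close>
  define V where "V s = (\<Sum>u\<in>{..<n} - arr s 9 ` {..<reg s 14}. 13 * deg u + 9)" for s :: state
  have lab: "label ?s = (\<lambda>u. if u = v then 1 else 0)"
    using v zero by (auto simp: label_def)
  have adj1: "adj ?s" using same_adj[OF adj, of "{14, 15}" "{8, 9}"] by (simp add: same_def)
  have loop: "tr w (While (Less (Reg 14) (Reg 15)) expand_step) ?s (26 * m + 9 * n + 1)
    (\<lambda>s'. bfs_state S v (reg s' 15) s')"
  proof (rule tr_While[where I = "\<lambda>s. bfs_state S v (reg s 14) s" and V = V])
    show "bfs_state S v (reg ?s 14) ?s"
      unfolding bfs_state_def lab bfs_inv_def by (auto simp: lessThan_Suc)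
  next
    fix s1 assume inv: "bfs_state S v (reg s1 14) s1" and same: "frame expand_step ?s s1"
      and g: "val w s1 (Less (Reg 14) (Reg 15)) \<noteq> 0"
    let ?h = "reg s1 14" and ?u = "arr s1 9 (reg s1 14)"
    have h: "?h < reg s1 15" using g by (auto split: if_splits)
    have "adj s1" using same_adj[OF adj1 same] by simp
    moreover have "reg s1 12 = v" "stored S s1" using v S sameD(1)[OF same, of 12] sameD(2)[OF same, of 7]
      by (auto simp: stored_def)
    ultimately have "tr w expand_step s1 (13 * deg ?u + 8) (\<lambda>s'. bfs_state S v (Suc ?h) s' \<and> reg s' 14 = Suc ?h \<and>
      (\<forall>i\<le>?h. arr s' 9 i = arr s1 9 i))"
      using v inv h by (intro expand_correct) auto
    then have "tr w expand_step s1 (13 * deg ?u + 8) (\<lambda>s'. bfs_state S v (reg s' 14) s' \<and> V s' + (13 * deg ?u + 8) + 1 \<le> V s1)"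
    proof (rule tr_conseq)
      fix s' assume s': "bfs_state S v (Suc ?h) s' \<and> reg s' 14 = Suc ?h \<and> (\<forall>i\<le>?h. arr s' 9 i = arr s1 9 i)"
      have "arr s' 9 ` {..<Suc ?h} = arr s1 9 ` {..<Suc ?h}" using s' by (intro image_cong) auto
      also have "\<dots> = insert ?u (arr s1 9 ` {..<?h})" by (simp add: lessThan_Suc)
      finally have im: "{..<n} - arr s' 9 ` {..<reg s' 14} = {..<n} - arr s1 9 ` {..<?h} - {?u}" using s' by auto
      have "?u \<notin> arr s1 9 ` {..<?h}"
        using inj_onD[OF bfs_invD(5)[OF inv[unfolded bfs_state_def]]] h by fastforce
      then have "?u \<in> {..<n} - arr s1 9 ` {..<?h}" using bfs_state_lt(1)[OF inv h] by simp
      then have "V s1 = (13 * deg ?u + 9) + V s'" unfolding V_def im by (intro sum.remove) auto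
      then show "bfs_state S v (reg s' 14) s' \<and> V s' + (13 * deg ?u + 8) + 1 \<le> V s1" using s' by simp
    qed simp
    then show "\<exists>c. tr w expand_step s1 c (\<lambda>s'. bfs_state S v (reg s' 14) s' \<and> V s' + c + 1 \<le> V s1)" by blast
  next
    fix s1 assume inv: "bfs_state S v (reg s1 14) s1" and "val w s1 (Less (Reg 14) (Reg 15)) = 0"
    then have "reg s1 14 = reg s1 15"
      using bfs_invD(2)[OF inv[unfolded bfs_state_def]] by (auto split: if_splits)
    then show "bfs_state S v (reg s1 15) s1" using inv by simp
  next
    have "V ?s \<le> (\<Sum>u<n. 13 * deg u + 9)" unfolding V_def by (intro sum_mono2) auto
    also have "\<dots> = 13 * (\<Sum>u<n. deg u) + 9 * n" by (simp add: sum.distrib sum_distrib_left)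
    also have "\<dots> \<le> 26 * m + 9 * n" using sum_deg by simp
    finally show "V ?s + 1 \<le> 26 * m + 9 * n + 1" by simp
  qed
  show ?thesis
    unfolding bfs_prog_def
    by (rule tr_Seq[where T = 7 and Q = "\<lambda>s1. s1 = ?s"], rule tr_flat)
      (use v loop in \<open>auto simp: bfs_init_def\<close>)
qed

section \<open>Layer sizes, radius and marking of the tree paths\<close>

lemma card_less_Suc: "card {u. u < Suc i \<and> P u} = card {u. u < i \<and> P u} + of_bool (P i)"
proof -
  have "{u. u < Suc i \<and> P u} = (if P i then insert i {u. u < i \<and> P u} else {u. u < i \<and> P u})"
    by (auto simp: less_Suc_eq)
  then show ?thesis by simp
qed

definition layer :: "state \<Rightarrow> nat \<Rightarrow> nat" where
  "layer s d = card {u. u < n \<and> label s u = d}"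

lemma layers_correct:
  assumes inp: "input s" and S: "stored S s" and zero: "\<forall>d<n + 2. arr s 11 d = 0"
    and D: "\<And>u. label s u \<le> n"
  shows "tr w layers_prog s (6 * n + 5) (\<lambda>s'. reg s' 17 = card S \<and> (\<forall>d<n + 2. arr s' 11 d = layer s d))"
    (is "tr w _ s _ ?Q")
proof -
  let ?s = "set_reg 17 0 s"
  have Sn: "S \<subseteq> {..<n}" using S unfolding stored_def by blast
  have le: "card {u. u < i \<and> P u} \<le> i" for i P
    using card_mono[of "{..<i}" "{u. u < i \<and> P u}"] by auto
  have inp1: "input ?s" using inp by (simp add: input_def)
  let ?I = "\<lambda>i s1. reg s1 17 = card {u. u < i \<and> u \<in> S} \<and>
    (\<forall>d<n + 2. arr s1 11 d = card {u. u < i \<and> label s u = d})"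
  have loop: "tr w (For 3 (Reg 0) layer_step) ?s (6 * n + 3)
      ?Q"
  proof (rule tr_For[where N = n and c = 3 and I = ?I])
    fix i s1 assume i: "i < n" "?I i s1" "reg s1 3 = i"
      and same: "frame_for 3 layer_step ?s s1"
    have a: "arr s1 7 = arr s 7" "arr s1 8 = arr s 8" using sameD(2)[OF same] by auto
    have ov: "card {u. u < i \<and> P u} + 1 < 2 ^ w" for P using le[of i P] i(1) word_bounds(3) by linarith
    have s7: "arr s1 7 i = of_bool (i \<in> S)" using a S i(1) by (simp add: stored_def)
    have s8: "arr s1 8 i = label s i" using a i(1) by (simp add: label_def)
    have l: "label s i < n + 2" using D[of i] by simp
    show "tr w layer_step s1 3 (\<lambda>s'. reg s' 3 = i \<and> ?I (Suc i) (set_reg 3 (Suc i) s'))"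
      unfolding layer_step_def card_less_Suc
      using i s7 s8 l ov[of "\<lambda>u. u \<in> S"] ov[of "\<lambda>u. label s u = label s i"] by (intro tr_flat) auto
  next
    fix i s1 assume same: "frame_for 3 layer_step ?s s1"
    have "input s1" using same_input[OF inp1 same] by simp
    then show "val w s1 (Reg 0) = n" by (simp add: inputD)
  next
    fix s1 assume "?I n s1"
    moreover have "{u. u < n \<and> u \<in> S} = S" using Sn by auto
    ultimately show "reg s1 17 = card S \<and> (\<forall>d<n + 2. arr s1 11 d = layer s d)" by (simp add: layer_def)
  qed (use word_bounds zero in auto)
  show ?thesis unfolding layers_prog_def
    by (rule tr_Seq[where T = 1 and Q = "\<lambda>s1. s1 = ?s"], rule tr_flat) (use loop in auto)
qed

text \<open>Distance \<open>k\<close> corresponds to label \<open>k + 1\<close>. The bound on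
  \<open>L (k + 1)\<close> limits the layer that is added, and the minimality of \<open>k\<close> is
  the premise of \<open>radius_bound\<close>.\<close>

definition radius_ok :: "nat \<Rightarrow> nat \<Rightarrow> (nat \<Rightarrow> nat) \<Rightarrow> nat \<Rightarrow> bool" where
  "radius_ok r z L k \<longleftrightarrow> 1 \<le> k \<and> k \<le> n \<and>
     (if r < f then L (k + 1) \<le> z * k \<and> (\<forall>j. 1 \<le> j \<longrightarrow> j < k \<longrightarrow> z * j < L (j + 1)) else k = 1)"

lemma radius_correct:
  assumes inp: "input s" and n: "n \<ge> 1" and r: "reg s 13 = r" and z: "reg s 17 = z" "z \<le> n"
    and L: "\<forall>d<n + 2. arr s 11 d = L d" "\<And>d. d > n \<Longrightarrow> L d = 0"
  shows "tr w radius_prog s (2 * n + 5) (\<lambda>s'. \<exists>k. reg s' 18 = k + 1 \<and> radius_ok r z L k)"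
    (is "tr w _ s _ ?Q")
proof -
  let ?s = "set_reg 18 2 s"
  let ?g = "Less (Mul (Reg 17) (Sub (Reg 18) (Const 1))) (Cell 11 (Reg 18))"
  have inp1: "input ?s" using inp by (simp add: input_def)
  define I where "I s1 \<longleftrightarrow> (\<exists>k. reg s1 18 = k + 1 \<and> 1 \<le> k \<and> k \<le> n \<and> (\<forall>j. 1 \<le> j \<longrightarrow> j < k \<longrightarrow> z * j < L (j + 1)))"
    for s1 :: state
  have g: "val w s1 ?g \<noteq> 0 \<longleftrightarrow> z * k < L (k + 1)"
    if "frame (incr 18) ?s s1" "reg s1 18 = k + 1" "k \<le> n" for s1 k
  proof -
    have "z * k \<le> n * n" using z(2) that(3) by (rule mult_le_mono)
    then have "z * k < 2 ^ w" using word_bounds(5) by linarith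
    then show ?thesis using sameD(1)[OF that(1), of 17] sameD(2)[OF that(1), of 11] that z(1) L(1) by simp
  qed
  have loop: "tr w (While ?g (incr 18)) ?s (2 * n + 2) ?Q" if "r < f"
  proof (rule tr_While[where I = I and V = "\<lambda>s1. 2 * (n + 1 - reg s1 18)"])
    show "I ?s" using n by (auto simp: I_def intro!: exI[of _ 1])
  next
    fix s1 assume "I s1" and same: "frame (incr 18) ?s s1" and v: "val w s1 ?g \<noteq> 0"
    then obtain k where k: "reg s1 18 = k + 1" "1 \<le> k" "k \<le> n" "\<forall>j. 1 \<le> j \<longrightarrow> j < k \<longrightarrow> z * j < L (j + 1)"
      unfolding I_def by blast
    have zk: "z * k < L (k + 1)" using v g[OF same k(1,3)] by simp
    \<comment> \<open>Layers with labels above \<open>n\<close> are empty, so the search cannot run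
      past \<open>n\<close>.\<close>
    then have kn: "k + 1 \<le> n" using L(2)[of "k + 1"] by (cases "k + 1 \<le> n") auto
    have "Suc (Suc k) < 2 ^ w" using kn word_bounds(3) by linarith
    then have "tr w (incr 18) s1 1 (\<lambda>s'. I s' \<and> 2 * (n + 1 - reg s' 18) + 1 + 1 \<le> 2 * (n + 1 - reg s1 18))"
      using k kn zk by (intro tr_flat) (auto simp: I_def less_Suc_eq intro!: exI[of _ "Suc k"])
    then show "\<exists>c. tr w (incr 18) s1 c (\<lambda>s'. I s' \<and> 2 * (n + 1 - reg s' 18) + c + 1 \<le> 2 * (n + 1 - reg s1 18))"
      by blast
  next
    fix s1 assume "I s1" and same: "frame (incr 18) ?s s1" and v: "val w s1 ?g = 0"
    then obtain k where k: "reg s1 18 = k + 1" "1 \<le> k" "k \<le> n" "\<forall>j. 1 \<le> j \<longrightarrow> j < k \<longrightarrow> z * j < L (j + 1)"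
      unfolding I_def by blast
    moreover have "L (k + 1) \<le> z * k" using v g[OF same k(1,3)] by simp
    ultimately show "\<exists>k. reg s1 18 = k + 1 \<and> radius_ok r z L k" using that unfolding radius_ok_def by auto
  qed (use n in simp)
  have "tr w (If (Less (Reg 13) (Reg 2)) (While ?g (incr 18)) skip) ?s (2 * n + 3)
    ?Q"
  proof (rule tr_If[where T = "2 * n + 2"])
    assume "val w ?s (Less (Reg 13) (Reg 2)) \<noteq> 0"
    then show "tr w (While ?g (incr 18)) ?s (2 * n + 2) ?Q"
      using inputD(4)[OF inp] r by (intro loop) (auto split: if_splits)
  next
    assume "val w ?s (Less (Reg 13) (Reg 2)) = 0"
    then show "tr w skip ?s (2 * n + 2) ?Q"
      using inputD(4)[OF inp] r n by (intro tr_flat) (auto simp: radius_ok_def split: if_splits intro!: exI[of _ 1])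
  qed simp
  then show ?thesis unfolding radius_prog_def
    by (intro tr_Seq[where T = 1 and Q = "\<lambda>s1. s1 = ?s" and T' = "2 * n + 3"])
      (auto intro!: tr_flat)
qed

definition marked :: "state \<Rightarrow> nat set" where
  "marked s = {u. u < n \<and> arr s 12 u \<noteq> 0}"

text \<open>Queue positions from \<open>i\<close> on have been processed. The last conjunct gives
  closure under parents; the middle one says that nothing is marked without cause, which the
  counting of marked layers requires.\<close>

definition marks_from :: "nat set \<Rightarrow> nat \<Rightarrow> (nat \<Rightarrow> nat) \<Rightarrow> (nat \<Rightarrow> nat) \<Rightarrow> (nat \<Rightarrow> nat) \<Rightarrow> nat \<Rightarrow> nat \<Rightarrow> nat set \<Rightarrow> bool" where
  "marks_from S v D par q t i M \<longleftrightarrow> S \<subseteq> M \<and>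
     (\<forall>u\<in>M. u \<in> S \<or> (\<exists>x\<in>M. D x \<noteq> 0 \<and> x \<noteq> v \<and> par x = u)) \<and>
     (\<forall>j. i \<le> j \<longrightarrow> j < t \<longrightarrow> q j \<in> M \<longrightarrow> par (q j) \<in> M)"

text \<open>The parent of \<open>q i\<close> stands strictly before position \<open>i\<close>, so
  marking it creates no new obligation at positions already processed.\<close>

lemma marks_from_step:
  assumes inv: "bfs_inv E S v h t D par q" and i: "i < t" "i \<noteq> 0" and M: "marks_from S v D par q t (Suc i) M"
  shows "marks_from S v D par q t i (if q i \<in> M then insert (par (q i)) M else M)"
proof -
  note I = bfs_invD[OF inv]
  obtain k where k: "k < i" "par (q i) = q k" using I(10)[OF i] by auto
  have new: "q j \<noteq> par (q i)" if "i \<le> j" "j < t" for j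
    using inj_onD[OF I(5), of j k] k that by auto
  have "D (q i) \<noteq> 0" using I(6) i(1) by blast
  moreover have "q i \<noteq> v" using inj_onD[OF I(5), of i 0] I(1,3) i by auto
  ultimately have 1: "\<forall>u\<in>insert (par (q i)) M. u \<in> S \<or> (\<exists>x\<in>insert (par (q i)) M. D x \<noteq> 0 \<and> x \<noteq> v \<and> par x = u)"
    if "q i \<in> M" using M that unfolding marks_from_def by blast
  show ?thesis
  proof (cases "q i \<in> M")
    case True
    have "par (q j) \<in> insert (par (q i)) M" if "i \<le> j" "j < t" "q j \<in> insert (par (q i)) M" for j
    proof (cases "j = i")
      case False
      then have "Suc i \<le> j" "q j \<in> M" using that new[OF that(1,2)] by auto
      then show ?thesis using M that(2) unfolding marks_from_def by blast
    qed simp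
    then show ?thesis using 1[OF True] M True unfolding marks_from_def by auto
  next
    case False
    have "par (q j) \<in> M" if "i \<le> j" "j < t" "q j \<in> M" for j
    proof -
      have "Suc i \<le> j" using that False by (cases "j = i") auto
      then show ?thesis using M that unfolding marks_from_def by blast
    qed
    then show ?thesis using M False unfolding marks_from_def by simp
  qed
qed

lemma ancestors_correct:
  assumes inp: "input s" and S: "stored S s" and inv: "bfs_state S v t s" and t: "reg s 15 = t"
    and init: "\<forall>u<n. arr s 12 u = of_bool (u \<in> S)"
  shows "tr w ancestors_prog s (7 * n + 3) (\<lambda>s'. (\<forall>u<n. arr s' 12 u = of_bool (u \<in> marked s')) \<and>
    marks_from S v (label s) (arr s 10) (arr s 9) t 1 (marked s'))"
proof -
  let ?A = "marks_from S v (label s) (arr s 10) (arr s 9) t"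
  let ?I = "\<lambda>i s1. (\<forall>u<n. arr s1 12 u = of_bool (u \<in> marked s1)) \<and> ?A i (marked s1)"
  show ?thesis
    unfolding ancestors_prog_def
  proof (rule tr_For[where N = "t - 1" and c = 4 and I = "\<lambda>i. ?I (t - i)"])
    note inv' = inv[unfolded bfs_state_def t]
    note I = bfs_invD[OF inv']
    have tn: "t \<le> n" using bfs_state_lt(2)[OF inv] t by simp
    show "t - 1 < 2 ^ w" using tn word_bounds(3) by linarith
    have "marked (set_reg 19 0 s) = S" using init S by (auto simp: marked_def stored_def)
    then show "?I (t - 0) (set_reg 19 0 s)"
      using init by (simp add: marks_from_def)
    fix i s1 assume same: "frame_for 19 ancestor_step s s1"
    have r: "reg s1 15 = t" using sameD(1)[OF same, of 15] t by simp
    then show "val w s1 (Sub (Reg 15) (Const 1)) = t - 1" by simp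
    assume i: "i < t - 1" "?I (t - i) s1" "reg s1 19 = i"
    define p where "p = t - Suc i"
    have p: "p < t" "p \<noteq> 0" "t - i = Suc p" "t - Suc 0 - i = p" using i(1) by (auto simp: p_def)
    have a: "arr s1 9 = arr s 9" "arr s1 10 = arr s 10" using sameD(2)[OF same] by auto
    have qn: "arr s 9 p < n" using bfs_state_lt(1)[OF inv] p t by simp
    obtain k where "k < p" "arr s 10 (arr s 9 p) = arr s 9 k" using I(10)[OF p(1,2)] by auto
    then have pn: "arr s 10 (arr s 9 p) < n" using bfs_state_lt(1)[OF inv, of k] p t by simp
    let ?M = "if arr s 9 p \<in> marked s1 then insert (arr s 10 (arr s 9 p)) (marked s1) else marked s1"
    let ?r = "result w ancestor_step s1"
    have r12: "\<forall>u<n. arr ?r 12 u = of_bool (u \<in> ?M)"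
      using i r a p qn pn by (auto simp: ancestor_step_def)
    then have "marked ?r = ?M" using pn by (auto simp: marked_def split: if_splits)
    then have mk: "marked (set_reg 19 (Suc i) ?r) = ?M" by (simp add: marked_def)
    have "?A p ?M"
      using i(2) p by (intro marks_from_step[OF inv' p(1,2)]) simp
    then show "tr w ancestor_step s1 4 (\<lambda>s'. reg s' 19 = i \<and>
       ?I (t - Suc i) (set_reg 19 (Suc i) s'))"
      using r12 mk i(3) unfolding p_def[symmetric]
      by (intro tr_flat) (simp_all add: ancestor_step_def)
  next
    fix s1 assume "?I (t - (t - 1)) s1"
    moreover have "t - (t - 1) = 1" using bfs_invD(1)[OF inv[unfolded bfs_state_def]] t by simp
    ultimately show "?I 1 s1" by simp
  next
    have "t \<le> n" using bfs_state_lt(2)[OF inv] t by simp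
    then show "(t - 1) * (4 + 3) + 3 \<le> 7 * n + 3" by simp
  qed
qed

lemma update_correct:
  assumes inp: "input s" and S: "stored S s" and v: "reg s 12 = v" "v < n" and k: "reg s 18 = k + 1" "k \<le> n"
    and r: "reg s 13 = r" and M: "\<forall>u<n. arr s 12 u = of_bool (u \<in> M)"
  shows "tr w update_prog s (5 * n + 5) (stored ((S \<union> {u. u < n \<and> u \<in> M \<and> label s u \<le> k + 1} \<union>
    {u. u < n \<and> r < f \<and> label s u = k + 1}) - {v}))"
proof -
  let ?U = "{u. u < n \<and> u \<in> M \<and> label s u \<le> k + 1} \<union> {u. u < n \<and> r < f \<and> label s u = k + 1}"
  let ?Q = "stored ((S \<union> {u. u < n \<and> u \<in> M \<and> label s u \<le> k + 1} \<union>
    {u. u < n \<and> r < f \<and> label s u = k + 1}) - {v})"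
  have Sn: "S \<subseteq> {..<n}" using S by (simp add: stored_def)
  have loop: "tr w (For 3 (Reg 0) update_step) s (5 * n + 3) (stored (S \<union> ?U))"
  proof (rule tr_For[where N = n and c = 2 and I = "\<lambda>i s1. \<forall>u<n. arr s1 7 u = of_bool (u \<in> S \<or> u < i \<and> u \<in> ?U)"])
    show "\<forall>u<n. arr (set_reg 3 0 s) 7 u = of_bool (u \<in> S \<or> u < 0 \<and> u \<in> ?U)" using S by (simp add: stored_def)
  next
    fix i s1 assume same: "frame_for 3 update_step s s1"
    have inp1: "input s1" using same_input[OF inp same] by simp
    then show "val w s1 (Reg 0) = n" by (simp add: inputD)
    assume i: "i < n" "\<forall>u<n. arr s1 7 u = of_bool (u \<in> S \<or> u < i \<and> u \<in> ?U)" "reg s1 3 = i"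
    have a: "reg s1 18 = k + 1" "reg s1 13 = r" "reg s1 2 = f" "arr s1 12 i = of_bool (i \<in> M)" "arr s1 8 i = label s i"
      using sameD[OF same] k(1) r M i(1) inputD(4)[OF inp1] by (auto simp: label_def)
    have "Suc (Suc k) < 2 ^ w" using k(2) word_bounds(3) by linarith
    then have c: "val w s1 (Add (Mul (Cell 12 (Reg 3)) (Less (Cell 8 (Reg 3)) (Add (Reg 18) (Const 1))))
          (Mul (Less (Reg 13) (Reg 2)) (Eq (Cell 8 (Reg 3)) (Reg 18)))) \<noteq> 0 \<longleftrightarrow> i \<in> ?U"
      using a i by auto
    show "tr w update_step s1 2 (\<lambda>s'. reg s' 3 = i \<and>
        (\<forall>u<n. arr (set_reg 3 (Suc i) s') 7 u = of_bool (u \<in> S \<or> u < Suc i \<and> u \<in> ?U)))"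
    proof (rule tr_flat)
      let ?r = "result w update_step s1"
      have "arr ?r 7 = (if i \<in> ?U then (arr s1 7)(i := 1) else arr s1 7)" "reg ?r 3 = i"
        unfolding update_step_def result.simps c using i(3) by auto
      then show "reg ?r 3 = i \<and> (\<forall>u<n. arr (set_reg 3 (Suc i) ?r) 7 u = of_bool (u \<in> S \<or> u < Suc i \<and> u \<in> ?U))"
        using i(2) by (auto simp: less_Suc_eq)
    qed (simp_all add: update_step_def)
  next
    fix s1 :: state assume "\<forall>u<n. arr s1 7 u = of_bool (u \<in> S \<or> u < n \<and> u \<in> ?U)"
    then show "stored (S \<union> ?U) s1" using Sn by (auto simp: stored_def)
  qed (use word_bounds in auto)
  show ?thesis unfolding update_prog_def
  proof (rule tr_Seq[OF loop, where T' = 1])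
    fix s1 assume "stored (S \<union> ?U) s1" "frame (For 3 (Reg 0) update_step) s s1"
    then show "tr w (Set_Cell 7 (Reg 12) (Const 0)) s1 1 ?Q"
      using v by (intro tr_flat) (auto simp: stored_def same_def)
  qed simp
qed

section \<open>Correctness, size and time of a complete round\<close>

definition round_ok :: "nat \<Rightarrow> nat \<Rightarrow> nat set \<Rightarrow> nat set \<Rightarrow> bool" where
  "round_ok v r S S' \<longleftrightarrow> S' \<subseteq> {..<n} \<and> (\<exists>k D par M. round_step E v S k (r < f) D par M S') \<and>
     (r < f \<longrightarrow> (card S')\<^sup>2 \<le> 36 * n * card S) \<and> (\<not> r < f \<longrightarrow> card S' \<le> 2 * card S)"

lemma round_okI:
  assumes inv: "bfs_inv E S v t t D par q" and v: "v \<notin> S" and Sn: "S \<subseteq> {..<n}"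
    and D: "\<And>u. D u \<noteq> 0 \<Longrightarrow> u < n"
    and M: "marks_from S v D par q t 1 M" and k: "radius_ok r (card S) (\<lambda>d. card {u. u < n \<and> D u = d}) k"
    and S': "S' = (S \<union> {u. u < n \<and> u \<in> M \<and> D u \<le> k + 1} \<union> {u. u < n \<and> r < f \<and> D u = k + 1}) - {v}"
  shows "round_ok v r S S'"
proof -
  note I = bfs_invD[OF inv]
  have bfs: "bfs_tree E S v D par" using inv v by (rule bfs_inv_tree)
  have k1: "1 \<le> k" using k by (simp add: radius_ok_def)
  have "par u \<in> M" if u: "u \<in> M" "u \<noteq> v" "D u \<noteq> 0" for u
  proof -
    obtain j where j: "j < t" "u = q j" using I(6)[of u] u by auto
    then have "1 \<le> j" using u I(3) by (cases j) auto
    then show ?thesis using M j u unfolding marks_from_def by blast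
  qed
  moreover have "u \<noteq> v" if "D u = k + 1" for u using that I(4) k1 by auto
  ultimately have R: "round_step E v S k (r < f) D par M S'"
    unfolding round_step_def using bfs k1 v M D unfolding S' marks_from_def by auto
  have fin: "finite {u. D u \<noteq> 0}" "finite S"
    using D Sn by (auto intro: finite_subset[of _ "{..<n}"])
  let ?Z = "{u. u < n \<and> r < f \<and> D u = k + 1}"
  have "S' \<subseteq> S \<union> {u \<in> M. u \<noteq> v \<and> D u \<noteq> 0 \<and> D u \<le> k + 1} \<union> ?Z"
  proof
    fix u assume u: "u \<in> S'"
    show "u \<in> S \<union> {u \<in> M. u \<noteq> v \<and> D u \<noteq> 0 \<and> D u \<le> k + 1} \<union> ?Z"
    proof (cases "u \<in> S \<or> u \<in> ?Z")
      case False
      then have *: "u \<in> M" "D u \<le> k + 1" "u \<noteq> v" using u unfolding S' by auto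
      \<comment> \<open>A marked vertex outside \<open>S\<close> is the parent of a reached vertex
        and is therefore reached itself.\<close>
      then obtain x where x: "D x \<noteq> 0" "x \<noteq> v" "par x = u" using M False unfolding marks_from_def by blast
      then have "D u \<noteq> 0" using bfs_treeD(3)[OF bfs x(1,2)] by simp
      then show ?thesis using * by simp
    qed auto
  qed
  then have card: "card S' \<le> card S * (k + 1) + card ?Z"
    using M unfolding marks_from_def by (intro card_round[OF R fin]) auto
  have "(card S')\<^sup>2 \<le> 36 * n * card S" if "r < f"
  proof (rule card_full_round[OF _ k1])
    have "card ?Z \<le> card S * k" using k that by (simp add: radius_ok_def)
    then show "card S' \<le> card S * (2 * k + 1)" using card by (simp add: algebra_simps)
    show "card S \<le> n" using card_mono[OF _ Sn] by simp
    show "card S * (k - 1)\<^sup>2 \<le> 2 * n"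
      using k that by (intro radius_bound[where D = D]) (auto simp: radius_ok_def)
  qed
  moreover have "card S' \<le> 2 * card S" if "\<not> r < f"
    using card k that by (simp add: radius_ok_def)
  moreover have "S' \<subseteq> {..<n}" using Sn unfolding S' by auto
  ultimately show ?thesis unfolding round_ok_def using R by blast
qed

lemma round_correct:
  assumes adj: "adj s" and v: "reg s 12 = v" "v < n" "v \<notin> S" and r: "reg s 13 = r" and S: "stored S s"
  shows "tr w round_prog s (26 * m + 37 * n + 54) (\<lambda>s'. \<exists>S'. stored S' s' \<and> round_ok v r S S')"
    (is "tr w _ s _ ?Q")
  unfolding round_prog_def
proof (rule tr_Seq[OF clear_correct[OF adjD(1)[OF adj]], where T' = "26 * m + 29 * n + 34"])
  fix s1 assume c: "cleared s1" and same: "frame clear_prog s s1"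
  have adj1: "adj s1" using same_adj[OF adj same] by simp
  have k1: "reg s1 12 = v" "reg s1 13 = r" "stored S s1"
    using sameD[OF same] v(1) r S by (auto simp: stored_def)
  have c1: "\<forall>u<n. arr s1 8 u = 0" "\<forall>d<n + 2. arr s1 11 d = 0" "\<forall>u<n. arr s1 12 u = of_bool (u \<in> S)"
    using c k1(3) by (auto simp: cleared_def stored_def)
  show "tr w (bfs_prog ;; layers_prog ;; radius_prog ;; ancestors_prog ;; update_prog) s1 (26 * m + 29 * n + 34)
    ?Q"
  proof (rule tr_Seq[OF bfs_correct[OF adj1 k1(1) v(2) k1(3) c1(1)], where T' = "20 * n + 24"])
    fix s2 assume b: "bfs_state S v (reg s2 15) s2" and same: "frame bfs_prog s1 s2"
    define t where "t = reg s2 15"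
    have inp2: "input s2" using same_adj[OF adj1 same] adjD(1) by simp
    have k2: "reg s2 12 = v" "reg s2 13 = r" "stored S s2" "arr s2 11 = arr s1 11" "arr s2 12 = arr s1 12"
      using sameD[OF same] k1 by (auto simp: stored_def)
    note inv = b[unfolded bfs_state_def]
    have D: "label s2 u \<le> n" for u
    proof (cases "label s2 u = 0")
      case False
      then obtain i where i: "i < reg s2 15" "u = arr s2 9 i" using bfs_invD(6)[OF inv, of u] by auto
      then have "label s2 u \<le> i + 1" using bfs_invD(7)[OF inv] by blast
      then show ?thesis using i(1) bfs_state_lt(2)[OF b] by simp
    qed simp
    have z: "\<forall>d<n + 2. arr s2 11 d = 0" using c1 k2 by simp
    show "tr w (layers_prog ;; radius_prog ;; ancestors_prog ;; update_prog) s2 (20 * n + 24)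
      ?Q"
    proof (rule tr_Seq[OF layers_correct[OF inp2 k2(3) z D], where T' = "14 * n + 18"])
      fix s3 assume l: "reg s3 17 = card S \<and> (\<forall>d<n + 2. arr s3 11 d = layer s2 d)"
        and same: "frame layers_prog s2 s3"
      have inp3: "input s3" using same_input[OF inp2 same] by simp
      have k3: "reg s3 12 = v" "reg s3 13 = r" "stored S s3" "reg s3 15 = t" "arr s3 8 = arr s2 8"
        "arr s3 9 = arr s2 9" "arr s3 10 = arr s2 10" "arr s3 12 = arr s1 12"
        using sameD[OF same] k2 by (auto simp: stored_def t_def)
      have n1: "n \<ge> 1" using v(2) by simp
      have zn: "card S \<le> n" using card_mono[of "{..<n}" S] S by (simp add: stored_def)
      have L0: "layer s2 d = 0" if "d > n" for d
      proof -
        have "{u. u < n \<and> label s2 u = d} = {}" using D that by (metis (mono_tags, lifting) empty_Collect_eq leD)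
        then show ?thesis by (simp add: layer_def)
      qed
      show "tr w (radius_prog ;; ancestors_prog ;; update_prog) s3 (14 * n + 18)
        ?Q"
      proof (rule tr_Seq[OF radius_correct[OF inp3 n1 k3(2) conjunct1[OF l] zn conjunct2[OF l] L0], where T' = "12 * n + 10"])
        fix s4 assume "\<exists>k. reg s4 18 = k + 1 \<and> radius_ok r (card S) (layer s2) k"
          and same: "frame radius_prog s3 s4"
        then obtain k where k: "reg s4 18 = k + 1" "radius_ok r (card S) (layer s2) k" by blast
        have inp4: "input s4" using same_input[OF inp3 same] by simp
        have k4: "reg s4 12 = v" "reg s4 13 = r" "stored S s4" "reg s4 15 = t" "arr s4 8 = arr s2 8"
          "arr s4 9 = arr s2 9" "arr s4 10 = arr s2 10" "arr s4 12 = arr s1 12"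
          using sameD[OF same] k3 by (auto simp: stored_def)
        have lab: "label s4 = label s2" using k4 by (auto simp: label_def)
        have b4: "bfs_state S v t s4" using b k4 by (simp add: bfs_state_def lab t_def)
        have i4: "\<forall>u<n. arr s4 12 u = of_bool (u \<in> S)" using c1 k4 by simp
        show "tr w (ancestors_prog ;; update_prog) s4 (12 * n + 10) ?Q"
        proof (rule tr_Seq[OF ancestors_correct[OF inp4 k4(3) b4 k4(4) i4], where T' = "5 * n + 5"])
          fix s5 assume a: "(\<forall>u<n. arr s5 12 u = of_bool (u \<in> marked s5)) \<and>
             marks_from S v (label s4) (arr s4 10) (arr s4 9) t 1 (marked s5)"
            and same: "frame ancestors_prog s4 s5"
          have inp5: "input s5" using same_input[OF inp4 same] by simp
          have k5: "reg s5 12 = v" "reg s5 13 = r" "stored S s5" "reg s5 18 = k + 1" "arr s5 8 = arr s2 8"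
            using sameD[OF same] k4 k by (auto simp: stored_def)
          have lab5: "label s5 = label s2" using k5 by (auto simp: label_def)
          have kn: "k \<le> n" using k(2) by (simp add: radius_ok_def)
          from update_correct[OF inp5 k5(3,1) v(2) k5(4) kn k5(2) conjunct1[OF a]]
          show "tr w update_prog s5 (5 * n + 5) ?Q"
          proof (rule tr_conseq)
            let ?S' = "(S \<union> {u. u < n \<and> u \<in> marked s5 \<and> label s5 u \<le> k + 1} \<union>
              {u. u < n \<and> r < f \<and> label s5 u = k + 1}) - {v}"
            fix s6 assume "stored ?S' s6"
            moreover have "round_ok v r S ?S'"
            proof (rule round_okI)
              show "bfs_inv E S v t t (label s2) (arr s2 10) (arr s2 9)" using inv by (simp add: t_def)
              show "marks_from S v (label s2) (arr s2 10) (arr s2 9) t 1 (marked s5)"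
                using a k4 by (simp add: lab)
              show "radius_ok r (card S) (\<lambda>d. card {u. u < n \<and> label s2 u = d}) k"
                using k(2) by (simp add: layer_def[abs_def])
              show "u < n" if "label s2 u \<noteq> 0" for u using that by (auto simp: label_def split: if_splits)
            qed (use v S lab5 in \<open>auto simp: stored_def\<close>)
            ultimately show "\<exists>S'. stored S' s6 \<and> round_ok v r S S'" by blast
          qed simp
        qed simp_all
      qed simp_all
    qed simp_all
  qed simp_all
qed simp_all

end

section \<open>The spanner program\<close>

definition copy_step :: prog where
  "copy_step = Set_Cell 7 (Reg 3) (Cell 5 (Reg 3))"

definition keep_step :: prog where
  "keep_step =
     If (Add (Mul (Eq (Cell 0 (Reg 4)) (Reg 12)) (Cell 7 (Cell 1 (Reg 4))))
          (Mul (Eq (Cell 1 (Reg 4)) (Reg 12)) (Cell 7 (Cell 0 (Reg 4)))))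
       (Set_Cell 6 (Reg 4) (Const 1)) skip"

definition vertex_prog :: prog where
  "vertex_prog = For 3 (Reg 0) copy_step ;; Set_Cell 7 (Reg 12) (Const 0) ;;
     For 13 (Add (Reg 2) (Const 1)) round_prog ;; For 4 (Reg 1) keep_step"

definition compress_step :: prog where
  "compress_step =
     If (Cell 6 (Reg 4))
       (Set_Cell 0 (Reg 5) (Cell 0 (Reg 4)) ;; Set_Cell 1 (Reg 5) (Cell 1 (Reg 4)) ;; incr 5) skip"

definition compress_prog :: prog where
  "compress_prog = Set_Reg 5 (Const 0) ;; For 4 (Reg 1) compress_step ;; Set_Reg 1 (Reg 5)"

definition dense_prog :: prog where
  "dense_prog = adjacency_prog ;; threshold_prog ;; centers_prog ;; sparse_prog ;;
     For 12 (Reg 0) vertex_prog ;; compress_prog"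

text \<open>Input and output share one format, so doing nothing returns the whole graph. In the
  other branch \<open>n < m\<close> absorbs the terms of order \<open>n * n\<close> into
  \<open>n * m\<close>.\<close>

definition spanner_prog :: prog where
  "spanner_prog = If (Less (Reg 0) (Reg 1)) dense_prog skip"

lemma written_spanner [simp]:
  "wregs copy_step = {}" "warrs copy_step = {7}"
  "wregs keep_step = {20}" "warrs keep_step = {6}"
  "wregs vertex_prog = {3, 4, 13, 14, 15, 16, 17, 18, 19, 20}" "warrs vertex_prog = {6, 7, 8, 9, 10, 11, 12}"
  "wregs compress_step = {5, 20}" "warrs compress_step = {0, 1}"
  "flat compress_step" "cost compress_step = 6"
  by (auto simp: copy_step_def keep_step_def vertex_prog_def compress_step_def)

context ram_graph
begin

text \<open>The machine only stores the current set, whereas the correctness proof needs all of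
  them; the existential quantifier carries this history through the loop.\<close>

definition rounds_ok :: "nat \<Rightarrow> nat set \<Rightarrow> nat \<Rightarrow> nat set \<Rightarrow> bool" where
  "rounds_ok v C r S \<longleftrightarrow> (\<exists>T. T 0 = C - {v} \<and> (\<forall>i<r. round_ok v i (T i) (T (Suc i))) \<and> T r = S)"

lemma rounds_ok_0: "rounds_ok v C 0 (C - {v})"
  unfolding rounds_ok_def by (intro exI[of _ "\<lambda>_. C - {v}"]) auto

lemma rounds_ok_Suc:
  assumes "rounds_ok v C r S" "round_ok v r S S'"
  shows "rounds_ok v C (Suc r) S'"
proof -
  obtain T where T: "T 0 = C - {v}" "\<forall>i<r. round_ok v i (T i) (T (Suc i))" "T r = S"
    using assms(1) unfolding rounds_ok_def by blast
  show ?thesis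
    unfolding rounds_ok_def using T assms(2)
    by (intro exI[of _ "T(Suc r := S')"]) (auto simp: less_Suc_eq)
qed

lemma rounds_ok_notin:
  assumes "rounds_ok v C r S"
  shows "v \<notin> S"
proof -
  obtain T where T: "T 0 = C - {v}" "\<forall>i<r. round_ok v i (T i) (T (Suc i))" "T r = S"
    using assms(1) unfolding rounds_ok_def by blast
  show ?thesis
  proof (cases r)
    case 0
    then show ?thesis using T by auto
  next
    case (Suc i)
    then have "round_ok v i (T i) S" using T by auto
    then obtain k D par M where "round_step E v (T i) k (i < f) D par M S" unfolding round_ok_def by blast
    then show ?thesis by (rule round_stepD(4))
  qed
qed

text \<open>The pairs \<open>{y, u}\<close> need not be edges. Flags exist for listed edges only, so
  the output is the intersection with \<open>E\<close>.\<close>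

definition kept_edges :: "nat set \<Rightarrow> (nat \<Rightarrow> nat set) \<Rightarrow> nat \<Rightarrow> nat set set" where
  "kept_edges C T v = sparse_edges f E C \<union> (\<Union>u\<in>{..<v}. (\<lambda>y. {y, u}) ` T u)"

lemma vertex_correct:
  assumes adj: "adj s" and v: "reg s 12 = v" "v < n" and C: "centers_stored C s" "C \<subseteq> {..<n}"
    and kept: "kept H s"
  shows "tr w vertex_prog s ((f + 1) * (26 * m + 37 * n + 57) + 4 * n + 5 * m + 13)
    (\<lambda>s'. \<exists>S. rounds_ok v C (f + 1) S \<and> kept (H \<union> (\<lambda>y. {y, v}) ` S) s')"
    (is "tr w _ s _ ?Q")
proof -
  let ?R = "(f + 1) * (26 * m + 37 * n + 57) + 3"
  let ?K = "\<lambda>S i s1. \<forall>j<m. arr s1 6 j \<noteq> 0 \<longleftrightarrow> edge j \<in> H \<or> j < i \<and> edge j \<in> (\<lambda>y. {y, v}) ` S"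
  have copy: "tr w (For 3 (Reg 0) copy_step) s (4 * n + 3) (\<lambda>s'. \<forall>u<n. arr s' 7 u = arr s 5 u)"
  proof (rule tr_For[where N = n and c = 1 and I = "\<lambda>i s1. \<forall>u<i. arr s1 7 u = arr s 5 u"])
    fix i s1 assume same: "frame_for 3 copy_step s s1"
    have "adj s1" using same_adj[OF adj same] by simp
    then show "val w s1 (Reg 0) = n" by (simp add: inputD[OF adjD(1)])
    assume "i < n" "\<forall>u<i. arr s1 7 u = arr s 5 u" "reg s1 3 = i"
    then show "tr w copy_step s1 1 (\<lambda>s'. reg s' 3 = i \<and> (\<forall>u<Suc i. arr (set_reg 3 (Suc i) s') 7 u = arr s 5 u))"
      unfolding copy_step_def using sameD(2)[OF same, of 5] by (intro tr_flat) (auto simp: less_Suc_eq)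
  qed (use word_bounds in auto)
  let ?L = "For 13 (Add (Reg 2) (Const 1)) round_prog"
  have rounds: "tr w ?L s2 ?R
      (\<lambda>s'. \<exists>S. stored S s' \<and> rounds_ok v C (f + 1) S)"
    if 2: "adj s2" "reg s2 12 = v" "stored (C - {v}) s2" for s2
  proof (rule tr_For[where N = "f + 1" and c = "26 * m + 37 * n + 54" and
        I = "\<lambda>i s1. \<exists>S. stored S s1 \<and> rounds_ok v C i S"])
    show "\<exists>S. stored S (set_reg 13 0 s2) \<and> rounds_ok v C 0 S"
      using 2(3) rounds_ok_0 by (auto simp: stored_def)
  next
    fix i s3 assume same: "frame_for 13 round_prog s2 s3"
    have adj3: "adj s3" using same_adj[OF 2(1) same] by simp
    have "f + 1 < 2 ^ w" using word_bounds(3) by linarith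
    then show "val w s3 (Add (Reg 2) (Const 1)) = f + 1" by (simp add: inputD[OF adjD(1)[OF adj3]])
    assume i: "i < f + 1" "\<exists>S. stored S s3 \<and> rounds_ok v C i S" "reg s3 13 = i"
    then obtain S where S: "stored S s3" "rounds_ok v C i S" by blast
    have "reg s3 12 = v" using sameD(1)[OF same, of 12] 2(2) by simp
    from round_correct[OF adj3 this v(2) rounds_ok_notin[OF S(2)] i(3) S(1)]
    show "tr w round_prog s3 (26 * m + 37 * n + 54) (\<lambda>s'. reg s' 13 = i \<and>
      (\<exists>S. stored S (set_reg 13 (Suc i) s') \<and> rounds_ok v C (Suc i) S))"
    proof (rule tr_conseq)
      fix s' assume "\<exists>S'. stored S' s' \<and> round_ok v i S S'" and same': "frame round_prog s3 s'"
      then obtain S' where "stored S' s'" "round_ok v i S S'" by blast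
      then have "stored S' (set_reg 13 (Suc i) s') \<and> rounds_ok v C (Suc i) S'"
        using rounds_ok_Suc[OF S(2)] by (simp add: stored_def)
      then show "reg s' 13 = i \<and> (\<exists>S. stored S (set_reg 13 (Suc i) s') \<and> rounds_ok v C (Suc i) S)"
        using sameD(1)[OF same', of 13] i(3) by auto
    qed simp
  next
    show "f + 1 < 2 ^ w" using word_bounds(3) by linarith
  qed simp_all
  have keep: "tr w (For 4 (Reg 1) keep_step) s2 (5 * m + 3) (kept (H \<union> (\<lambda>y. {y, v}) ` S))"
    if 2: "input s2" "reg s2 12 = v" "stored S s2" "kept H s2" for s2 S
  proof (rule tr_For[where N = m and c = 2 and I = "?K S"])
    show "?K S 0 (set_reg 4 0 s2)"
      using 2(4) by (simp add: kept_def)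
  next
    fix i s3 assume same: "frame_for 4 keep_step s2 s3"
    have inp: "input s3" using same_input[OF 2(1) same] by simp
    then show "val w s3 (Reg 1) = m" by (simp add: inputD)
    assume i: "i < m" "?K S i s3" "reg s3 4 = i"
    have k: "reg s3 12 = v" "\<forall>u<n. arr s3 7 u = of_bool (u \<in> S)"
      using sameD[OF same] 2(2,3) by (auto simp: stored_def)
    let ?a = "fst (es ! i)" and ?b = "snd (es ! i)"
    have e: "edge i \<in> (\<lambda>y. {y, v}) ` S \<longleftrightarrow> ?a = v \<and> ?b \<in> S \<or> ?b = v \<and> ?a \<in> S"
      by (auto simp: edge_def doubleton_eq_iff)
    have c: "val w s3 (Add (Mul (Eq (Cell 0 (Reg 4)) (Reg 12)) (Cell 7 (Cell 1 (Reg 4))))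
          (Mul (Eq (Cell 1 (Reg 4)) (Reg 12)) (Cell 7 (Cell 0 (Reg 4))))) \<noteq> 0 \<longleftrightarrow> edge i \<in> (\<lambda>y. {y, v}) ` S"
      unfolding e using k i(1,3) inputD(5-7)[OF inp i(1)] edge_endpoints[OF i(1)] by auto
    let ?r = "result w keep_step s3"
    have "arr ?r 6 = (if edge i \<in> (\<lambda>y. {y, v}) ` S then (arr s3 6)(i := 1) else arr s3 6)" "reg ?r 4 = i"
      unfolding keep_step_def result.simps c using i(3) by auto
    then have "reg ?r 4 = i \<and> ?K S (Suc i) (set_reg 4 (Suc i) ?r)"
      using i(1,2) by (auto simp: less_Suc_eq)
    then show "tr w keep_step s3 2 (\<lambda>s'. reg s' 4 = i \<and> ?K S (Suc i) (set_reg 4 (Suc i) s'))"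
      by (intro tr_flat) (simp_all add: keep_step_def)
  next
    fix s3 :: state assume "?K S m s3"
    then show "kept (H \<union> (\<lambda>y. {y, v}) ` S) s3" by (auto simp: kept_def)
  qed (use word_bounds in auto)
  show ?thesis unfolding vertex_prog_def
  proof (rule tr_Seq[OF copy, where T' = "?R + 5 * m + 6"])
    fix s1 assume 1: "\<forall>u<n. arr s1 7 u = arr s 5 u"
      and same: "frame (For 3 (Reg 0) copy_step) s s1"
    let ?s = "set_cell 7 v 0 s1"
    have adj1: "adj s1" using same_adj[OF adj same] by simp
    have k1: "reg s1 12 = v" "kept H s1" using sameD[OF same] v(1) kept by (auto simp: kept_def)
    have adj2: "adj ?s" using same_adj[OF adj1, of "{}" "{7}"] by (simp add: same_def)
    have S2: "stored (C - {v}) ?s" using 1 C by (auto simp: stored_def centers_stored_def)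
    show "tr w (Set_Cell 7 (Reg 12) (Const 0) ;; ?L ;;
       For 4 (Reg 1) keep_step) s1 (?R + 5 * m + 6)
      ?Q"
    proof (rule tr_Seq[where T = 1 and Q = "\<lambda>s2. s2 = ?s" and T' = "?R + 5 * m + 4"], rule tr_flat)
      fix s2 assume s2: "s2 = ?s"
      have "tr w ?L s2 ?R (\<lambda>s'. \<exists>S. stored S s' \<and> rounds_ok v C (f + 1) S)"
        using adj2 k1 S2 unfolding s2 by (intro rounds) auto
      then show "tr w (?L ;; For 4 (Reg 1) keep_step) s2 (?R + 5 * m + 4)
        ?Q"
      proof (rule tr_Seq[where T' = "5 * m + 3"])
        fix s3 assume "\<exists>S. stored S s3 \<and> rounds_ok v C (f + 1) S"
          and same: "frame ?L s2 s3"
        then obtain S where S: "stored S s3" "rounds_ok v C (f + 1) S" by blast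
        have "adj s3" using same_adj[OF adj2[folded s2] same] by simp
        moreover have "reg s3 12 = v" "kept H s3" using sameD[OF same] k1 by (auto simp: s2 kept_def)
        ultimately have "tr w (For 4 (Reg 1) keep_step) s3 (5 * m + 3) (kept (H \<union> (\<lambda>y. {y, v}) ` S))"
          using S(1) adjD(1) by (intro keep) auto
        then show "tr w (For 4 (Reg 1) keep_step) s3 (5 * m + 3)
          ?Q"
          by (rule tr_conseq) (use S(2) in auto)
      qed simp
    qed (use k1 in auto)
  qed simp
qed

text \<open>Compaction in place is safe because the write position never exceeds the read position:
  the entries from \<open>i\<close> on are still those of the input.\<close>

lemma compress_correct:
  assumes inp: "input s" and kept: "kept H s"
  shows "tr w compress_prog s (9 * m + 7) (\<lambda>s'. output_edges ([], s') = E \<inter> H)"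
    (is "tr w _ s _ ?Q")
proof -
  let ?s = "set_reg 5 0 s"
  let ?out = "\<lambda>s t. (\<lambda>i. {arr s 0 i, arr s 1 i}) ` {..<t}"
  let ?I = "\<lambda>i s1. reg s1 5 \<le> i \<and> ?out s1 (reg s1 5) = edge ` {j. j < i \<and> edge j \<in> H} \<and>
    (\<forall>j<m. i \<le> j \<longrightarrow> arr s1 0 j = fst (es ! j) \<and> arr s1 1 j = snd (es ! j))"
  have k: "arr s 6 j \<noteq> 0 \<longleftrightarrow> edge j \<in> H" if "j < m" for j using kept that by (simp add: kept_def)
  have loop: "tr w (For 4 (Reg 1) compress_step) ?s (9 * m + 3)
      (\<lambda>s'. ?out s' (reg s' 5) = edge ` {j. j < m \<and> edge j \<in> H})"
  proof (rule tr_For[where N = m and c = 6 and I = ?I])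
    show "?I 0 (set_reg 4 0 ?s)"
      using inputD(5,7)[OF inp] by simp
  next
    fix i s1 assume same: "frame_for 4 compress_step ?s s1"
    show "val w s1 (Reg 1) = m" using sameD(1)[OF same, of 1] inputD(3)[OF inp] by simp
    assume i: "i < m" "reg s1 4 = i" and I: "?I i s1"
    define t where "t = reg s1 5"
    have t: "t \<le> i" and out: "?out s1 t = edge ` {j. j < i \<and> edge j \<in> H}" using I by (auto simp: t_def)
    have a: "arr s1 0 i = fst (es ! i)" "arr s1 1 i = snd (es ! i)" using I i(1) by auto
    have flag: "arr s1 6 i \<noteq> 0 \<longleftrightarrow> edge i \<in> H" using sameD(2)[OF same, of 6] k[OF i(1)] by simp
    have ov: "Suc t < 2 ^ w" using t i(1) word_bounds(2) by linarith
    let ?r = "result w compress_step s1"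
    show "tr w compress_step s1 6 (\<lambda>s'. reg s' 4 = i \<and> ?I (Suc i) (set_reg 4 (Suc i) s'))"
    proof (cases "edge i \<in> H")
      case True
      have r: "arr ?r 0 = (arr s1 0)(t := fst (es ! i))" "arr ?r 1 = (arr s1 1)(t := snd (es ! i))"
        "reg ?r 5 = Suc t" "reg ?r 4 = i"
        using True flag a ov i(2) t by (auto simp: compress_step_def t_def[symmetric])
      have "?out ?r (Suc t) = insert (edge i) (?out s1 t)"
        unfolding r lessThan_Suc by (auto simp: edge_def)
      also have "\<dots> = edge ` {j. j < Suc i \<and> edge j \<in> H}" unfolding out using True by (auto simp: less_Suc_eq)
      finally have "?out ?r (Suc t) = edge ` {j. j < Suc i \<and> edge j \<in> H}" .
      then show ?thesis using r t I
        by (intro tr_flat) simp_all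
    next
      case False
      have r: "arr ?r 0 = arr s1 0" "arr ?r 1 = arr s1 1" "reg ?r 5 = t" "reg ?r 4 = i"
        using False flag i(2) by (auto simp: compress_step_def t_def)
      have "{j. j < Suc i \<and> edge j \<in> H} = {j. j < i \<and> edge j \<in> H}" using False by (auto simp: less_Suc_eq)
      then show ?thesis using r t I out
        by (intro tr_flat) simp_all
    qed
  qed (use word_bounds in auto)
  have E: "edge ` {j. j < m \<and> edge j \<in> H} = E \<inter> H" using edge_image by auto
  show ?thesis unfolding compress_prog_def
  proof (rule tr_Seq[where T = 1 and Q = "\<lambda>s1. s1 = ?s"], rule tr_flat)
    fix s1 assume s1: "s1 = ?s"
    show "tr w (For 4 (Reg 1) compress_step ;; Set_Reg 1 (Reg 5)) s1 (9 * m + 5) ?Q"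
      unfolding s1
    proof (rule tr_Seq[OF loop, where T' = 1])
      fix s2 :: state assume "?out s2 (reg s2 5) = edge ` {j. j < m \<and> edge j \<in> H}"
      then show "tr w (Set_Reg 1 (Reg 5)) s2 1 ?Q"
        unfolding E by (intro tr_flat) (simp_all add: output_edges_def Let_def)
    qed simp
  qed simp_all
qed

definition good_output :: "nat set set \<Rightarrow> bool" where
  "good_output H \<longleftrightarrow> additive_FT_spanner 2 f {..<n} E H \<and>
     real (card H) \<le> 76 * (real f * real n powr (2 - 1 / (2 ^ f + 1)))"

lemma good_output_kept:
  assumes n: "n \<ge> 1" and f: "f \<ge> 1"
    and \<sigma>: "\<sigma> \<ge> 1" "n \<le> \<sigma> ^ (2 ^ f + 1)" "(\<sigma> - 1) ^ (2 ^ f + 1) < n"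
    and C: "center_set n f ((f + 1) * n div \<sigma> + 1) E C"
    and T: "\<And>v. v < n \<Longrightarrow> rounds_ok v C (f + 1) (T v)"
  shows "good_output (E \<inter> kept_edges C T n)"
proof -
  have "\<forall>v. \<exists>S. v < n \<longrightarrow> S 0 = C - {v} \<and> (\<forall>i<f + 1. round_ok v i (S i) (S (Suc i))) \<and> S (f + 1) = T v"
    using T unfolding rounds_ok_def by auto
  then obtain S where S: "\<And>v. v < n \<Longrightarrow> S v 0 = C - {v} \<and>
      (\<forall>i<f + 1. round_ok v i (S v i) (S v (Suc i))) \<and> S v (f + 1) = T v"
    by metis
  then have S0: "S v 0 = C - {v}" and Sf: "S v (Suc f) = T v" if "v < n" for v using that by auto
  have Si: "round_ok v i (S v i) (S v (Suc i))" if "v < n" "i < Suc f" for v i using S that by auto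
  let ?H = "E \<inter> kept_edges C T n"
  have "additive_FT_spanner 2 f {..<n} E ?H"
  proof (rule spanner_correct[where S = S and C = C])
    show "\<exists>k D par M. round_step E v (S v i) k True D par M (S v (Suc i))" if "v \<in> {..<n}" "i < f" for v i
      using Si[of v i] that unfolding round_ok_def by auto
    show "\<exists>k D par M. round_step E v (S v f) k False D par M (S v (Suc f))" if "v \<in> {..<n}" for v
      using Si[of v f] that unfolding round_ok_def by auto
    show "S v 0 = C - {v}" if "v \<in> {..<n}" for v using S0 that by simp
    show "{y, v} \<in> ?H" if "v \<in> {..<n}" "y \<in> S v (Suc f)" "{y, v} \<in> E" for v y
      using that Sf[of v] unfolding kept_edges_def by blast
    show "f < card {c \<in> C. {c, a} \<in> E}" if "{a, b} \<in> E" "{a, b} \<notin> ?H" for a b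
      using that unfolding kept_edges_def sparse_edges_def by auto
    show "e \<subseteq> {..<n}" if "e \<in> E" for e using graph that unfolding simple_graph_def by blast
  qed (auto simp: finite_E)
  moreover have "real (card ?H) \<le> 76 * (real f * real n powr (2 - 1 / (2 ^ f + 1)))"
  proof (rule spanner_size[where S = S and C = C and E = E and \<sigma> = \<sigma>])
    show "(card (S v (Suc i)))\<^sup>2 \<le> 36 * n * card (S v i)" if "v < n" "i < f" for v i
      using Si[of v i] that unfolding round_ok_def by auto
    show "card (S v (Suc f)) \<le> 2 * card (S v f)" if "v < n" for v
      using Si[of v f] that unfolding round_ok_def by auto
    show "finite (S v (Suc f))" if "v < n" for v
      using Si[of v f] that finite_subset[of _ "{..<n}"] unfolding round_ok_def by auto
    show "?H \<subseteq> sparse_edges f E C \<union> (\<Union>v\<in>{..<n}. (\<lambda>y. {y, v}) ` S v (Suc f))"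
      unfolding kept_edges_def using Sf by auto
  qed (use n f \<sigma> C S0 graph in auto)
  ultimately show ?thesis by (simp add: good_output_def)
qed

lemma vertices_correct:
  assumes adj: "adj s" and C: "centers_stored C s" "C \<subseteq> {..<n}" and kept: "kept (sparse_edges f E C) s"
  shows "tr w (For 12 (Reg 0) vertex_prog) s (n * ((f + 1) * (26 * m + 37 * n + 57) + 4 * n + 5 * m + 16) + 3)
    (\<lambda>s'. \<exists>T. (\<forall>v<n. rounds_ok v C (f + 1) (T v)) \<and> kept (kept_edges C T n) s')"
proof -
  let ?I = "\<lambda>v s1. \<exists>T. (\<forall>u<v. rounds_ok u C (f + 1) (T u)) \<and> kept (kept_edges C T v) s1"
  show ?thesis
proof (rule tr_For[where N = n and c = "(f + 1) * (26 * m + 37 * n + 57) + 4 * n + 5 * m + 13" and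
      I = ?I])
  show "?I 0 (set_reg 12 0 s)"
    using kept by (auto simp: kept_edges_def kept_def)
next
  fix v s1 assume same: "frame_for 12 vertex_prog s s1"
  have adj1: "adj s1" using same_adj[OF adj same] by simp
  then show "val w s1 (Reg 0) = n" by (simp add: inputD[OF adjD(1)])
  assume v: "v < n" "reg s1 12 = v" and "?I v s1"
  then obtain T where T: "\<forall>u<v. rounds_ok u C (f + 1) (T u)" "kept (kept_edges C T v) s1" by blast
  have "centers_stored C s1" using C(1) sameD(2)[OF same] by (simp add: centers_stored_def)
  from vertex_correct[OF adj1 v(2,1) this C(2) T(2)]
  show "tr w vertex_prog s1 ((f + 1) * (26 * m + 37 * n + 57) + 4 * n + 5 * m + 13) (\<lambda>s'. reg s' 12 = v \<and>
    ?I (Suc v) (set_reg 12 (Suc v) s'))"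
  proof (rule tr_conseq)
    fix s' assume "\<exists>S. rounds_ok v C (f + 1) S \<and> kept (kept_edges C T v \<union> (\<lambda>y. {y, v}) ` S) s'"
      and same': "frame vertex_prog s1 s'"
    then obtain S where S: "rounds_ok v C (f + 1) S" "kept (kept_edges C T v \<union> (\<lambda>y. {y, v}) ` S) s'" by blast
    have "(\<Union>u\<in>{..<v}. (\<lambda>y. {y, u}) ` (T(v := S)) u) = (\<Union>u\<in>{..<v}. (\<lambda>y. {y, u}) ` T u)"
      by (intro SUP_cong) auto
    then have "kept_edges C (T(v := S)) (Suc v) = kept_edges C T v \<union> (\<lambda>y. {y, v}) ` S"
      unfolding kept_edges_def lessThan_Suc by (simp add: Un_ac)
    then have "(\<forall>u<Suc v. rounds_ok u C (f + 1) ((T(v := S)) u)) \<and>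
        kept (kept_edges C (T(v := S)) (Suc v)) (set_reg 12 (Suc v) s')"
      using S T(1) by (auto simp: kept_def less_Suc_eq)
    then have "?I (Suc v) (set_reg 12 (Suc v) s')" by (rule exI[where x = "T(v := S)"])
    then show "reg s' 12 = v \<and> ?I (Suc v) (set_reg 12 (Suc v) s')"
      using sameD(1)[OF same', of 12] v(2) by auto
  qed simp
qed (use word_bounds in auto)
qed

section \<open>Total running time and the final statement\<close>

abbreviation dense_time :: nat where
  "dense_time \<equiv> (n * (7 * m + 8) + 7) + (n * (7 * f + 14) + 8) + (n * (9 * n + 16) + 3) + (4 * m + 3) +
      (n * ((f + 1) * (26 * m + 37 * n + 57) + 4 * n + 5 * m + 16) + 3) + (9 * m + 7) + 5"

lemma dense_correct:
  assumes inp: "input s" and zero: "\<forall>u<n. arr s 4 u = 0" "\<forall>u<n. arr s 5 u = 0" and nf: "n \<ge> 1" "f \<ge> 1"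
  shows "tr w dense_prog s dense_time
    (\<lambda>s'. good_output (output_edges ([], s')))"
proof -
  let ?t5 = "n * ((f + 1) * (26 * m + 37 * n + 57) + 4 * n + 5 * m + 16) + 3"
  let ?t4 = "(4 * m + 3) + ?t5 + (9 * m + 7) + 2"
  let ?t3 = "(n * (9 * n + 16) + 3) + ?t4 + 1"
  let ?t2 = "(n * (7 * f + 14) + 8) + ?t3 + 1"
  let ?Q = "\<lambda>s'. good_output (output_edges ([], s'))"
  let ?p5 = "For 12 (Reg 0) vertex_prog ;; compress_prog"
  let ?p4 = "sparse_prog ;; ?p5"
  let ?p3 = "centers_prog ;; ?p4"
  show ?thesis unfolding dense_prog_def
  proof (rule tr_Seq[OF adjacency_correct[OF inp], where T' = ?t2])
    fix s1 assume adj1: "adj s1" and same1: "frame adjacency_prog s s1"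
    show "tr w (threshold_prog ;; ?p3) s1 ?t2 ?Q"
    proof (rule tr_Seq[OF threshold_correct[OF adjD(1)[OF adj1] nf(1)], where T' = ?t3])
      fix s2 assume "\<exists>\<sigma>\<ge>1. n \<le> \<sigma> ^ (2 ^ f + 1) \<and> (\<sigma> - 1) ^ (2 ^ f + 1) < n \<and> reg s2 9 = (f + 1) * n div \<sigma> + 1"
        and same2: "frame threshold_prog s1 s2"
      then obtain \<sigma> where \<sigma>: "\<sigma> \<ge> 1" "n \<le> \<sigma> ^ (2 ^ f + 1)" "(\<sigma> - 1) ^ (2 ^ f + 1) < n"
        "reg s2 9 = (f + 1) * n div \<sigma> + 1" by blast
      have adj2: "adj s2" using same_adj[OF adj1 same2] by simp
      have z: "\<forall>u<n. arr s2 4 u = 0" "\<forall>u<n. arr s2 5 u = 0"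
        using zero sameD(2)[OF same1] sameD(2)[OF same2] by auto
      show "tr w ?p3 s2 ?t3 ?Q"
      proof (rule tr_Seq[OF centers_correct[OF adj2 \<sigma>(4) z], where T' = ?t4])
        fix s3 assume "\<exists>C. centers_stored C s3 \<and> center_set n f ((f + 1) * n div \<sigma> + 1) E C"
          and same3: "frame centers_prog s2 s3"
        then obtain C where C: "centers_stored C s3" "center_set n f ((f + 1) * n div \<sigma> + 1) E C" by blast
        have Cn: "C \<subseteq> {..<n}" using C(2) by (simp add: center_set_def)
        have adj3: "adj s3" using same_adj[OF adj2 same3] by simp
        show "tr w ?p4 s3 ?t4 ?Q"
        proof (rule tr_Seq[OF sparse_correct[OF adj3 C(1)], where T' = "?t5 + (9 * m + 7) + 1"])
          fix s4 assume 4: "kept (sparse_edges f E C) s4" and same4: "frame sparse_prog s3 s4"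
          have adj4: "adj s4" using same_adj[OF adj3 same4] by simp
          have C4: "centers_stored C s4" using C(1) sameD(2)[OF same4] by (simp add: centers_stored_def)
          show "tr w ?p5 s4 (?t5 + (9 * m + 7) + 1) ?Q"
          proof (rule tr_Seq[OF vertices_correct[OF adj4 C4 Cn 4], where T' = "9 * m + 7"])
            fix s5 assume "\<exists>T. (\<forall>v<n. rounds_ok v C (f + 1) (T v)) \<and> kept (kept_edges C T n) s5"
              and same5: "frame (For 12 (Reg 0) vertex_prog) s4 s5"
            then obtain T where T: "\<And>v. v < n \<Longrightarrow> rounds_ok v C (f + 1) (T v)" "kept (kept_edges C T n) s5" by blast
            have "adj s5" using same_adj[OF adj4 same5] by simp
            from compress_correct[OF adjD(1)[OF this] T(2)]
            show "tr w compress_prog s5 (9 * m + 7) ?Q"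
              by (rule tr_conseq) (use good_output_kept[OF nf \<sigma>(1-3) C(2) T(1)] in auto)
          qed simp
        qed simp
      qed simp
    qed simp
  qed simp
qed

text \<open>The exponent \<open>2 - 1 / (2 ^ f + 1)\<close> is at least \<open>1\<close>, so a graph
  with at most \<open>n\<close> edges meets the size bound as it is.\<close>

lemma good_output_all:
  assumes n: "n \<ge> 1" and f: "f \<ge> 1" and m: "m \<le> n"
  shows "good_output E"
proof -
  have "additive_FT_spanner 2 f {..<n} E E"
    unfolding additive_FT_spanner_def by (auto intro: order_trans[OF _ le_iff_add[THEN iffD2]])
  moreover have "real (card E) \<le> 76 * (real f * real n powr (2 - 1 / (2 ^ f + 1)))"
  proof -
    have "real (card E) \<le> real n powr 1" using m n es by (simp add: lists_edges_def)
    have "1 / (2 ^ f + 1) \<le> (1 :: real)" by (simp add: divide_le_eq_1 add_pos_pos)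
    then have "real n powr 1 \<le> real n powr (2 - 1 / (2 ^ f + 1))"
      using n by (intro powr_mono) auto
    with \<open>real (card E) \<le> real n powr 1\<close>
    have "real (card E) \<le> real n powr (2 - 1 / (2 ^ f + 1))" by (rule order_trans)
    also have "\<dots> \<le> (76 * real f) * real n powr (2 - 1 / (2 ^ f + 1))"
      using f mult_right_mono[of 1 "76 * real f" "real n powr (2 - 1 / (2 ^ f + 1))"] by simp
    finally show ?thesis by simp
  qed
  ultimately show ?thesis by (simp add: good_output_def)
qed

lemma spanner_prog_correct:
  assumes nf: "n \<ge> 1" "f \<ge> 1"
  shows "tr w spanner_prog (input_state n f es) (500 * (f * n * max 1 m)) (\<lambda>s'. good_output (output_edges ([], s')))"
proof -
  let ?s = "input_state n f es"
  let ?Q = "\<lambda>s'. good_output (output_edges ([], s'))"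
  have inp: "input ?s" by (simp add: input_def input_state_def)
  show ?thesis unfolding spanner_prog_def
  proof (rule tr_If[where T = "500 * (f * n * max 1 m) - 1"])
    assume "val w ?s (Less (Reg 0) (Reg 1)) \<noteq> 0"
    then have nm: "n < m" using inputD[OF inp] by (auto split: if_splits)
    let ?X = "f * n * m"
    have "1 * n * 1 \<le> ?X" "1 * n * m \<le> ?X" "f * n * 1 \<le> ?X" "1 * n * n \<le> ?X" "f * n * n \<le> ?X" "1 * 1 * m \<le> ?X"
      using nf nm by (intro mult_le_mono; simp)+
    then have b: "n \<le> ?X" "n * m \<le> ?X" "f * n \<le> ?X" "n * n \<le> ?X" "f * (n * n) \<le> ?X" "m \<le> ?X" "1 \<le> ?X"
      using nf nm by (auto simp: mult.assoc)
    have "dense_time =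
      38 * (n * m) + 111 * n + 64 * (f * n) + 50 * (n * n) + 26 * ?X + 37 * (f * (n * n)) + 13 * m + 36"
      by (simp add: algebra_simps)
    \<comment> \<open>Each monomial is at most \<open>?X\<close>, and the coefficients add up to
      \<open>375\<close>; the slack covers the subtracted \<open>1\<close>.\<close>
    also have "\<dots> \<le> 500 * ?X - 1" using b by linarith
    finally have T: "dense_time \<le>
      500 * (f * n * max 1 m) - 1" using nm by simp
    show "tr w dense_prog ?s (500 * (f * n * max 1 m) - 1) ?Q"
      by (rule tr_conseq[OF dense_correct[OF inp _ _ nf] T]) (auto simp: input_state_def)
  next
    assume "val w ?s (Less (Reg 0) (Reg 1)) = 0"
    then have mn: "m \<le> n" using inputD[OF inp] by (auto split: if_splits)
    have "output_edges ([], set_reg 20 0 ?s) = edge ` {..<m}"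
      using inputD[OF inp] by (auto simp: output_edges_def Let_def edge_def)
    then have "good_output (output_edges ([], set_reg 20 0 ?s))"
      using good_output_all[OF nf mn] edge_image by simp
    \<comment> \<open>An edgeless graph still needs a few steps, which \<open>max 1 m\<close>
      provides.\<close>
    moreover have "1 * 1 * 1 \<le> f * n * max 1 m" using nf by (intro mult_le_mono) auto
    then have "1 \<le> 500 * (f * n * max 1 m) - 1" by linarith
    ultimately show "tr w skip ?s (500 * (f * n * max 1 m) - 1) ?Q"
      by (intro tr_flat) simp_all
  next
    have "1 * 1 * 1 \<le> f * n * max 1 m" using nf by (intro mult_le_mono) auto
    then show "500 * (f * n * max 1 m) - 1 + 1 \<le> 500 * (f * n * max 1 m)" by simp
  qed
qed

end

lemma word_length_bound: "(n + f + 2) ^ \<kappa> \<le> 2 ^ word_length \<kappa> n f"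
proof -
  let ?z = "n + f + 2" and ?l = "nat \<lceil>log 2 (real (n + f + 2))\<rceil>"
  have "real ?z = 2 powr log 2 (real ?z)" by simp
  also have "\<dots> \<le> 2 powr real ?l" by (intro powr_mono) (auto intro: real_nat_ceiling_ge)
  also have "\<dots> = 2 ^ ?l" by (rule powr_realpow) simp
  also have "\<dots> = real (2 ^ ?l)" by (simp only: of_nat_power of_nat_numeral)
  finally have "?z \<le> 2 ^ ?l" by (simp only: of_nat_le_iff)
  then have "?z ^ \<kappa> \<le> (2 ^ ?l) ^ \<kappa>" by (rule power_mono) simp
  then show ?thesis by (simp add: word_length_def mult.commute flip: power_mult)
qed

theorem theorem2:
  fixes c :: real
  assumes "c \<ge> 2"
  shows "\<exists>(P :: prog) (\<kappa> :: nat) (time :: nat \<times> nat \<times> nat \<Rightarrow> nat) (size :: nat \<times> nat \<Rightarrow> real).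
    (\<lambda>x. real (time x)) \<in> soft_O {(n, m, f). n \<ge> 1 \<and> f \<ge> 1} fst
      (\<lambda>(n, m, f). real f * real n * real (max 1 m)) \<and>
    size \<in> soft_O {(n, f). n \<ge> 1 \<and> f \<ge> 1} fst
      (\<lambda>(n, f). real f * real n powr (2 - 1 / (2 ^ f + 1))) \<and>
    (\<forall>(n :: nat) (m :: nat) (f :: nat) (E :: nat set set) (es :: (nat \<times> nat) list).
      n \<ge> 1 \<and> f \<ge> 1 \<and> simple_graph {..<n} E \<and> m = card E \<and> lists_edges es E \<longrightarrow>
      (let R = run (word_length \<kappa> n f) (time (n, m, f)) ([P], input_state n f es)
       in (\<forall>cfg \<in> set_pmf R. halted cfg) \<and>
          measure_pmf.prob R
            {cfg. additive_FT_spanner 2 f {..<n} E (output_edges cfg) \<and>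
                  real (card (output_edges cfg)) \<le> size (n, f)}
          \<ge> 1 - 1 / real n powr c))"
proof -
  let ?time = "\<lambda>(n, m, f). 500 * (f * n * max 1 m) :: nat"
  let ?size = "\<lambda>(n, f). 76 * (real f * real n powr (2 - 1 / (2 ^ f + 1)))"
  have time: "(\<lambda>x. real (?time x)) \<in> soft_O {(n, m, f). n \<ge> 1 \<and> f \<ge> 1} fst
      (\<lambda>(n, m, f). real f * real n * real (max 1 m))"
    unfolding soft_O_def by (intro CollectI exI[of _ 500] exI[of _ 0]) auto
  have size: "?size \<in> soft_O {(n, f). n \<ge> 1 \<and> f \<ge> 1} fst
      (\<lambda>(n, f). real f * real n powr (2 - 1 / (2 ^ f + 1)))"
    unfolding soft_O_def by (intro CollectI exI[of _ 76] exI[of _ 0]) auto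
  have run: "let R = run (word_length 3 n f) (?time (n, m, f)) ([spanner_prog], input_state n f es)
       in (\<forall>cfg \<in> set_pmf R. halted cfg) \<and>
          measure_pmf.prob R
            {cfg. additive_FT_spanner 2 f {..<n} E (output_edges cfg) \<and>
                  real (card (output_edges cfg)) \<le> ?size (n, f)}
          \<ge> 1 - 1 / real n powr c"
    if *: "n \<ge> 1 \<and> f \<ge> 1 \<and> simple_graph {..<n} E \<and> m = card E \<and> lists_edges es E" for n m f E es
  proof -
    interpret ram_graph "word_length 3 n f" n f E es
      using * word_length_bound by unfold_locales auto
    have len: "length es = m" using * by (simp add: lists_edges_def)
    obtain t s' where 1: "exec (word_length 3 n f) spanner_prog (input_state n f es) t s'"
      "t \<le> ?time (n, m, f)" "good_output (output_edges ([], s'))"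
      using spanner_prog_correct * unfolding tr_def len by auto
    \<comment> \<open>The result is a point mass at a halted configuration with a good output, so
      the success probability is \<open>1\<close>.\<close>
    have "run (word_length 3 n f) (?time (n, m, f)) ([spanner_prog], input_state n f es) = return_pmf ([], s')"
      using 1(1,2) by (rule exec_run_halted)
    then show ?thesis using 1(3) by (simp add: halted_def good_output_def indicator_def)
  qed
  show ?thesis
    by (intro exI[of _ spanner_prog] exI[of _ 3] exI[of _ ?time] exI[of _ ?size] conjI time size allI impI)
      (rule run)
qed

end
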